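(* Let $a<b$ be real numbers, and let $f:[a,b]\to\mathbb{R}$ and $g:[a,b]\to\mathbb{R}_+$ be functions that extend to $C^2$ functions on an open interval containing $[a,b]$. Assume that $g(x)=0$ if and only if $x\in\{a,b\}$, that $g'(a)\ne0$ and $g'(b)\neq0$, and that $f(a)\ge0$ and $f(b)\le0$. Consider the It\^o SDE $$dX_t=f(X_t)\,dt+\sqrt{2g(X_t)}\,dW_t,\qquad X_0=x_0\in[a,b],$$ with finite state space $[a,b]$, and suppose that both boundary points $a$ and $b$ are accessible, that at least one of them is absorbing, and that the other is either absorbing or reflecting. Then the solution is absorbed in finite mean time; that is, for each $x_0\in[a,b]$, if $\mathcal A\subseteq\{a,b\}$ denotes the set of absorbing boundary points and $\tau_{x_0}:=\inf\{t\ge0: X_t\in\mathcal A\}$ for the solution with $X_0=x_0$, then $\mathbb{E}(\tau_{x_0})<\infty$.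
   Context: $\mathbb{R}_+=[0,\infty)$. $W$ is a Brownian motion with respect to a filtration $\{\mathcal F_t\}_{t\ge0}$ ($W_t$ is $\mathcal F_t$-measurable and $W_t-W_s$ is independent of $\mathcal F_s$ for $0\le s<t$), and the SDE is understood in the It\^o sense. Under the stated assumptions on $f$ and $g$ the SDE has a unique strong solution, with values in $[a,b]$ and defined for all $t\ge0$, for each $x_0\in[a,b]$. Derivatives at $a$ and $b$ are those of the $C^2$ extensions. A boundary point $c\in\{a,b\}$ is accessible if the solution (started from an interior point $x_0\in(a,b)$) reaches $c$ in finite time with positive probability. It is absorbing if the constant process $X_t=c$ is a solution of the SDE when it is initialized at $X_0=c$. An accessible boundary point $c$ is instantaneously reflecting if the Lebesgue measure of $\{t:X_t=c\}$ is zero almost surely, slowly reflecting if the Lebesgue measure of $\{t:X_t=c\}$ is finite almost surely, and reflecting if it is either instantaneously or slowly reflecting. *)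

theory Defs
  imports "HOL-Probability.Probability" "HOL-Probability.Stopping_Time"
begin

definition C2_on :: "real set \<Rightarrow> (real \<Rightarrow> real) \<Rightarrow> bool" where
  "C2_on S h \<longleftrightarrow> (\<exists>h' h''.
     (\<forall>x\<in>S. (h has_real_derivative h' x) (at x) \<and> (h' has_real_derivative h'' x) (at x)) \<and>
     continuous_on S h'')"

definition C2_extension :: "real \<Rightarrow> real \<Rightarrow> (real \<Rightarrow> real) \<Rightarrow> (real \<Rightarrow> real) \<Rightarrow> bool" where
  "C2_extension a b h hx \<longleftrightarrow>
     (\<exists>l u. l < a \<and> b < u \<and> C2_on {l<..<u} hx) \<and> (\<forall>x\<in>{a..b}. hx x = h x)"

text \<open>Time is indexed by the reals, but only nonnegative times matter: a filtration on the half-line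
  is extended to negative times by its value at time 0.  Neither completeness nor right-continuity
  of the filtration is required.\<close>

locale brownian_motion = prob_space M + filtration "space M" F
  for M :: "'w measure" and F :: "real \<Rightarrow> 'w measure" +
  fixes W :: "real \<Rightarrow> 'w \<Rightarrow> real"
  assumes sets_F_subset: "\<And>t. 0 \<le> t \<Longrightarrow> sets (F t) \<subseteq> sets M"
    and adapted: "\<And>t. 0 \<le> t \<Longrightarrow> W t \<in> borel_measurable (F t)"
    and starts_at_0: "AE \<omega> in M. W 0 \<omega> = 0"
    and continuous_paths: "AE \<omega> in M. continuous_on {0..} (\<lambda>t. W t \<omega>)"
    and normal_increments: "\<And>s t. 0 \<le> s \<Longrightarrow> s < t \<Longrightarrow>
      distributed M lborel (\<lambda>\<omega>. W t \<omega> - W s \<omega>) (\<lambda>x. ennreal (normal_density 0 (sqrt (t - s)) x))"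
    and indep_increments: "\<And>s t. 0 \<le> s \<Longrightarrow> s < t \<Longrightarrow>
      indep_set (sets (F s)) (sets (vimage_algebra (space M) (\<lambda>\<omega>. W t \<omega> - W s \<omega>) borel))"

text \<open>The integrand equals \<open>\<xi> i\<close> on \<open>[p i, p (i + 1))\<close> for \<open>i < n\<close>, where
  \<open>0 = p 0 \<le> \<dots> \<le> p n = t\<close>.\<close>

definition elementary_integrand ::
  "'w measure \<Rightarrow> (real \<Rightarrow> 'w measure) \<Rightarrow> real \<Rightarrow> nat \<Rightarrow> (nat \<Rightarrow> real) \<Rightarrow> (nat \<Rightarrow> 'w \<Rightarrow> real) \<Rightarrow> bool"
where
  "elementary_integrand M F t n p \<xi> \<longleftrightarrow>
     p 0 = 0 \<and> p n = t \<and>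
     (\<forall>i<n. p i \<le> p (Suc i) \<and> \<xi> i \<in> borel_measurable (F (p i)) \<and>
            (\<exists>C. \<forall>\<omega>\<in>space M. \<bar>\<xi> i \<omega>\<bar> \<le> C))"

definition elementary_process ::
  "nat \<Rightarrow> (nat \<Rightarrow> real) \<Rightarrow> (nat \<Rightarrow> 'w \<Rightarrow> real) \<Rightarrow> real \<Rightarrow> 'w \<Rightarrow> real" where
  "elementary_process n p \<xi> s \<omega> = (\<Sum>i<n. \<xi> i \<omega> * indicator {p i..<p (Suc i)} s)"

definition elementary_integral ::
  "(real \<Rightarrow> 'w \<Rightarrow> real) \<Rightarrow> nat \<Rightarrow> (nat \<Rightarrow> real) \<Rightarrow> (nat \<Rightarrow> 'w \<Rightarrow> real) \<Rightarrow> 'w \<Rightarrow> real" where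
  "elementary_integral W n p \<xi> \<omega> = (\<Sum>i<n. \<xi> i \<omega> * (W (p (Suc i)) \<omega> - W (p i) \<omega>))"

text \<open>The standard class of integrands on \<open>[0, t]\<close>: jointly measurable, adapted, square integrable
  for the product of \<open>M\<close> and Lebesgue measure.\<close>

definition ito_integrand ::
  "'w measure \<Rightarrow> (real \<Rightarrow> 'w measure) \<Rightarrow> real \<Rightarrow> (real \<Rightarrow> 'w \<Rightarrow> real) \<Rightarrow> bool" where
  "ito_integrand M F t H \<longleftrightarrow>
     (\<lambda>(s, \<omega>). H s \<omega>) \<in> borel_measurable (restrict_space borel {0..t} \<Otimes>\<^sub>M M) \<and>
     (\<forall>s\<in>{0..t}. H s \<in> borel_measurable (F s)) \<and>
     (\<integral>\<^sup>+\<omega>. (\<integral>\<^sup>+s\<in>{0..t}. ennreal ((H s \<omega>)\<^sup>2) \<partial>lborel) \<partial>M) < \<infinity>"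

text \<open>\<open>J\<close> is a version of the Ito integral of \<open>H\<close> with respect to \<open>W\<close> over \<open>[0, t]\<close>: the mean-square
  limit of the integrals of elementary processes that converge to \<open>H\<close> in mean square.
  It determines \<open>J\<close> up to almost sure equality.\<close>

definition has_ito_integral ::
  "'w measure \<Rightarrow> (real \<Rightarrow> 'w measure) \<Rightarrow> (real \<Rightarrow> 'w \<Rightarrow> real) \<Rightarrow>
   real \<Rightarrow> (real \<Rightarrow> 'w \<Rightarrow> real) \<Rightarrow> ('w \<Rightarrow> real) \<Rightarrow> bool" where
  "has_ito_integral M F W t H J \<longleftrightarrow>
     ito_integrand M F t H \<and> J \<in> borel_measurable M \<and>
     (\<exists>n p \<xi>.
        (\<forall>k::nat. elementary_integrand M F t (n k) (p k) (\<xi> k)) \<and>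
        (\<lambda>k. \<integral>\<^sup>+\<omega>. (\<integral>\<^sup>+s\<in>{0..t}.
            ennreal ((elementary_process (n k) (p k) (\<xi> k) s \<omega> - H s \<omega>)\<^sup>2) \<partial>lborel) \<partial>M)
          \<longlonglongrightarrow> 0 \<and>
        (\<lambda>k. \<integral>\<^sup>+\<omega>. ennreal ((elementary_integral W (n k) (p k) (\<xi> k) \<omega> - J \<omega>)\<^sup>2) \<partial>M)
          \<longlonglongrightarrow> 0)"

definition sde_solution ::
  "'w measure \<Rightarrow> (real \<Rightarrow> 'w measure) \<Rightarrow> (real \<Rightarrow> 'w \<Rightarrow> real) \<Rightarrow> (real \<Rightarrow> real) \<Rightarrow> (real \<Rightarrow> real) \<Rightarrow>
   real \<Rightarrow> real \<Rightarrow> real \<Rightarrow> (real \<Rightarrow> 'w \<Rightarrow> real) \<Rightarrow> bool" where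
  "sde_solution M F W f g a b x0 X \<longleftrightarrow>
     (\<forall>t\<ge>0. X t \<in> borel_measurable (F t)) \<and>
     (\<forall>\<omega>\<in>space M. continuous_on {0..} (\<lambda>t. X t \<omega>)) \<and>
     (\<forall>\<omega>\<in>space M. \<forall>t\<ge>0. X t \<omega> \<in> {a..b}) \<and>
     (AE \<omega> in M. X 0 \<omega> = x0) \<and>
     (\<forall>t\<ge>0. \<exists>J. has_ito_integral M F W t (\<lambda>s \<omega>. sqrt (2 * g (X s \<omega>))) J \<and>
        (AE \<omega> in M. X t \<omega> = x0 + integral {0..t} (\<lambda>s. f (X s \<omega>)) + J \<omega>))"

text \<open>Below, \<open>X x0\<close> is the solution started at \<open>x0\<close>.\<close>

definition accessible ::
  "'w measure \<Rightarrow> real \<Rightarrow> real \<Rightarrow> (real \<Rightarrow> real \<Rightarrow> 'w \<Rightarrow> real) \<Rightarrow> real \<Rightarrow> bool" where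
  "accessible M a b X c \<longleftrightarrow>
     (\<exists>x0\<in>{a<..<b}. measure M {\<omega>\<in>space M. \<exists>t\<ge>0. X x0 t \<omega> = c} > 0)"

definition absorbing ::
  "'w measure \<Rightarrow> (real \<Rightarrow> 'w measure) \<Rightarrow> (real \<Rightarrow> 'w \<Rightarrow> real) \<Rightarrow> (real \<Rightarrow> real) \<Rightarrow> (real \<Rightarrow> real) \<Rightarrow>
   real \<Rightarrow> real \<Rightarrow> real \<Rightarrow> bool" where
  "absorbing M F W f g a b c \<longleftrightarrow> sde_solution M F W f g a b c (\<lambda>t \<omega>. c)"

definition instantaneously_reflecting ::
  "'w measure \<Rightarrow> real \<Rightarrow> real \<Rightarrow> (real \<Rightarrow> real \<Rightarrow> 'w \<Rightarrow> real) \<Rightarrow> real \<Rightarrow> bool" where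
  "instantaneously_reflecting M a b X c \<longleftrightarrow> accessible M a b X c \<and>
     (\<forall>x0\<in>{a<..<b}. AE \<omega> in M. emeasure lborel {t. 0 \<le> t \<and> X x0 t \<omega> = c} = 0)"

definition slowly_reflecting ::
  "'w measure \<Rightarrow> real \<Rightarrow> real \<Rightarrow> (real \<Rightarrow> real \<Rightarrow> 'w \<Rightarrow> real) \<Rightarrow> real \<Rightarrow> bool" where
  "slowly_reflecting M a b X c \<longleftrightarrow> accessible M a b X c \<and>
     (\<forall>x0\<in>{a<..<b}. AE \<omega> in M. emeasure lborel {t. 0 \<le> t \<and> X x0 t \<omega> = c} < \<infinity>)"

definition reflecting ::
  "'w measure \<Rightarrow> real \<Rightarrow> real \<Rightarrow> (real \<Rightarrow> real \<Rightarrow> 'w \<Rightarrow> real) \<Rightarrow> real \<Rightarrow> bool" where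
  "reflecting M a b X c \<longleftrightarrow>
     instantaneously_reflecting M a b X c \<or> slowly_reflecting M a b X c"

text \<open>The value is \<open>\<infinity>\<close> on paths that never enter \<open>A\<close>.\<close>

definition entry_time :: "(real \<Rightarrow> 'w \<Rightarrow> real) \<Rightarrow> real set \<Rightarrow> 'w \<Rightarrow> ennreal" where
  "entry_time Y A \<omega> = (INF t\<in>{t. 0 \<le> t \<and> Y t \<omega> \<in> A}. ennreal t)"

end

theory Submission
  imports Defs
begin

text \<open>If a smooth \<open>\<phi>\<close> with \<open>0 \<le> \<phi> \<le> B\<close> satisfies \<open>f \<phi>' + g \<phi>'' \<le> - \<rho>\<close> on \<open>[a, b]\<close> for some
  \<open>\<rho> \<ge> 0\<close>, then Dynkin's formula bounds the mean of the integral of \<open>\<rho> (X t)\<close> over all times by \<open>B\<close>.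
  For \<open>\<rho>\<close> equal to the indicator of the non-absorbing points this would bound the mean time spent
  outside the absorbing set, which dominates the entry time, without stopping times or the Markov
  property. Such a \<open>\<phi>\<close> is not smooth at an absorbing endpoint \<open>a\<close>, but it is a limit of test
  functions \<open>\<phi>\<^sub>\<epsilon>\<close> that are bounded uniformly in \<open>\<epsilon>\<close>, with \<open>\<rho>\<^sub>\<epsilon>\<close> proportional to
  \<open>w(x) (x - a) / (x - a + \<epsilon>)\<close>. If only one endpoint is absorbing, the drift at the other endpoint
  points strictly inwards and \<open>w\<close> can be taken constant; if both are, \<open>w\<close> is taken to vanish at the
  other endpoint and the estimates for the two endpoints are added.

  Dynkin's formula itself is proved by discretisation: only the first two conditional moments of
  the increments of the stochastic integral are needed, because the path is bounded and continuous.\<close>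

section \<open>Square-integrable functions and Brownian increments\<close>

text \<open>At an endpoint \<open>c\<close> the diffusion vanishes, so the constant process solves
  the equation exactly when \<open>f c = 0\<close>; this turns the boundary classification into sign
  conditions on the drift. At an absorbing endpoint \<open>a\<close> the generator therefore kills
  every smooth test function. This is why \<open>\<rho>\<close> must carry the factor
  \<open>(x - a) / (x - a + \<epsilon>)\<close>, which tends to the indicator of
  \<open>x \<noteq> a\<close>. The square root behind \<open>\<phi>\<close> comes from the simple
  zero of \<open>g\<close>: where \<open>g\<close> is comparable to \<open>x - a\<close>, the
  function \<open>sqrt (x - a)\<close> is bounded, yet \<open>g\<close> times its second derivative
  is of order \<open>- 1 / sqrt (x - a)\<close> and so stays away from zero. In Dynkin's formula the
  obstacle is that the Ito integral is given only as a mean-square limit, separately for each time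
  and with unrelated approximating sequences. The increment over \<open>[s, t]\<close> must first be
  recognised as a limit of simple integrals living on \<open>[s, t]\<close>; only these can be
  multiplied by weights known at time \<open>s\<close>, which yields the conditional
  moments.\<close>

lemma integrable_mult_square_integrable:
  fixes f g :: "'a \<Rightarrow> real"
  assumes [measurable]: "f \<in> borel_measurable N" "g \<in> borel_measurable N"
    and "integrable N (\<lambda>x. (f x)\<^sup>2)" "integrable N (\<lambda>x. (g x)\<^sup>2)"
  shows "integrable N (\<lambda>x. f x * g x)"
proof (rule Bochner_Integration.integrable_bound)
  show "integrable N (\<lambda>x. (f x)\<^sup>2 + (g x)\<^sup>2)" using assms by simp
  have "\<bar>u * v\<bar> \<le> u\<^sup>2 + v\<^sup>2" for u v :: real
  proof -
    have "2 * (\<bar>u\<bar> * \<bar>v\<bar>) \<le> u\<^sup>2 + v\<^sup>2"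
      using sum_squares_bound[of "\<bar>u\<bar>" "\<bar>v\<bar>"] by (simp add: mult.assoc)
    moreover have "0 \<le> \<bar>u\<bar> * \<bar>v\<bar>" by simp
    ultimately show ?thesis unfolding abs_mult by linarith
  qed
  then show "AE x in N. norm (f x * g x) \<le> norm ((f x)\<^sup>2 + (g x)\<^sup>2)" by simp
qed simp

lemma integrable_square_add:
  fixes f g :: "'a \<Rightarrow> real"
  assumes [measurable]: "f \<in> borel_measurable N" "g \<in> borel_measurable N"
    and "integrable N (\<lambda>x. (f x)\<^sup>2)" "integrable N (\<lambda>x. (g x)\<^sup>2)"
  shows "integrable N (\<lambda>x. (f x + g x)\<^sup>2)"
  using assms integrable_mult_square_integrable[OF assms]
  by (simp add: power2_sum mult.assoc)

lemma integrable_square_mult_bounded: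
  fixes f Z :: "'a \<Rightarrow> real"
  assumes [measurable]: "f \<in> borel_measurable N" "Z \<in> borel_measurable N"
    and f: "integrable N (\<lambda>x. (f x)\<^sup>2)" and Z: "\<And>x. x \<in> space N \<Longrightarrow> \<bar>Z x\<bar> \<le> c"
  shows "integrable N (\<lambda>x. (Z x * f x)\<^sup>2)"
proof (rule Bochner_Integration.integrable_bound)
  show "integrable N (\<lambda>x. c\<^sup>2 * (f x)\<^sup>2)" using f by simp
  have "(Z x)\<^sup>2 \<le> c\<^sup>2" if "x \<in> space N" for x using power_mono[OF Z[OF that], of 2] by simp
  then show "AE x in N. norm ((Z x * f x)\<^sup>2) \<le> norm (c\<^sup>2 * (f x)\<^sup>2)"
    by (auto simp: power_mult_distrib intro!: mult_right_mono)
qed simp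

lemma Cauchy_Schwarz_integral:
  fixes f g :: "'a \<Rightarrow> real"
  assumes [measurable]: "f \<in> borel_measurable N" "g \<in> borel_measurable N"
    and f: "integrable N (\<lambda>x. (f x)\<^sup>2)" and g: "integrable N (\<lambda>x. (g x)\<^sup>2)"
  shows "(\<integral>x. \<bar>f x * g x\<bar> \<partial>N) \<le> sqrt (\<integral>x. (f x)\<^sup>2 \<partial>N) * sqrt (\<integral>x. (g x)\<^sup>2 \<partial>N)"
proof -
  have "ennreal (\<integral>x. \<bar>f x * g x\<bar> \<partial>N) = (\<integral>\<^sup>+x. ennreal \<bar>f x * g x\<bar> \<partial>N)"
    using integrable_mult_square_integrable[OF assms] by (intro nn_integral_eq_integral[symmetric]) auto
  also have "\<dots> = (\<integral>\<^sup>+x. ennreal \<bar>f x\<bar> * ennreal \<bar>g x\<bar> \<partial>N)"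
    by (simp add: abs_mult ennreal_mult)
  finally have "ennreal ((\<integral>x. \<bar>f x * g x\<bar> \<partial>N)\<^sup>2) = (\<integral>\<^sup>+x. ennreal \<bar>f x\<bar> * ennreal \<bar>g x\<bar> \<partial>N)\<^sup>2"
    by (simp flip: ennreal_power)
  also have "\<dots> \<le> (\<integral>\<^sup>+x. (ennreal \<bar>f x\<bar>)\<^sup>2 \<partial>N) * (\<integral>\<^sup>+x. (ennreal \<bar>g x\<bar>)\<^sup>2 \<partial>N)"
    by (rule Cauchy_Schwarz_nn_integral) auto
  also have "\<dots> = ennreal ((\<integral>x. (f x)\<^sup>2 \<partial>N) * (\<integral>x. (g x)\<^sup>2 \<partial>N))"
    using f g by (simp add: ennreal_power nn_integral_eq_integral ennreal_mult)
  finally have "(\<integral>x. \<bar>f x * g x\<bar> \<partial>N)\<^sup>2 \<le> (\<integral>x. (f x)\<^sup>2 \<partial>N) * (\<integral>x. (g x)\<^sup>2 \<partial>N)"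
    by (simp add: ennreal_le_iff)
  then show ?thesis by (simp add: real_le_rsqrt real_sqrt_mult[symmetric])
qed

text \<open>With \<open>d = u - f\<close> one has
  \<open>u\<^sup>2 - f\<^sup>2 = d\<^sup>2 + 2 * f * d\<close>: the first term is the mean-square
  distance, the second is handled by Cauchy-Schwarz. The bounded weight \<open>Z\<close> is carried
  along because conditional second moments are expressed by testing against such weights.\<close>

lemma integral_square_tendsto:
  fixes f :: "'a \<Rightarrow> real"
  assumes [measurable]: "\<And>k. u k \<in> borel_measurable N" "f \<in> borel_measurable N" "Z \<in> borel_measurable N"
    and u: "\<And>k. integrable N (\<lambda>x. (u k x)\<^sup>2)" and f: "integrable N (\<lambda>x. (f x)\<^sup>2)"
    and Z: "\<And>x. x \<in> space N \<Longrightarrow> \<bar>Z x\<bar> \<le> c"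
    and lim: "(\<lambda>k. \<integral>\<^sup>+x. ennreal ((u k x - f x)\<^sup>2) \<partial>N) \<longlonglongrightarrow> 0"
  shows "(\<lambda>k. \<integral>x. Z x * (u k x)\<^sup>2 \<partial>N) \<longlonglongrightarrow> (\<integral>x. Z x * (f x)\<^sup>2 \<partial>N)"
proof -
  define d where "d k x = u k x - f x" for k x
  have d_meas[measurable]: "d k \<in> borel_measurable N" for k unfolding d_def by measurable
  have d2: "integrable N (\<lambda>x. (d k x)\<^sup>2)" for k
    using integrable_square_add[of "u k" N "\<lambda>x. - f x"] u f by (simp add: d_def)
  define e where "e k = (\<integral>x. (d k x)\<^sup>2 \<partial>N)" for k
  have "ennreal (e k) = (\<integral>\<^sup>+x. ennreal ((u k x - f x)\<^sup>2) \<partial>N)" for k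
    unfolding e_def using d2[of k] by (simp add: nn_integral_eq_integral d_def)
  with lim have "(\<lambda>k. ennreal (e k)) \<longlonglongrightarrow> ennreal 0" by simp
  then have e0: "e \<longlonglongrightarrow> 0"
    by (subst (asm) tendsto_ennreal_iff) (auto simp: e_def)
  define S where "S = sqrt (\<integral>x. (f x)\<^sup>2 \<partial>N)"
  have iZ: "integrable N (\<lambda>x. Z x * h x)" if h: "integrable N h" for h :: "'a \<Rightarrow> real"
  proof (rule Bochner_Integration.integrable_bound)
    have [measurable]: "h \<in> borel_measurable N" using h by simp
    show "(\<lambda>x. Z x * h x) \<in> borel_measurable N" by measurable
    show "integrable N (\<lambda>x. c * h x)" using h by simp
    show "AE x in N. norm (Z x * h x) \<le> norm (c * h x)"
      using Z by (intro AE_I2) (auto simp: abs_mult intro!: mult_right_mono order_trans[OF Z abs_ge_self])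
  qed
  have fd: "integrable N (\<lambda>x. f x * d k x)" for k
    by (rule integrable_mult_square_integrable) (use f d2 in auto)
  have bound: "norm ((\<integral>x. Z x * (u k x)\<^sup>2 \<partial>N) - (\<integral>x. Z x * (f x)\<^sup>2 \<partial>N))
      \<le> \<bar>c\<bar> * (e k + 2 * (S * sqrt (e k)))" for k
  proof -
    have "(\<integral>x. Z x * (u k x)\<^sup>2 \<partial>N) - (\<integral>x. Z x * (f x)\<^sup>2 \<partial>N)
        = (\<integral>x. Z x * ((d k x)\<^sup>2 + 2 * (f x * d k x)) \<partial>N)"
      by (subst Bochner_Integration.integral_diff[symmetric])
         (auto simp: d_def power2_eq_square algebra_simps intro!: Bochner_Integration.integral_cong iZ
           u[unfolded power2_eq_square] f[unfolded power2_eq_square])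
    also have "norm \<dots> \<le> (\<integral>x. \<bar>c\<bar> * ((d k x)\<^sup>2 + 2 * \<bar>f x * d k x\<bar>) \<partial>N)"
    proof (rule order_trans[OF integral_norm_bound Bochner_Integration.integral_mono])
      fix x assume "x \<in> space N"
      then have "\<bar>Z x\<bar> \<le> \<bar>c\<bar>" using Z by fastforce
      moreover have "\<bar>(d k x)\<^sup>2 + 2 * (f x * d k x)\<bar> \<le> (d k x)\<^sup>2 + 2 * \<bar>f x * d k x\<bar>"
        by (rule order_trans[OF abs_triangle_ineq]) simp
      ultimately show "norm (Z x * ((d k x)\<^sup>2 + 2 * (f x * d k x))) \<le> \<bar>c\<bar> * ((d k x)\<^sup>2 + 2 * \<bar>f x * d k x\<bar>)"
        by (auto simp: abs_mult intro!: mult_mono)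
    qed (use d2 fd in \<open>auto intro!: iZ\<close>)
    also have "\<dots> = \<bar>c\<bar> * (e k + 2 * (\<integral>x. \<bar>f x * d k x\<bar> \<partial>N))"
      using d2 fd by (simp add: e_def)
    also have "\<dots> \<le> \<bar>c\<bar> * (e k + 2 * (S * sqrt (e k)))"
      unfolding e_def S_def by (intro mult_left_mono add_left_mono Cauchy_Schwarz_integral f d2) auto
    finally show ?thesis .
  qed
  have "(\<lambda>k. \<bar>c\<bar> * (e k + 2 * (S * sqrt (e k)))) \<longlonglongrightarrow> \<bar>c\<bar> * (0 + 2 * (S * sqrt 0))"
    by (intro tendsto_intros e0)
  then have "(\<lambda>k. (\<integral>x. Z x * (u k x)\<^sup>2 \<partial>N) - (\<integral>x. Z x * (f x)\<^sup>2 \<partial>N)) \<longlonglongrightarrow> 0"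
    by (intro Lim_null_comparison[OF always_eventually[OF allI[OF bound]]]) simp
  then show ?thesis by (simp add: LIM_zero_iff)
qed

lemma nn_integral_square_triangle:
  fixes f g :: "'a \<Rightarrow> real"
  assumes [measurable]: "f \<in> borel_measurable N" "g \<in> borel_measurable N"
  shows "(\<integral>\<^sup>+x. ennreal ((f x + g x)\<^sup>2) \<partial>N)
    \<le> 2 * (\<integral>\<^sup>+x. ennreal ((f x)\<^sup>2) \<partial>N) + 2 * (\<integral>\<^sup>+x. ennreal ((g x)\<^sup>2) \<partial>N)"
proof -
  have "(u + v)\<^sup>2 \<le> 2 * u\<^sup>2 + 2 * v\<^sup>2" for u v :: real
    using zero_le_power2[of "u - v"] by (simp add: power2_sum power2_diff)
  then have "(\<integral>\<^sup>+x. ennreal ((f x + g x)\<^sup>2) \<partial>N) \<le> (\<integral>\<^sup>+x. 2 * ennreal ((f x)\<^sup>2) + 2 * ennreal ((g x)\<^sup>2) \<partial>N)"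
    by (intro nn_integral_mono) (simp add: ennreal_mult'[symmetric] ennreal_plus[symmetric] flip: ennreal_numeral del: ennreal_plus)
  also have "\<dots> = 2 * (\<integral>\<^sup>+x. ennreal ((f x)\<^sup>2) \<partial>N) + 2 * (\<integral>\<^sup>+x. ennreal ((g x)\<^sup>2) \<partial>N)"
    by (simp add: nn_integral_add nn_integral_cmult)
  finally show ?thesis .
qed

section \<open>Moments of Brownian increments\<close>

context brownian_motion
begin

lemma space_F_eq [simp]: "space (F t) = space M"
  by (rule space_F)

lemma borel_measurable_F:
  "0 \<le> t \<Longrightarrow> Y \<in> borel_measurable (F t) \<Longrightarrow> Y \<in> borel_measurable M"
  using sets_F_subset[of t] by (auto simp: measurable_def)

lemma borel_measurable_F_mono:
  "s \<le> t \<Longrightarrow> Y \<in> borel_measurable (F s) \<Longrightarrow> Y \<in> borel_measurable (F t)"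
  using sets_F_mono[of s t] by (auto simp: measurable_def)

lemma borel_measurable_W [measurable]: "0 \<le> t \<Longrightarrow> W t \<in> borel_measurable M"
  using borel_measurable_F adapted by blast

definition dW :: "real \<Rightarrow> real \<Rightarrow> 'w \<Rightarrow> real" where
  "dW u v \<omega> = W v \<omega> - W u \<omega>"

lemma dW_same [simp]: "dW u u \<omega> = 0"
  by (simp add: dW_def)

lemma dW_add: "dW u v \<omega> = dW u r \<omega> + dW r v \<omega>"
  by (simp add: dW_def)

lemma borel_measurable_dW_F: "0 \<le> u \<Longrightarrow> u \<le> v \<Longrightarrow> dW u v \<in> borel_measurable (F v)"
  unfolding dW_def using adapted[of v] borel_measurable_F_mono[OF _ adapted[of u], of v] by simp

lemma borel_measurable_dW [measurable]: "0 \<le> u \<Longrightarrow> 0 \<le> v \<Longrightarrow> dW u v \<in> borel_measurable M"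
  unfolding dW_def by measurable

text \<open>The independence axiom concerns all of \<open>F u\<close>; it passes to \<open>Y\<close>
  because the sigma-algebra generated by an \<open>F u\<close>-measurable variable lies in
  \<open>F u\<close>.\<close>

lemma indep_var_dW:
  assumes Y: "Y \<in> borel_measurable (F u)" and "0 \<le> u" "u < v"
  shows "indep_var borel Y borel (dW u v)"
  unfolding indep_var_eq
proof (intro conjI)
  show "random_variable borel Y" "random_variable borel (dW u v)"
    using borel_measurable_F[of u] assms by auto
  have "indep_set (sets (F u)) (sets (vimage_algebra (space M) (dW u v) borel))"
    using indep_increments[OF assms(2,3)] by (simp add: dW_def[abs_def])
  moreover have "sigma_sets (space M) {Y -` A \<inter> space M | A. A \<in> sets borel} \<subseteq> sets (F u)"
    using Y by (intro sets.sigma_sets_subset[where M="F u", simplified]) (auto simp: measurable_def)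
  moreover have "sigma_sets (space M) {dW u v -` A \<inter> space M | A. A \<in> sets borel}
      = sets (vimage_algebra (space M) (dW u v) borel)"
    by (simp add: sets_vimage_algebra)
  ultimately show "indep_set (sigma_sets (space M) {Y -` A \<inter> space M | A. A \<in> sets borel})
      (sigma_sets (space M) {dW u v -` A \<inter> space M | A. A \<in> sets borel})"
    unfolding indep_sets2_eq by blast
qed

lemma dW_moments:
  assumes "0 \<le> u" "u < v"
  shows "integrable M (dW u v)" "expectation (dW u v) = 0"
    "integrable M (\<lambda>\<omega>. (dW u v \<omega>)\<^sup>2)" "expectation (\<lambda>\<omega>. (dW u v \<omega>)\<^sup>2) = v - u"
proof -
  have D: "distributed M lborel (dW u v) (\<lambda>x. ennreal (normal_density 0 (sqrt (v - u)) x))"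
    using normal_increments[OF assms] by (simp add: dW_def[abs_def])
  have pos: "0 < sqrt (v - u)" using assms by simp
  show "expectation (dW u v) = 0" using normal_distributed_expectation[OF pos D] .
  show "integrable M (dW u v)"
    using distributed_integrable[OF D, of "\<lambda>x. x"] integrable_normal_moment_nz_1[OF pos, of 0] by simp
  show "integrable M (\<lambda>\<omega>. (dW u v \<omega>)\<^sup>2)"
    using distributed_integrable[OF D, of "\<lambda>x. x\<^sup>2"] integrable_normal_moment[OF pos, of 0 2] by simp
  show "expectation (\<lambda>\<omega>. (dW u v \<omega>)\<^sup>2) = v - u"
    using normal_distributed_variance[OF pos D] normal_distributed_expectation[OF pos D] assms by simp
qed

lemma integrable_dW2:
  assumes "0 \<le> u" "u \<le> v"
  shows "integrable M (\<lambda>\<omega>. (dW u v \<omega>)\<^sup>2)"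
  using dW_moments(3)[of u v] assms by (cases "u = v") auto

text \<open>Independence factorizes the mean, so plain integrability of \<open>Y\<close> suffices
  and \<open>Y\<close> may itself contain earlier increments.\<close>

lemma expectation_mult_dW:
  assumes Y: "Y \<in> borel_measurable (F u)" "integrable M Y" and "0 \<le> u" "u \<le> v"
  shows "expectation (\<lambda>\<omega>. Y \<omega> * dW u v \<omega>) = 0"
proof (cases "u = v")
  case False
  then have "u < v" using assms by simp
  from indep_var_lebesgue_integral[OF indep_var_dW[OF Y(1) \<open>0 \<le> u\<close> this] Y(2) dW_moments(1)]
  show ?thesis using dW_moments(2) \<open>u < v\<close> \<open>0 \<le> u\<close> by simp
qed simp

lemma expectation_mult_dW2:
  assumes Y: "Y \<in> borel_measurable (F u)" "integrable M Y" and "0 \<le> u" "u \<le> v"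
  shows "expectation (\<lambda>\<omega>. Y \<omega> * (dW u v \<omega>)\<^sup>2) = expectation Y * (v - u)"
proof (cases "u = v")
  case False
  then have "u < v" using assms by simp
  have "indep_var borel ((\<lambda>x. x) \<circ> Y) borel ((\<lambda>x. x\<^sup>2) \<circ> dW u v)"
    by (rule indep_var_compose[OF indep_var_dW[OF Y(1) \<open>0 \<le> u\<close> \<open>u < v\<close>]]) auto
  then have "indep_var borel Y borel (\<lambda>\<omega>. (dW u v \<omega>)\<^sup>2)" by (simp add: comp_def)
  from indep_var_lebesgue_integral[OF this Y(2) dW_moments(3)]
  show ?thesis using dW_moments(4) \<open>u < v\<close> \<open>0 \<le> u\<close> by simp
qed simp

section \<open>Covariances of Brownian blocks and the product with Lebesgue measure\<close>

interpretation P: pair_sigma_finite M lborel ..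

abbreviation MT :: "('w \<times> real) measure" where
  "MT \<equiv> M \<Otimes>\<^sub>M lborel"

lemma integrable_tensor:
  fixes Y :: "'w \<Rightarrow> real"
  assumes Y: "integrable M Y" and A[measurable]: "A \<in> sets lborel" "emeasure lborel A < \<infinity>"
  shows "integrable MT (\<lambda>x. Y (fst x) * indicator A (snd x))"
    "(\<integral>x. Y (fst x) * indicator A (snd x) \<partial>MT) = expectation Y * measure lborel A"
proof -
  have [measurable]: "Y \<in> borel_measurable M" using Y by simp
  show *: "integrable MT (\<lambda>x. Y (fst x) * indicator A (snd x))"
    by (rule P.Fubini_integrable) (use Y A in \<open>auto simp: abs_mult\<close>)
  show "(\<integral>x. Y (fst x) * indicator A (snd x) \<partial>MT) = expectation Y * measure lborel A"
    using P.integral_fst'[OF *] by simp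
qed

lemma integrable_bounded_random_variable:
  fixes Y :: "'w \<Rightarrow> real"
  assumes "Y \<in> borel_measurable M" "\<And>\<omega>. \<omega> \<in> space M \<Longrightarrow> \<bar>Y \<omega>\<bar> \<le> c"
  shows "integrable M Y"
  using assms by (intro integrable_const_bound[where B=c] AE_I2) auto

lemma square_integrable_block:
  assumes "\<xi> \<in> borel_measurable (F u)" "\<And>\<omega>. \<omega> \<in> space M \<Longrightarrow> \<bar>\<xi> \<omega>\<bar> \<le> c" "0 \<le> u" "u \<le> v"
  shows "integrable M (\<lambda>\<omega>. (\<xi> \<omega> * dW u v \<omega>)\<^sup>2)"
proof (rule integrable_square_mult_bounded[OF _ _ integrable_dW2[OF assms(3,4)] assms(2)])
  show "dW u v \<in> borel_measurable M" using assms(3,4) by (intro borel_measurable_dW) linarith+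
  show "\<xi> \<in> borel_measurable M" by (rule borel_measurable_F[OF assms(3,1)])
qed

lemma integrable_block:
  assumes "\<xi> \<in> borel_measurable (F u)" "\<And>\<omega>. \<omega> \<in> space M \<Longrightarrow> \<bar>\<xi> \<omega>\<bar> \<le> c" "0 \<le> u" "u \<le> v"
  shows "integrable M (\<lambda>\<omega>. \<xi> \<omega> * dW u v \<omega>)"
proof (rule square_integrable_imp_integrable[OF _ square_integrable_block[OF assms]])
  show "(\<lambda>\<omega>. \<xi> \<omega> * dW u v \<omega>) \<in> borel_measurable M"
    using assms(3,4) by (intro borel_measurable_times borel_measurable_F[OF assms(3,1)] borel_measurable_dW) linarith+
qed

lemma bounded_mult:
  fixes Y Z :: "'w \<Rightarrow> real"
  assumes "\<And>\<omega>. \<omega> \<in> space M \<Longrightarrow> \<bar>Y \<omega>\<bar> \<le> c" "\<And>\<omega>. \<omega> \<in> space M \<Longrightarrow> \<bar>Z \<omega>\<bar> \<le> d" "\<omega> \<in> space M"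
  shows "\<bar>Y \<omega> * Z \<omega>\<bar> \<le> c * d"
  using assms(1,2)[OF assms(3)]
  unfolding abs_mult by (intro mult_mono order_trans[OF abs_ge_zero]) auto

text \<open>Splitting \<open>dW r v'\<close> at \<open>v\<close> leaves
  \<open>(dW r v)\<^sup>2\<close>, of mean \<open>v - r\<close> independently of \<open>Y\<close>,
  and a later increment, which is orthogonal to the \<open>F v\<close>-measurable factor
  \<open>Y * dW r v\<close>.\<close>

lemma expectation_common_start_increments:
  assumes Y: "Y \<in> borel_measurable (F r)" "\<And>\<omega>. \<omega> \<in> space M \<Longrightarrow> \<bar>Y \<omega>\<bar> \<le> c"
    and r: "0 \<le> r" "r \<le> v" "v \<le> v'"
  shows "expectation (\<lambda>\<omega>. Y \<omega> * dW r v \<omega> * dW r v' \<omega>) = expectation Y * (v - r)"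
proof -
  have [measurable]: "Y \<in> borel_measurable M" using borel_measurable_F[of r] Y r by blast
  have iY: "integrable M Y" using Y by (intro integrable_bounded_random_variable) auto
  have b1: "integrable M (\<lambda>\<omega>. (Y \<omega> * dW r v \<omega>) * dW v v' \<omega>)"
    and b2: "integrable M (\<lambda>\<omega>. (Y \<omega> * dW r v \<omega>) * dW r v \<omega>)"
    using r by (auto intro!: integrable_mult_square_integrable square_integrable_block[OF Y] integrable_dW2)
  have m: "(\<lambda>\<omega>. Y \<omega> * dW r v \<omega>) \<in> borel_measurable (F v)"
    using r borel_measurable_F_mono[OF _ Y(1), of v] borel_measurable_dW_F[of r v] by simp
  have "expectation (\<lambda>\<omega>. Y \<omega> * dW r v \<omega> * dW r v' \<omega>)
      = expectation (\<lambda>\<omega>. (Y \<omega> * dW r v \<omega>) * dW r v \<omega> + (Y \<omega> * dW r v \<omega>) * dW v v' \<omega>)"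
    by (subst dW_add[of r v' _ v]) (simp add: algebra_simps)
  also have "\<dots> = expectation (\<lambda>\<omega>. (Y \<omega> * dW r v \<omega>) * dW r v \<omega>)
      + expectation (\<lambda>\<omega>. (Y \<omega> * dW r v \<omega>) * dW v v' \<omega>)"
    using b1 b2 by simp
  also have "expectation (\<lambda>\<omega>. (Y \<omega> * dW r v \<omega>) * dW v v' \<omega>) = 0"
    using r by (intro expectation_mult_dW m integrable_block[OF Y]) auto
  also have "expectation (\<lambda>\<omega>. (Y \<omega> * dW r v \<omega>) * dW r v \<omega>) = expectation Y * (v - r)"
    using expectation_mult_dW2[OF Y(1) iY r(1,2)] by (simp add: power2_eq_square mult.assoc)
  finally show ?thesis by simp
qed

text \<open>The block that starts first is cut at \<open>u'\<close>. Its part before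
  \<open>u'\<close> is known at time \<open>u'\<close> and hence orthogonal to the other block; the
  rest starts together with the other block and contributes the length up to the earlier right
  end.\<close>

lemma expectation_ordered_increments:
  assumes X: "X \<in> borel_measurable (F u)" "\<And>\<omega>. \<omega> \<in> space M \<Longrightarrow> \<bar>X \<omega>\<bar> \<le> c"
    and Y: "Y \<in> borel_measurable (F u')" "\<And>\<omega>. \<omega> \<in> space M \<Longrightarrow> \<bar>Y \<omega>\<bar> \<le> d"
    and u: "0 \<le> u" "u \<le> u'" "u \<le> v" "u' \<le> v'"
  shows "expectation (\<lambda>\<omega>. (X \<omega> * dW u v \<omega>) * (Y \<omega> * dW u' v' \<omega>))
    = expectation (\<lambda>\<omega>. X \<omega> * Y \<omega>) * measure lborel ({u..<v} \<inter> {u'..<v'})"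
proof -
  have X': "X \<in> borel_measurable (F u')" using borel_measurable_F_mono[OF _ X(1)] u by blast
  have [measurable]: "X \<in> borel_measurable M" "Y \<in> borel_measurable M"
    using borel_measurable_F X(1) Y(1) u order_trans[of 0 u u'] by blast+
  have XY: "(\<lambda>\<omega>. X \<omega> * Y \<omega>) \<in> borel_measurable (F u')" using X' Y(1) by simp
  have XYb: "\<bar>X \<omega> * Y \<omega>\<bar> \<le> c * d" if "\<omega> \<in> space M" for \<omega>
    using bounded_mult[OF X(2) Y(2) that] .
  \<comment> \<open>Since \<open>u \<le> u'\<close>, both \<open>X\<close> and \<open>Y\<close> are
    \<open>F u'\<close>-measurable, so the whole product \<open>X * Y * dW u r\<close> can act as
    the factor known at time \<open>u'\<close>.\<close>
  have zero: "expectation (\<lambda>\<omega>. (X \<omega> * dW u r \<omega>) * (Y \<omega> * dW u' v' \<omega>)) = 0"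
    if "u \<le> r" "r \<le> u'" for r
  proof -
    have "expectation (\<lambda>\<omega>. (X \<omega> * Y \<omega> * dW u r \<omega>) * dW u' v' \<omega>) = 0"
    proof (rule expectation_mult_dW)
      show "(\<lambda>\<omega>. X \<omega> * Y \<omega> * dW u r \<omega>) \<in> borel_measurable (F u')"
        using XY borel_measurable_F_mono[OF that(2) borel_measurable_dW_F[of u r]] u that by simp
      show "integrable M (\<lambda>\<omega>. X \<omega> * Y \<omega> * dW u r \<omega>)"
        using u that XYb
        by (intro square_integrable_imp_integrable[OF _ integrable_square_mult_bounded[OF _ _ integrable_dW2]])
           auto
    qed (use u in auto)
    then show ?thesis by (simp add: ac_simps)
  qed
  show ?thesis
  proof (cases "v \<le> u'")
    case True
    then have "{u..<v} \<inter> {u'..<v'} = {}" by auto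
    then show ?thesis using zero[of v] True u by simp
  next
    case False
    have i: "integrable M (\<lambda>\<omega>. (X \<omega> * dW p q \<omega>) * (Y \<omega> * dW u' v' \<omega>))" if "0 \<le> p" "p \<le> q" for p q
      using u that X(2) Y(2)
      by (intro integrable_mult_square_integrable integrable_square_mult_bounded[OF _ _ integrable_dW2]) auto
    have "expectation (\<lambda>\<omega>. (X \<omega> * dW u v \<omega>) * (Y \<omega> * dW u' v' \<omega>))
       = expectation (\<lambda>\<omega>. (X \<omega> * dW u u' \<omega>) * (Y \<omega> * dW u' v' \<omega>) + (X \<omega> * dW u' v \<omega>) * (Y \<omega> * dW u' v' \<omega>))"
      by (subst dW_add[of u v _ u']) (simp add: algebra_simps)
    also have "\<dots> = expectation (\<lambda>\<omega>. (X \<omega> * dW u' v \<omega>) * (Y \<omega> * dW u' v' \<omega>))"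
      using i[of u u'] i[of u' v] False u zero[of u'] by simp
    also have "\<dots> = expectation (\<lambda>\<omega>. X \<omega> * Y \<omega>) * (min v v' - u')"
    proof (cases "v \<le> v'")
      case True
      have "expectation (\<lambda>\<omega>. (X \<omega> * dW u' v \<omega>) * (Y \<omega> * dW u' v' \<omega>))
        = expectation (\<lambda>\<omega>. X \<omega> * Y \<omega> * dW u' v \<omega> * dW u' v' \<omega>)" by (simp add: ac_simps)
      then show ?thesis
        using expectation_common_start_increments[OF XY XYb, of v v'] True False u by simp
    next
      case False
      have "expectation (\<lambda>\<omega>. (X \<omega> * dW u' v \<omega>) * (Y \<omega> * dW u' v' \<omega>))
        = expectation (\<lambda>\<omega>. X \<omega> * Y \<omega> * dW u' v' \<omega> * dW u' v \<omega>)" by (simp add: ac_simps)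
      then show ?thesis
        using expectation_common_start_increments[OF XY XYb, of v' v] False u by simp
    qed
    also have "min v v' - u' = measure lborel ({u..<v} \<inter> {u'..<v'})"
    proof -
      have "{u..<v} \<inter> {u'..<v'} = {u'..<min v v'}" using u by auto
      then show ?thesis using False u by simp
    qed
    finally show ?thesis .
  qed
qed

lemma expectation_increments:
  assumes X: "X \<in> borel_measurable (F u)" "\<And>\<omega>. \<omega> \<in> space M \<Longrightarrow> \<bar>X \<omega>\<bar> \<le> c"
    and Y: "Y \<in> borel_measurable (F u')" "\<And>\<omega>. \<omega> \<in> space M \<Longrightarrow> \<bar>Y \<omega>\<bar> \<le> d"
    and u: "0 \<le> u" "0 \<le> u'" "u \<le> v" "u' \<le> v'"
  shows "expectation (\<lambda>\<omega>. (X \<omega> * dW u v \<omega>) * (Y \<omega> * dW u' v' \<omega>))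
    = expectation (\<lambda>\<omega>. X \<omega> * Y \<omega>) * measure lborel ({u..<v} \<inter> {u'..<v'})"
proof (cases "u \<le> u'")
  case True
  then show ?thesis by (intro expectation_ordered_increments[OF X Y]) (use u in auto)
next
  case False
  then have "expectation (\<lambda>\<omega>. (Y \<omega> * dW u' v' \<omega>) * (X \<omega> * dW u v \<omega>))
    = expectation (\<lambda>\<omega>. Y \<omega> * X \<omega>) * measure lborel ({u'..<v'} \<inter> {u..<v})"
    by (intro expectation_ordered_increments[OF Y X]) (use u in auto)
  then show ?thesis by (simp add: ac_simps Int_commute)
qed

section \<open>Simple integrals and the Ito isometry\<close>

text \<open>Overlapping blocks are allowed, so that no common refinement of partitions is ever needed.\<close>

inductive simple_integral :: "real \<Rightarrow> real \<Rightarrow> ('w \<times> real \<Rightarrow> real) \<Rightarrow> ('w \<Rightarrow> real) \<Rightarrow> bool"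
  for s t where
  zero: "simple_integral s t (\<lambda>_. 0) (\<lambda>_. 0)"
| add: "simple_integral s t \<eta> I \<Longrightarrow> s \<le> u \<Longrightarrow> u \<le> v \<Longrightarrow> v \<le> t \<Longrightarrow> \<xi> \<in> borel_measurable (F u) \<Longrightarrow>
    (\<And>\<omega>. \<omega> \<in> space M \<Longrightarrow> \<bar>\<xi> \<omega>\<bar> \<le> c) \<Longrightarrow>
    simple_integral s t (\<lambda>x. \<eta> x + \<xi> (fst x) * indicator {u..<v} (snd x)) (\<lambda>\<omega>. I \<omega> + \<xi> \<omega> * dW u v \<omega>)"

lemma simple_integral_cong:
  "simple_integral s t \<eta> I \<Longrightarrow> (\<And>x. \<eta> x = \<eta>' x) \<Longrightarrow> (\<And>\<omega>. I \<omega> = I' \<omega>) \<Longrightarrow> simple_integral s t \<eta>' I'"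
  by (metis ext)

lemma simple_integral_borel_measurable:
  assumes "simple_integral s t \<eta> I" "0 \<le> s"
  shows "I \<in> borel_measurable M" "\<eta> \<in> borel_measurable MT"
  using assms(1)
proof (induction)
  case (add \<eta> I u v \<xi> c)
  have uv: "0 \<le> u" "0 \<le> v" "u \<le> v" using add.hyps(2,3) \<open>0 \<le> s\<close> by linarith+
  have [measurable]: "\<xi> \<in> borel_measurable M" using borel_measurable_F[OF uv(1) add.hyps(5)] .
  note [measurable] = add.IH
  have [measurable]: "dW u v \<in> borel_measurable M" using uv by simp
  case 1 show ?case by measurable
  case 2 show ?case by measurable
qed auto

lemma integrable_square_block_process:
  fixes \<xi> :: "'w \<Rightarrow> real"
  assumes "\<xi> \<in> borel_measurable (F u)" "\<And>\<omega>. \<omega> \<in> space M \<Longrightarrow> \<bar>\<xi> \<omega>\<bar> \<le> c" "0 \<le> u" "u \<le> v"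
  shows "integrable MT (\<lambda>x. (\<xi> (fst x) * indicator {u..<v} (snd x))\<^sup>2)"
proof -
  have [measurable]: "\<xi> \<in> borel_measurable M" by (rule borel_measurable_F[OF assms(3,1)])
  have "integrable M (\<lambda>\<omega>. (\<xi> \<omega>)\<^sup>2)"
    using bounded_mult[OF assms(2,2)] unfolding power2_eq_square
    by (intro integrable_bounded_random_variable[where c="c * c"]) measurable
  from integrable_tensor(1)[OF this, of "{u..<v}"]
  moreover have "(\<xi> (fst x) * indicator {u..<v} (snd x))\<^sup>2 = (\<xi> (fst x))\<^sup>2 * indicator {u..<v} (snd x)"
    for x :: "'w \<times> real" by (simp add: indicator_def)
  ultimately show ?thesis using assms(4) by simp
qed

lemma simple_integral_square_integrable:
  assumes "simple_integral s t \<eta> I" "0 \<le> s"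
  shows "integrable M (\<lambda>\<omega>. (I \<omega>)\<^sup>2)" "integrable MT (\<lambda>x. (\<eta> x)\<^sup>2)"
  using assms(1)
proof (induction)
  case (add \<eta> I u v \<xi> c)
  have uv: "0 \<le> u" "0 \<le> v" "u \<le> v" using add.hyps(2,3) \<open>0 \<le> s\<close> by linarith+
  have [measurable]: "\<xi> \<in> borel_measurable M" using borel_measurable_F[OF uv(1) add.hyps(5)] .
  note [measurable] = simple_integral_borel_measurable[OF add.hyps(1) \<open>0 \<le> s\<close>]
  have [measurable]: "dW u v \<in> borel_measurable M" using uv by simp
  case 1 show ?case
    by (intro integrable_square_add square_integrable_block[OF add.hyps(5,6) uv(1,3)] add.IH) measurable
  case 2 show ?case
    by (intro integrable_square_add integrable_square_block_process[OF add.hyps(5,6) uv(1,3)] add.IH) measurable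
qed auto

text \<open>The isometry is bilinear, so it can be built block by block: here one block is paired
  with a simple integral, by induction on the latter, and every pair of blocks contributes the
  overlap of its time intervals.\<close>

lemma expectation_block_simple_integral:
  assumes "simple_integral s t \<eta> I" "0 \<le> s"
    and \<xi>: "\<xi> \<in> borel_measurable (F u)" "\<And>\<omega>. \<omega> \<in> space M \<Longrightarrow> \<bar>\<xi> \<omega>\<bar> \<le> c" "0 \<le> u" "u \<le> v"
  shows "expectation (\<lambda>\<omega>. (\<xi> \<omega> * dW u v \<omega>) * I \<omega>)
    = (\<integral>x. (\<xi> (fst x) * indicator {u..<v} (snd x)) * \<eta> x \<partial>MT)"
  using assms(1)
proof induction
  case (add \<eta> I u' v' \<xi>' c')
  have [measurable]: "\<xi> \<in> borel_measurable M" by (rule borel_measurable_F[OF \<xi>(3,1)])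
  have uv: "0 \<le> u'" "0 \<le> v'" "u' \<le> v'" "0 \<le> v" using add.hyps(2,3) \<open>0 \<le> s\<close> \<xi>(3,4) by linarith+
  have [measurable]: "\<xi>' \<in> borel_measurable M" by (rule borel_measurable_F[OF uv(1) add.hyps(5)])
  have [measurable]: "dW u v \<in> borel_measurable M" "dW u' v' \<in> borel_measurable M" using uv \<xi>(3) by simp_all
  note SI = simple_integral_borel_measurable[OF add.hyps(1) \<open>0 \<le> s\<close>]
     simple_integral_square_integrable[OF add.hyps(1) \<open>0 \<le> s\<close>]
  note [measurable] = SI(1,2)
  have "expectation (\<lambda>\<omega>. (\<xi> \<omega> * dW u v \<omega>) * (I \<omega> + \<xi>' \<omega> * dW u' v' \<omega>))
      = expectation (\<lambda>\<omega>. (\<xi> \<omega> * dW u v \<omega>) * I \<omega>)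
      + expectation (\<lambda>\<omega>. (\<xi> \<omega> * dW u v \<omega>) * (\<xi>' \<omega> * dW u' v' \<omega>))"
    unfolding distrib_left
    by (intro Bochner_Integration.integral_add integrable_mult_square_integrable SI
        square_integrable_block[OF \<xi>] square_integrable_block[OF add.hyps(5,6) uv(1,3)]) measurable
  also have "\<dots> = (\<integral>x. (\<xi> (fst x) * indicator {u..<v} (snd x)) * \<eta> x \<partial>MT)
      + expectation (\<lambda>\<omega>. \<xi> \<omega> * \<xi>' \<omega>) * measure lborel ({u..<v} \<inter> {u'..<v'})"
    by (simp only: add.IH expectation_increments[OF \<xi>(1,2) add.hyps(5,6) \<xi>(3) uv(1) \<xi>(4) uv(3)])
  also have "expectation (\<lambda>\<omega>. \<xi> \<omega> * \<xi>' \<omega>) * measure lborel ({u..<v} \<inter> {u'..<v'})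
      = (\<integral>x. (\<xi> (fst x) * \<xi>' (fst x)) * indicator ({u..<v} \<inter> {u'..<v'}) (snd x) \<partial>MT)"
  proof (rule integrable_tensor(2)[symmetric])
    show "integrable M (\<lambda>\<omega>. \<xi> \<omega> * \<xi>' \<omega>)"
      by (rule integrable_bounded_random_variable[OF _ bounded_mult[OF \<xi>(2) add.hyps(6)]]) measurable
    have "emeasure lborel ({u..<v} \<inter> {u'..<v'}) \<le> emeasure lborel {u..<v}" by (rule emeasure_mono) auto
    also have "\<dots> < \<infinity>" using \<xi>(4) by simp
    finally show "emeasure lborel ({u..<v} \<inter> {u'..<v'}) < \<infinity>" .
  qed simp
  also have "\<dots> = (\<integral>x. (\<xi> (fst x) * indicator {u..<v} (snd x)) * (\<xi>' (fst x) * indicator {u'..<v'} (snd x)) \<partial>MT)"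
    by (simp only: indicator_inter_arith ac_simps)
  also have "(\<integral>x. (\<xi> (fst x) * indicator {u..<v} (snd x)) * \<eta> x \<partial>MT) + \<dots>
      = (\<integral>x. (\<xi> (fst x) * indicator {u..<v} (snd x)) * (\<eta> x + \<xi>' (fst x) * indicator {u'..<v'} (snd x)) \<partial>MT)"
    unfolding distrib_left
    by (intro Bochner_Integration.integral_add[symmetric] integrable_mult_square_integrable SI
        integrable_square_block_process[OF \<xi>] integrable_square_block_process[OF add.hyps(5,6) uv(1,3)]) measurable
  finally show ?case .
qed simp

text \<open>The polarized form, instead of the one for a single square, makes it possible to pair
  \<open>Z * I\<close> with \<open>I\<close> and thus to obtain second moments weighted by
  \<open>Z\<close>.\<close>

lemma simple_integral_isometry:
  assumes "simple_integral s t \<eta> I" "simple_integral s t \<eta>' I'" "0 \<le> s"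
  shows "expectation (\<lambda>\<omega>. I \<omega> * I' \<omega>) = (\<integral>x. \<eta> x * \<eta>' x \<partial>MT)"
  using assms(1)
proof induction
  case (add \<eta> I u v \<xi> c)
  have uv: "0 \<le> u" "0 \<le> v" "u \<le> v" using add.hyps(2,3) \<open>0 \<le> s\<close> by linarith+
  have [measurable]: "\<xi> \<in> borel_measurable M" by (rule borel_measurable_F[OF uv(1) add.hyps(5)])
  have [measurable]: "dW u v \<in> borel_measurable M" using uv by simp
  note SI = simple_integral_borel_measurable[OF add.hyps(1) \<open>0 \<le> s\<close>]
     simple_integral_square_integrable[OF add.hyps(1) \<open>0 \<le> s\<close>]
  note SI' = simple_integral_borel_measurable[OF assms(2,3)] simple_integral_square_integrable[OF assms(2,3)]
  note [measurable] = SI(1,2) SI'(1,2)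
  have "expectation (\<lambda>\<omega>. (I \<omega> + \<xi> \<omega> * dW u v \<omega>) * I' \<omega>)
      = expectation (\<lambda>\<omega>. I \<omega> * I' \<omega>) + expectation (\<lambda>\<omega>. (\<xi> \<omega> * dW u v \<omega>) * I' \<omega>)"
    unfolding distrib_right
    by (intro Bochner_Integration.integral_add integrable_mult_square_integrable SI SI'
        square_integrable_block[OF add.hyps(5,6) uv(1,3)]) measurable
  also have "\<dots> = (\<integral>x. \<eta> x * \<eta>' x \<partial>MT)
      + (\<integral>x. (\<xi> (fst x) * indicator {u..<v} (snd x)) * \<eta>' x \<partial>MT)"
    using expectation_block_simple_integral[OF assms(2,3) add.hyps(5,6) uv(1,3)] add.IH by simp
  also have "\<dots> = (\<integral>x. (\<eta> x + \<xi> (fst x) * indicator {u..<v} (snd x)) * \<eta>' x \<partial>MT)"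
    unfolding distrib_right
    by (intro Bochner_Integration.integral_add[symmetric] integrable_mult_square_integrable SI SI'
        integrable_square_block_process[OF add.hyps(5,6) uv(1,3)]) measurable
  finally show ?case .
qed simp

lemma simple_integral_nn_isometry:
  assumes "simple_integral s t \<eta> I" "0 \<le> s"
  shows "(\<integral>\<^sup>+\<omega>. ennreal ((I \<omega>)\<^sup>2) \<partial>M) = (\<integral>\<^sup>+x. ennreal ((\<eta> x)\<^sup>2) \<partial>MT)"
  using simple_integral_isometry[OF assms(1,1,2)] simple_integral_square_integrable[OF assms]
  by (simp add: nn_integral_eq_integral power2_eq_square)

lemma simple_integral_mean:
  assumes "simple_integral s t \<eta> I" "0 \<le> s"
  shows "expectation I = 0"
  using assms(1)
proof induction
  case (add \<eta> I u v \<xi> c)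
  have uv: "0 \<le> u" "0 \<le> v" "u \<le> v" using add.hyps(2,3) \<open>0 \<le> s\<close> by linarith+
  have [measurable]: "\<xi> \<in> borel_measurable M" by (rule borel_measurable_F[OF uv(1) add.hyps(5)])
  have "integrable M I"
    by (rule square_integrable_imp_integrable[OF simple_integral_borel_measurable(1)[OF add.hyps(1) \<open>0 \<le> s\<close>]
      simple_integral_square_integrable(1)[OF add.hyps(1) \<open>0 \<le> s\<close>]])
  moreover have "expectation (\<lambda>\<omega>. \<xi> \<omega> * dW u v \<omega>) = 0"
    by (rule expectation_mult_dW[OF add.hyps(5) integrable_bounded_random_variable[OF _ add.hyps(6)] uv(1,3)])
       measurable
  ultimately show ?case using integrable_block[OF add.hyps(5,6) uv(1,3)] add.IH by simp
qed simp

text \<open>All blocks start at or after \<open>s\<close>, so a weight known at time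
  \<open>s\<close> can be absorbed into each coefficient. For this purpose the left end
  \<open>s\<close> is a parameter of \<open>simple_integral\<close>.\<close>

lemma simple_integral_scale:
  assumes "simple_integral s t \<eta> I" "0 \<le> s"
    and Z: "Z \<in> borel_measurable (F s)" "\<And>\<omega>. \<omega> \<in> space M \<Longrightarrow> \<bar>Z \<omega>\<bar> \<le> c"
  shows "simple_integral s t (\<lambda>x. Z (fst x) * \<eta> x) (\<lambda>\<omega>. Z \<omega> * I \<omega>)"
  using assms(1)
proof induction
  case zero then show ?case using simple_integral.zero by simp
next
  case (add \<eta> I u v \<xi> d)
  have "simple_integral s t (\<lambda>x. Z (fst x) * \<eta> x + (Z (fst x) * \<xi> (fst x)) * indicator {u..<v} (snd x))
     (\<lambda>\<omega>. Z \<omega> * I \<omega> + (Z \<omega> * \<xi> \<omega>) * dW u v \<omega>)"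
    using add.IH add.hyps(2-4)
  proof (rule simple_integral.add)
    show "(\<lambda>\<omega>. Z \<omega> * \<xi> \<omega>) \<in> borel_measurable (F u)"
      using add.hyps(2,5) borel_measurable_F_mono[OF _ Z(1)] by simp
    show "\<And>\<omega>. \<omega> \<in> space M \<Longrightarrow> \<bar>Z \<omega> * \<xi> \<omega>\<bar> \<le> c * d"
      by (rule bounded_mult[OF Z(2) add.hyps(6)])
  qed
  then show ?case by (rule simple_integral_cong) (simp_all add: algebra_simps)
qed

lemma simple_integral_diff:
  assumes "simple_integral s t \<eta> I" "simple_integral s t \<eta>' I'"
  shows "simple_integral s t (\<lambda>x. \<eta> x - \<eta>' x) (\<lambda>\<omega>. I \<omega> - I' \<omega>)"
  using assms(2)
proof induction
  case zero then show ?case using assms(1) by simp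
next
  case (add \<eta>' I' u v \<xi> d)
  have "simple_integral s t (\<lambda>x. \<eta> x - \<eta>' x + (- \<xi> (fst x)) * indicator {u..<v} (snd x))
     (\<lambda>\<omega>. I \<omega> - I' \<omega> + (- \<xi> \<omega>) * dW u v \<omega>)"
    by (rule simple_integral.add[OF add.IH add.hyps(2-4)]) (use add.hyps(5,6) in auto)
  then show ?case by (rule simple_integral_cong) (simp_all add: algebra_simps)
qed

text \<open>Only a block that straddles \<open>m\<close> needs work: it is split at
  \<open>m\<close>, and its coefficient, known at time \<open>u\<close>, is also known at time
  \<open>m\<close>.\<close>

lemma simple_integral_cut:
  assumes "simple_integral s t \<eta> I" and m: "s \<le> m" "m \<le> t"
  shows "\<exists>I1 I2. simple_integral s m (\<lambda>x. \<eta> x * indicator {..<m} (snd x)) I1 \<and>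
    simple_integral m t (\<lambda>x. \<eta> x * indicator {m..} (snd x)) I2 \<and> (\<forall>\<omega>. I \<omega> = I1 \<omega> + I2 \<omega>)"
  using assms(1)
proof induction
  case zero then show ?case using simple_integral.zero by fastforce
next
  case (add \<eta> I u v \<xi> d)
  obtain I1 I2 where I1: "simple_integral s m (\<lambda>x. \<eta> x * indicator {..<m} (snd x)) I1"
    and I2: "simple_integral m t (\<lambda>x. \<eta> x * indicator {m..} (snd x)) I2"
    and I: "\<And>\<omega>. I \<omega> = I1 \<omega> + I2 \<omega>" using add.IH by blast
  let ?\<eta> = "\<lambda>x. \<eta> x + \<xi> (fst x) * indicator {u..<v} (snd x)"
  consider "v \<le> m" | "m \<le> u" | "u < m" "m < v" by linarith
  then show ?case
  proof cases
    case 1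
    have "simple_integral s m (\<lambda>x. ?\<eta> x * indicator {..<m} (snd x)) (\<lambda>\<omega>. I1 \<omega> + \<xi> \<omega> * dW u v \<omega>)"
      by (rule simple_integral_cong[OF simple_integral.add[OF I1 add.hyps(2,3) 1 add.hyps(5,6)]])
         (use 1 in \<open>auto simp: indicator_def\<close>)
    moreover have "simple_integral m t (\<lambda>x. ?\<eta> x * indicator {m..} (snd x)) I2"
      by (rule simple_integral_cong[OF I2]) (use 1 in \<open>auto simp: indicator_def\<close>)
    ultimately show ?thesis using I by (intro exI conjI) auto
  next
    case 2
    have "simple_integral m t (\<lambda>x. ?\<eta> x * indicator {m..} (snd x)) (\<lambda>\<omega>. I2 \<omega> + \<xi> \<omega> * dW u v \<omega>)"
      by (rule simple_integral_cong[OF simple_integral.add[OF I2 2 add.hyps(3-6)]])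
         (use 2 in \<open>auto simp: indicator_def\<close>)
    moreover have "simple_integral s m (\<lambda>x. ?\<eta> x * indicator {..<m} (snd x)) I1"
      by (rule simple_integral_cong[OF I1]) (use 2 in \<open>auto simp: indicator_def\<close>)
    ultimately show ?thesis using I by (intro exI conjI) auto
  next
    case 3
    have "simple_integral s m (\<lambda>x. ?\<eta> x * indicator {..<m} (snd x)) (\<lambda>\<omega>. I1 \<omega> + \<xi> \<omega> * dW u m \<omega>)"
      by (rule simple_integral_cong[OF simple_integral.add[OF I1 add.hyps(2) less_imp_le[OF 3(1)] order_refl add.hyps(5,6)]])
         (use 3 in \<open>auto simp: indicator_def\<close>)
    moreover have "simple_integral m t (\<lambda>x. ?\<eta> x * indicator {m..} (snd x)) (\<lambda>\<omega>. I2 \<omega> + \<xi> \<omega> * dW m v \<omega>)"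
      by (rule simple_integral_cong[OF simple_integral.add[OF I2 order_refl less_imp_le[OF 3(2)] add.hyps(4)
            borel_measurable_F_mono[OF less_imp_le[OF 3(1)] add.hyps(5)] add.hyps(6)]])
         (use 3 in \<open>auto simp: indicator_def\<close>)
    moreover have "I \<omega> + \<xi> \<omega> * dW u v \<omega> = (I1 \<omega> + \<xi> \<omega> * dW u m \<omega>) + (I2 \<omega> + \<xi> \<omega> * dW m v \<omega>)" for \<omega>
      by (subst dW_add[of u v \<omega> m]) (simp add: I algebra_simps)
    ultimately show ?thesis by (intro exI conjI) auto
  qed
qed

lemma simple_integral_elementary:
  assumes "elementary_integrand M F t n p \<xi>"
  shows "simple_integral 0 t (\<lambda>x. elementary_process n p \<xi> (snd x) (fst x)) (elementary_integral W n p \<xi>)"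
proof -
  have p: "p 0 = 0" "p n = t" "\<And>i. i < n \<Longrightarrow> p i \<le> p (Suc i)"
    "\<And>i. i < n \<Longrightarrow> \<xi> i \<in> borel_measurable (F (p i))"
    "\<And>i. i < n \<Longrightarrow> \<exists>C. \<forall>\<omega>\<in>space M. \<bar>\<xi> i \<omega>\<bar> \<le> C"
    using assms by (auto simp: elementary_integrand_def)
  have lo: "0 \<le> p i" if "i \<le> n" for i
    using that by (induction i) (use p in \<open>auto intro: order_trans\<close>)
  have hi: "p i \<le> t" if "i \<le> n" for i
    using that by (induction rule: inc_induct) (use p in \<open>auto intro: order_trans\<close>)
  have "simple_integral 0 t (\<lambda>x. elementary_process m p \<xi> (snd x) (fst x)) (elementary_integral W m p \<xi>)"
    if "m \<le> n" for m
    using that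
  proof (induction m)
    case 0
    then show ?case using simple_integral.zero
      by (rule_tac simple_integral_cong) (auto simp: elementary_process_def elementary_integral_def)
  next
    case (Suc m)
    then obtain C where C: "\<And>\<omega>. \<omega> \<in> space M \<Longrightarrow> \<bar>\<xi> m \<omega>\<bar> \<le> C" using p(5)[of m] by auto
    have "simple_integral 0 t
      (\<lambda>x. elementary_process m p \<xi> (snd x) (fst x) + \<xi> m (fst x) * indicator {p m..<p (Suc m)} (snd x))
      (\<lambda>\<omega>. elementary_integral W m p \<xi> \<omega> + \<xi> m \<omega> * dW (p m) (p (Suc m)) \<omega>)"
      using Suc lo[of m] hi[of "Suc m"] p(3,4)[of m] C by (intro simple_integral.add[where c=C]) auto
    then show ?case
      by (rule simple_integral_cong) (auto simp: elementary_process_def elementary_integral_def dW_def)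
  qed
  from this[of n] show ?thesis by simp
qed

end

section \<open>Mean-square limits\<close>

text \<open>Some \<open>u k\<close> has finite mean-square distance from \<open>f\<close>, and
  \<open>f\<close> is the sum of \<open>f - u k\<close> and \<open>u k\<close>.\<close>

lemma nn_integral_square_limit_integrable:
  fixes f :: "'a \<Rightarrow> real"
  assumes [measurable]: "\<And>k. u k \<in> borel_measurable N" "f \<in> borel_measurable N"
    and u: "\<And>k::nat. integrable N (\<lambda>x. (u k x)\<^sup>2)"
    and lim: "(\<lambda>k. \<integral>\<^sup>+x. ennreal ((u k x - f x)\<^sup>2) \<partial>N) \<longlonglongrightarrow> 0"
  shows "integrable N (\<lambda>x. (f x)\<^sup>2)"
proof -
  have "\<forall>\<^sub>F k in sequentially. (\<integral>\<^sup>+x. ennreal ((u k x - f x)\<^sup>2) \<partial>N) < 1"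
    using lim by (rule order_tendstoD) simp
  then obtain k where k: "(\<integral>\<^sup>+x. ennreal ((u k x - f x)\<^sup>2) \<partial>N) < 1"
    using eventually_happens by force
  have "integrable N (\<lambda>x. (u k x - f x)\<^sup>2)"
    by (rule integrableI_bounded) (use k in \<open>auto intro: less_trans\<close>)
  then have "integrable N (\<lambda>x. (f x - u k x)\<^sup>2)" by (simp add: power2_commute)
  then have "integrable N (\<lambda>x. ((f x - u k x) + u k x)\<^sup>2)"
    by (intro integrable_square_add u) simp_all
  then show ?thesis by simp
qed

lemma tendsto_0_ennreal_le:
  fixes v :: "nat \<Rightarrow> ennreal"
  assumes "v \<longlonglongrightarrow> 0" "\<And>k. w k \<le> v k"
  shows "w \<longlonglongrightarrow> 0"
  by (rule tendsto_sandwich[OF _ _ tendsto_const assms(1)]) (use assms(2) in auto)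

lemma tendsto_0_ennreal_twice:
  fixes v w :: "nat \<Rightarrow> ennreal"
  assumes "v \<longlonglongrightarrow> 0" "w \<longlonglongrightarrow> 0"
  shows "(\<lambda>k. 2 * v k + 2 * w k) \<longlonglongrightarrow> 0"
proof -
  have "(\<lambda>k. 2 * v k + 2 * w k) \<longlonglongrightarrow> 2 * 0 + 2 * 0"
    by (intro tendsto_add ennreal_tendsto_cmult assms) simp_all
  then show ?thesis by simp
qed

context brownian_motion
begin

interpretation P: pair_sigma_finite M lborel ..

abbreviation cutoff :: "(real \<Rightarrow> 'w \<Rightarrow> real) \<Rightarrow> real \<Rightarrow> real \<Rightarrow> 'w \<times> real \<Rightarrow> real" where
  "cutoff H s t x \<equiv> H (snd x) (fst x) * indicator {s..<t} (snd x)"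

lemma simple_integral_outside:
  assumes "simple_integral s t \<eta> I" "snd x \<notin> {s..<t}"
  shows "\<eta> x = 0"
  using assms by induction (auto simp: indicator_def)

text \<open>The definition of the integral uses iterated integrals over \<open>{0..t}\<close>. Here
  they become one integral over the product measure, with a cutoff to \<open>{0..<t}\<close> so that
  adjacent time windows do not overlap.\<close>

lemma ito_integral_approximation:
  assumes J: "has_ito_integral M F W t H J" and "0 \<le> t"
    and Hm: "(\<lambda>x. cutoff H 0 t x) \<in> borel_measurable MT"
  obtains \<eta> I where "\<And>k::nat. simple_integral 0 t (\<eta> k) (I k)"
    "(\<lambda>k. \<integral>\<^sup>+x. ennreal ((\<eta> k x - cutoff H 0 t x)\<^sup>2) \<partial>MT) \<longlonglongrightarrow> 0"
    "(\<lambda>k. \<integral>\<^sup>+\<omega>. ennreal ((I k \<omega> - J \<omega>)\<^sup>2) \<partial>M) \<longlonglongrightarrow> 0"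
proof -
  note [measurable] = Hm
  obtain n p \<xi> where el: "\<And>k::nat. elementary_integrand M F t (n k) (p k) (\<xi> k)"
    and l1: "(\<lambda>k. \<integral>\<^sup>+\<omega>. (\<integral>\<^sup>+s\<in>{0..t}.
            ennreal ((elementary_process (n k) (p k) (\<xi> k) s \<omega> - H s \<omega>)\<^sup>2) \<partial>lborel) \<partial>M) \<longlonglongrightarrow> 0"
    and l2: "(\<lambda>k. \<integral>\<^sup>+\<omega>. ennreal ((elementary_integral W (n k) (p k) (\<xi> k) \<omega> - J \<omega>)\<^sup>2) \<partial>M) \<longlonglongrightarrow> 0"
    using J unfolding has_ito_integral_def by blast
  define \<eta> where "\<eta> k x = elementary_process (n k) (p k) (\<xi> k) (snd x) (fst x)" for k and x :: "'w \<times> real"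
  have SI: "simple_integral 0 t (\<eta> k) (elementary_integral W (n k) (p k) (\<xi> k))" for k
    using simple_integral_elementary[OF el] by (simp add: \<eta>_def[abs_def])
  note [measurable] = simple_integral_borel_measurable(2)[OF SI order_refl]
  have "(\<integral>\<^sup>+x. ennreal ((\<eta> k x - cutoff H 0 t x)\<^sup>2) \<partial>MT)
     \<le> (\<integral>\<^sup>+\<omega>. (\<integral>\<^sup>+s\<in>{0..t}. ennreal ((elementary_process (n k) (p k) (\<xi> k) s \<omega> - H s \<omega>)\<^sup>2) \<partial>lborel) \<partial>M)" for k
  proof (subst lborel.nn_integral_fst[symmetric])
    \<comment> \<open>Outside \<open>{0..<t}\<close> the simple process and the cut-off integrand
      both vanish, so the passage to the half-open interval can only lower the error.\<close>
    have "\<eta> k (\<omega>, r) = 0" if "r \<notin> {0..<t}" for \<omega> r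
      using simple_integral_outside[OF SI, of "(\<omega>, r)"] that by simp
    then show "(\<integral>\<^sup>+\<omega>. \<integral>\<^sup>+r. ennreal ((\<eta> k (\<omega>, r) - H (snd (\<omega>, r)) (fst (\<omega>, r)) * indicator {0..<t} (snd (\<omega>, r)))\<^sup>2) \<partial>lborel \<partial>M)
       \<le> (\<integral>\<^sup>+\<omega>. (\<integral>\<^sup>+s\<in>{0..t}. ennreal ((elementary_process (n k) (p k) (\<xi> k) s \<omega> - H s \<omega>)\<^sup>2) \<partial>lborel) \<partial>M)"
      by (intro nn_integral_mono) (auto simp: indicator_def \<eta>_def)
  qed measurable
  then show thesis
    using that[OF SI tendsto_0_ennreal_le[OF l1] l2] by blast
qed

text \<open>\<open>J\<close> and \<open>J'\<close> come with unrelated approximating sequences. The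
  sequence for \<open>J'\<close> is cut at \<open>s\<close>; its first parts approximate the same
  integrand on \<open>[0, s)\<close> as the sequence for \<open>J\<close>, so the isometry forces
  them to converge to \<open>J\<close>, and the second parts are left with the limit
  \<open>J' - J\<close>.\<close>

lemma ito_integral_increment_approximation:
  assumes J: "has_ito_integral M F W s H J" and J': "has_ito_integral M F W t H J'"
    and st: "0 \<le> s" "s \<le> t"
    and Hm: "(\<lambda>x. cutoff H 0 t x) \<in> borel_measurable MT"
  obtains \<eta> I where "\<And>k::nat. simple_integral s t (\<eta> k) (I k)"
    "(\<lambda>k. \<integral>\<^sup>+x. ennreal ((\<eta> k x - cutoff H s t x)\<^sup>2) \<partial>MT) \<longlonglongrightarrow> 0"
    "(\<lambda>k. \<integral>\<^sup>+\<omega>. ennreal ((I k \<omega> - (J' \<omega> - J \<omega>))\<^sup>2) \<partial>M) \<longlonglongrightarrow> 0"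
proof -
  note [measurable] = Hm
  let ?H = "\<lambda>x. cutoff H 0 t x"
  have Heq: "?H x * indicator {..<s} (snd x) = cutoff H 0 s x"
    "?H x * indicator {s..} (snd x) = cutoff H s t x" for x
    using st by (auto simp: indicator_def)
  have Hs[measurable]: "(\<lambda>x. cutoff H 0 s x) \<in> borel_measurable MT"
    unfolding Heq(1)[symmetric] by measurable
  have [measurable]: "J \<in> borel_measurable M" "J' \<in> borel_measurable M"
    using J J' by (auto simp: has_ito_integral_def)
  obtain \<eta> I where SI: "\<And>k. simple_integral 0 t (\<eta> k) (I k)"
    and \<eta>: "(\<lambda>k. \<integral>\<^sup>+x. ennreal ((\<eta> k x - ?H x)\<^sup>2) \<partial>MT) \<longlonglongrightarrow> 0"
    and I: "(\<lambda>k. \<integral>\<^sup>+\<omega>. ennreal ((I k \<omega> - J' \<omega>)\<^sup>2) \<partial>M) \<longlonglongrightarrow> 0"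
    by (rule ito_integral_approximation[OF J' order_trans[OF st] Hm]) iprover
  obtain \<eta>' I' where SI': "\<And>k. simple_integral 0 s (\<eta>' k) (I' k)"
    and \<eta>': "(\<lambda>k. \<integral>\<^sup>+x. ennreal ((\<eta>' k x - cutoff H 0 s x)\<^sup>2) \<partial>MT) \<longlonglongrightarrow> 0"
    and I': "(\<lambda>k. \<integral>\<^sup>+\<omega>. ennreal ((I' k \<omega> - J \<omega>)\<^sup>2) \<partial>M) \<longlonglongrightarrow> 0"
    by (rule ito_integral_approximation[OF J st(1) Hs]) iprover
  have "\<forall>k. \<exists>I1 I2. simple_integral 0 s (\<lambda>x. \<eta> k x * indicator {..<s} (snd x)) I1 \<and>
    simple_integral s t (\<lambda>x. \<eta> k x * indicator {s..} (snd x)) I2 \<and> (\<forall>\<omega>. I k \<omega> = I1 \<omega> + I2 \<omega>)"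
    using simple_integral_cut[OF SI st] by blast
  from this[unfolded choice_iff] obtain I1 I2
    where I_cut: "\<forall>k. simple_integral 0 s (\<lambda>x. \<eta> k x * indicator {..<s} (snd x)) (I1 k) \<and>
      simple_integral s t (\<lambda>x. \<eta> k x * indicator {s..} (snd x)) (I2 k) \<and> (\<forall>\<omega>. I k \<omega> = I1 k \<omega> + I2 k \<omega>)"
    by (elim exE)
  then have SI1: "\<And>k. simple_integral 0 s (\<lambda>x. \<eta> k x * indicator {..<s} (snd x)) (I1 k)"
    and SI2: "\<And>k. simple_integral s t (\<lambda>x. \<eta> k x * indicator {s..} (snd x)) (I2 k)"
    and I12: "\<And>k \<omega>. I k \<omega> = I1 k \<omega> + I2 k \<omega>" by blast+
  have [measurable]: "\<And>k. \<eta> k \<in> borel_measurable MT" "\<And>k. \<eta>' k \<in> borel_measurable MT"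
    "\<And>k. I k \<in> borel_measurable M" "\<And>k. I' k \<in> borel_measurable M"
    "\<And>k. I1 k \<in> borel_measurable M" "\<And>k. I2 k \<in> borel_measurable M"
    using simple_integral_borel_measurable[OF SI order_refl] simple_integral_borel_measurable[OF SI' order_refl]
      simple_integral_borel_measurable(1)[OF SI1 order_refl] simple_integral_borel_measurable(1)[OF SI2 st(1)]
    by blast+
  have lim2: "(\<lambda>k. \<integral>\<^sup>+x. ennreal ((\<eta> k x * indicator {s..} (snd x) - cutoff H s t x)\<^sup>2)
      \<partial>MT) \<longlonglongrightarrow> 0"
    unfolding Heq(2)[symmetric]
    by (rule tendsto_0_ennreal_le[OF \<eta>], rule nn_integral_mono) (simp add: indicator_def)
  have lim1: "(\<lambda>k. \<integral>\<^sup>+x. ennreal ((\<eta> k x * indicator {..<s} (snd x) - cutoff H 0 s x)\<^sup>2)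
      \<partial>MT) \<longlonglongrightarrow> 0"
    unfolding Heq(1)[symmetric]
    by (rule tendsto_0_ennreal_le[OF \<eta>], rule nn_integral_mono) (simp add: indicator_def)
  \<comment> \<open>Both integrands are close to \<open>cutoff H 0 s\<close>, hence to each other,
    and the isometry transfers this to the integrals \<open>I1 k\<close> and
    \<open>I' k\<close>.\<close>
  have "(\<lambda>k. \<integral>\<^sup>+\<omega>. ennreal ((I1 k \<omega> - I' k \<omega>)\<^sup>2) \<partial>M) \<longlonglongrightarrow> 0"
  proof (rule tendsto_0_ennreal_le[OF tendsto_0_ennreal_twice[OF lim1 \<eta>']])
    fix k
    let ?Hs = "\<lambda>x. cutoff H 0 s x"
    have "(\<integral>\<^sup>+\<omega>. ennreal ((I1 k \<omega> - I' k \<omega>)\<^sup>2) \<partial>M)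
        = (\<integral>\<^sup>+x. ennreal ((\<eta> k x * indicator {..<s} (snd x) - \<eta>' k x)\<^sup>2) \<partial>MT)"
      by (rule simple_integral_nn_isometry[OF simple_integral_diff[OF SI1 SI'] order_refl])
    also have "\<dots> = (\<integral>\<^sup>+x. ennreal (((\<eta> k x * indicator {..<s} (snd x) - ?Hs x) + - (\<eta>' k x - ?Hs x))\<^sup>2) \<partial>MT)"
      by simp
    also have "\<dots> \<le> 2 * (\<integral>\<^sup>+x. ennreal ((\<eta> k x * indicator {..<s} (snd x) - ?Hs x)\<^sup>2) \<partial>MT)
       + 2 * (\<integral>\<^sup>+x. ennreal ((- (\<eta>' k x - ?Hs x))\<^sup>2) \<partial>MT)"
      by (rule nn_integral_square_triangle) measurable
    finally show "(\<integral>\<^sup>+\<omega>. ennreal ((I1 k \<omega> - I' k \<omega>)\<^sup>2) \<partial>M)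
      \<le> 2 * (\<integral>\<^sup>+x. ennreal ((\<eta> k x * indicator {..<s} (snd x) - ?Hs x)\<^sup>2) \<partial>MT)
       + 2 * (\<integral>\<^sup>+x. ennreal ((\<eta>' k x - ?Hs x)\<^sup>2) \<partial>MT)"
      by (simp only: power2_minus)
  qed
  note lim3 = tendsto_0_ennreal_twice[OF I tendsto_0_ennreal_twice[OF this I']]
  \<comment> \<open>\<open>I2 k - (J' - J)\<close> equals
    \<open>(I k - J') - ((I1 k - I' k) + (I' k - J))\<close>, and each of the three differences
    tends to zero in mean square.\<close>
  have "(\<lambda>k. \<integral>\<^sup>+\<omega>. ennreal ((I2 k \<omega> - (J' \<omega> - J \<omega>))\<^sup>2) \<partial>M) \<longlonglongrightarrow> 0"
  proof (rule tendsto_0_ennreal_le[OF lim3])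
    fix k
    have "(\<integral>\<^sup>+\<omega>. ennreal ((I2 k \<omega> - (J' \<omega> - J \<omega>))\<^sup>2) \<partial>M)
      = (\<integral>\<^sup>+\<omega>. ennreal (((I k \<omega> - J' \<omega>) + - ((I1 k \<omega> - I' k \<omega>) + (I' k \<omega> - J \<omega>)))\<^sup>2) \<partial>M)"
      by (intro nn_integral_cong arg_cong[where f="\<lambda>v. ennreal (v\<^sup>2)"]) (simp add: I12)
    also have "\<dots> \<le> 2 * (\<integral>\<^sup>+\<omega>. ennreal ((I k \<omega> - J' \<omega>)\<^sup>2) \<partial>M)
      + 2 * (\<integral>\<^sup>+\<omega>. ennreal ((- ((I1 k \<omega> - I' k \<omega>) + (I' k \<omega> - J \<omega>)))\<^sup>2) \<partial>M)"
      by (rule nn_integral_square_triangle) measurable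
    also have "\<dots> \<le> 2 * (\<integral>\<^sup>+\<omega>. ennreal ((I k \<omega> - J' \<omega>)\<^sup>2) \<partial>M)
      + 2 * (2 * (\<integral>\<^sup>+\<omega>. ennreal ((I1 k \<omega> - I' k \<omega>)\<^sup>2) \<partial>M) + 2 * (\<integral>\<^sup>+\<omega>. ennreal ((I' k \<omega> - J \<omega>)\<^sup>2) \<partial>M))"
      unfolding power2_minus
      by (intro add_left_mono mult_left_mono nn_integral_square_triangle) simp_all
    finally show "(\<integral>\<^sup>+\<omega>. ennreal ((I2 k \<omega> - (J' \<omega> - J \<omega>))\<^sup>2) \<partial>M) \<le> \<dots>" .
  qed
  with SI2 lim2 show thesis by (rule that)
qed

text \<open>These are the conditional mean and the conditional variance of the increment given
  \<open>F s\<close>, in the weak form of testing against bounded \<open>Z\<close>. The variance is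
  the limit of the polarized isometry for the pair \<open>Z * I k\<close> and
  \<open>I k\<close>.\<close>

lemma ito_integral_increment:
  assumes J: "has_ito_integral M F W s H J" and J': "has_ito_integral M F W t H J'"
    and st: "0 \<le> s" "s \<le> t"
    and Hm: "(\<lambda>x. cutoff H 0 t x) \<in> borel_measurable MT"
    and Z: "Z \<in> borel_measurable (F s)" "\<And>\<omega>. \<omega> \<in> space M \<Longrightarrow> \<bar>Z \<omega>\<bar> \<le> c"
  shows "expectation (\<lambda>\<omega>. Z \<omega> * (J' \<omega> - J \<omega>)) = 0"
    "expectation (\<lambda>\<omega>. Z \<omega> * (J' \<omega> - J \<omega>)\<^sup>2)
      = (\<integral>x. Z (fst x) * (cutoff H s t x)\<^sup>2 \<partial>MT)"
proof -
  obtain \<eta> I where SI: "\<And>k::nat. simple_integral s t (\<eta> k) (I k)"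
    and \<eta>: "(\<lambda>k. \<integral>\<^sup>+x. ennreal ((\<eta> k x - cutoff H s t x)\<^sup>2) \<partial>MT) \<longlonglongrightarrow> 0"
    and I: "(\<lambda>k. \<integral>\<^sup>+\<omega>. ennreal ((I k \<omega> - (J' \<omega> - J \<omega>))\<^sup>2) \<partial>M) \<longlonglongrightarrow> 0"
    by (rule ito_integral_increment_approximation[OF J J' st Hm]) iprover
  have Zm[measurable]: "Z \<in> borel_measurable M" by (rule borel_measurable_F[OF st(1) Z(1)])
  have Z2: "\<bar>Z (fst x)\<bar> \<le> c" if "x \<in> space MT" for x :: "'w \<times> real"
    using Z(2)[of "fst x"] that by (auto simp: space_pair_measure)
  have [measurable]: "J \<in> borel_measurable M" "J' \<in> borel_measurable M"
    using J J' by (auto simp: has_ito_integral_def)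
  let ?D = "\<lambda>\<omega>. J' \<omega> - J \<omega>"
  let ?H = "\<lambda>x. cutoff H s t x"
  note [measurable] = Hm
  have Heq: "?H x = cutoff H 0 t x * indicator {s..} (snd x)" for x
    using st by (auto simp: indicator_def)
  have [measurable]: "?H \<in> borel_measurable MT"
    unfolding Heq by measurable
  note m[measurable] = simple_integral_borel_measurable[OF SI st(1)]
  note sq = simple_integral_square_integrable[OF SI st(1)]
  have D2: "integrable M (\<lambda>\<omega>. (?D \<omega>)\<^sup>2)"
    by (rule nn_integral_square_limit_integrable[OF _ _ sq(1) I]) measurable
  have H2: "integrable MT (\<lambda>x. (?H x)\<^sup>2)"
    by (rule nn_integral_square_limit_integrable[OF _ _ sq(2) \<eta>]) measurable
  have lim1: "(\<lambda>k. expectation (\<lambda>\<omega>. Z \<omega> * (I k \<omega>)\<^sup>2)) \<longlonglongrightarrow> expectation (\<lambda>\<omega>. Z \<omega> * (?D \<omega>)\<^sup>2)"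
    by (rule integral_square_tendsto[OF _ _ Zm sq(1) D2 Z(2) I]) measurable
  have lim2: "(\<lambda>k. \<integral>x. Z (fst x) * (\<eta> k x)\<^sup>2 \<partial>MT) \<longlonglongrightarrow> (\<integral>x. Z (fst x) * (?H x)\<^sup>2 \<partial>MT)"
    by (rule integral_square_tendsto[OF _ _ _ sq(2) H2 Z2 \<eta>]) measurable
  have eq: "expectation (\<lambda>\<omega>. Z \<omega> * (I k \<omega>)\<^sup>2) = (\<integral>x. Z (fst x) * (\<eta> k x)\<^sup>2 \<partial>MT)" for k
    using simple_integral_isometry[OF simple_integral_scale[OF SI st(1) Z] SI st(1), of k k]
    by (simp add: power2_eq_square mult.assoc)
  show "expectation (\<lambda>\<omega>. Z \<omega> * (J' \<omega> - J \<omega>)\<^sup>2) = (\<integral>x. Z (fst x) * (?H x)\<^sup>2 \<partial>MT)"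
    using LIMSEQ_unique[OF lim1[unfolded eq] lim2] .
  \<comment> \<open>The first moment is extracted from second moments:
    \<open>Z * (v + 1)\<^sup>2 - Z * v\<^sup>2 - Z = 2 * Z * v\<close>, so the convergence of
    weighted squares can be applied once more, to \<open>I k + 1\<close>.\<close>
  have one: "integrable M (\<lambda>\<omega>. (1::real)\<^sup>2)" by simp
  have D1: "integrable M (\<lambda>\<omega>. (?D \<omega> + 1)\<^sup>2)"
    by (rule integrable_square_add[OF _ _ D2 one]) measurable
  have I1: "integrable M (\<lambda>\<omega>. (I k \<omega> + 1)\<^sup>2)" for k
    by (rule integrable_square_add[OF _ _ sq(1) one]) measurable
  have lim3: "(\<lambda>k. expectation (\<lambda>\<omega>. Z \<omega> * (I k \<omega> + 1)\<^sup>2)) \<longlonglongrightarrow> expectation (\<lambda>\<omega>. Z \<omega> * (?D \<omega> + 1)\<^sup>2)"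
  proof (rule integral_square_tendsto[OF _ _ Zm I1 D1 Z(2)])
    show "(\<lambda>k. \<integral>\<^sup>+\<omega>. ennreal ((I k \<omega> + 1 - (J' \<omega> - J \<omega> + 1))\<^sup>2) \<partial>M) \<longlonglongrightarrow> 0"
      using I by simp
  qed measurable
  have iZ: "integrable M (\<lambda>\<omega>. Z \<omega> * v \<omega>)" "integrable M (\<lambda>\<omega>. Z \<omega> * (v \<omega>)\<^sup>2)"
    if v: "integrable M (\<lambda>\<omega>. (v \<omega>)\<^sup>2)" and [measurable]: "v \<in> borel_measurable M" for v :: "'w \<Rightarrow> real"
  proof -
    show "integrable M (\<lambda>\<omega>. Z \<omega> * v \<omega>)"
      by (rule square_integrable_imp_integrable[OF _ integrable_square_mult_bounded[OF _ Zm v Z(2)]]) measurable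
    have "integrable M (\<lambda>\<omega>. (Z \<omega> * v \<omega>) * v \<omega>)"
      by (rule integrable_mult_square_integrable[OF _ _ integrable_square_mult_bounded[OF _ Zm v Z(2)] v]) measurable
    then show "integrable M (\<lambda>\<omega>. Z \<omega> * (v \<omega>)\<^sup>2)" by (simp add: power2_eq_square mult.assoc)
  qed
  have iZ1: "integrable M Z" by (rule integrable_bounded_random_variable[OF Zm Z(2)])
  have polar: "expectation (\<lambda>\<omega>. Z \<omega> * (v \<omega> + 1)\<^sup>2)
     = expectation (\<lambda>\<omega>. Z \<omega> * (v \<omega>)\<^sup>2) + 2 * expectation (\<lambda>\<omega>. Z \<omega> * v \<omega>) + expectation Z"
    if v: "integrable M (\<lambda>\<omega>. (v \<omega>)\<^sup>2)" and [measurable]: "v \<in> borel_measurable M" for v :: "'w \<Rightarrow> real"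
  proof -
    have "expectation (\<lambda>\<omega>. Z \<omega> * (v \<omega> + 1)\<^sup>2) = expectation (\<lambda>\<omega>. Z \<omega> * (v \<omega>)\<^sup>2 + 2 * (Z \<omega> * v \<omega>) + Z \<omega>)"
      by (simp add: power2_sum algebra_simps)
    then show ?thesis using iZ[OF v] iZ1 by simp
  qed
  have "expectation (\<lambda>\<omega>. Z \<omega> * I k \<omega>) = 0" for k
    by (rule simple_integral_mean[OF simple_integral_scale[OF SI st(1) Z] st(1)])
  with lim3 have "(\<lambda>k. expectation (\<lambda>\<omega>. Z \<omega> * (I k \<omega>)\<^sup>2) + expectation Z) \<longlonglongrightarrow>
     expectation (\<lambda>\<omega>. Z \<omega> * (?D \<omega>)\<^sup>2) + 2 * expectation (\<lambda>\<omega>. Z \<omega> * ?D \<omega>) + expectation Z"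
    using polar[OF sq(1) m(1)] polar[OF D2] by simp
  from LIMSEQ_unique[OF this tendsto_add[OF lim1 tendsto_const]]
  show "expectation (\<lambda>\<omega>. Z \<omega> * (J' \<omega> - J \<omega>)) = 0" by simp
qed

end

section \<open>The solution and its martingale part\<close>

lemma continuous_on_Icc_bounded:
  fixes h :: "real \<Rightarrow> real"
  assumes "continuous_on {a..b} h"
  shows "\<exists>K. \<forall>x\<in>{a..b}. \<bar>h x\<bar> \<le> K"
  using compact_imp_bounded[OF compact_continuous_image[OF assms compact_Icc]]
  by (auto simp: bounded_iff)

locale bounded_sde = brownian_motion M F W
  for M :: "'w measure" and F :: "real \<Rightarrow> 'w measure" and W :: "real \<Rightarrow> 'w \<Rightarrow> real" +
  fixes f g :: "real \<Rightarrow> real" and a b x0 :: real and X :: "real \<Rightarrow> 'w \<Rightarrow> real"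
  assumes solution: "sde_solution M F W f g a b x0 X"
    and continuous_drift: "continuous_on {a..b} f"
    and continuous_diffusion: "continuous_on {a..b} g"
    and diffusion_nonneg: "\<And>x. x \<in> {a..b} \<Longrightarrow> 0 \<le> g x"
begin

interpretation P: pair_sigma_finite M lborel ..

section \<open>Measurability of the paths and time integrals along them\<close>

lemma X_adapted: "0 \<le> t \<Longrightarrow> X t \<in> borel_measurable (F t)"
  using solution by (auto simp: sde_solution_def)

lemma X_measurable [measurable]: "0 \<le> t \<Longrightarrow> X t \<in> borel_measurable M"
  using X_adapted borel_measurable_F by blast

lemma X_continuous: "\<omega> \<in> space M \<Longrightarrow> continuous_on {0..} (\<lambda>t. X t \<omega>)"
  using solution by (auto simp: sde_solution_def)

lemma X_range: "\<omega> \<in> space M \<Longrightarrow> 0 \<le> t \<Longrightarrow> X t \<omega> \<in> {a..b}"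
  using solution by (auto simp: sde_solution_def)

text \<open>Negative times are sent to time 0, so that paths are continuous on the whole line.\<close>

abbreviation Xt :: "'w \<times> real \<Rightarrow> real" where
  "Xt x \<equiv> X (max 0 (snd x)) (fst x)"

text \<open>The path is sampled at the largest multiple of \<open>1 / (n + 1)\<close> not exceeding
  the time. Each approximation uses countably many time values, and path continuity gives the
  limit.\<close>

lemma X_jointly_measurable [measurable]:
  "(\<lambda>x. Xt x) \<in> borel_measurable MT"
proof (rule borel_measurable_LIMSEQ_real)
  let ?q = "\<lambda>n (r::real). nat \<lfloor>max 0 r * real (Suc n)\<rfloor>"
  fix n :: nat
  show "(\<lambda>x. X (real (?q n (snd x)) / real (Suc n)) (fst x)) \<in> borel_measurable MT"
  proof (rule measurable_compose_countable[where f="\<lambda>i x. X (real i / real (Suc n)) (fst x)"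
        and g="\<lambda>x. ?q n (snd x)"])
    fix i :: nat
    show "(\<lambda>x. X (real i / real (Suc n)) (fst x)) \<in> borel_measurable MT"
      by measurable
  qed measurable
next
  let ?q = "\<lambda>n (r::real). nat \<lfloor>max 0 r * real (Suc n)\<rfloor>"
  fix x assume x: "x \<in> space MT"
  define r where "r = max 0 (snd x)"
  have r: "0 \<le> r" by (simp add: r_def)
  have "(\<lambda>n. real (?q n (snd x)) / real (Suc n)) \<longlonglongrightarrow> r"
  proof (rule tendsto_sandwich)
    have q: "r * real (Suc n) - 1 \<le> real (?q n (snd x))" "real (?q n (snd x)) \<le> r * real (Suc n)" for n
      using r by (simp_all add: r_def of_nat_nat)
    show "\<forall>\<^sub>F n in sequentially. r - 1 / real (Suc n) \<le> real (?q n (snd x)) / real (Suc n)"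
    proof (intro always_eventually allI)
      fix n
      have "(r * real (Suc n) - 1) / real (Suc n) \<le> real (?q n (snd x)) / real (Suc n)"
        by (rule divide_right_mono[OF q(1)]) simp
      then show "r - 1 / real (Suc n) \<le> real (?q n (snd x)) / real (Suc n)"
        by (simp add: diff_divide_distrib del: of_nat_Suc)
    qed
    show "\<forall>\<^sub>F n in sequentially. real (?q n (snd x)) / real (Suc n) \<le> r"
    proof (intro always_eventually allI)
      fix n
      have "real (?q n (snd x)) / real (Suc n) \<le> (r * real (Suc n)) / real (Suc n)"
        by (rule divide_right_mono[OF q(2)]) simp
      then show "real (?q n (snd x)) / real (Suc n) \<le> r"
        by (simp del: of_nat_Suc)
    qed
    have "(\<lambda>n. r - 1 / real (Suc n)) \<longlonglongrightarrow> r - 0"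
      by (intro tendsto_diff tendsto_const LIMSEQ_Suc[OF lim_1_over_n])
    then show "(\<lambda>n. r - 1 / real (Suc n)) \<longlonglongrightarrow> r" by simp
  qed simp
  moreover have "continuous_on {0..} (\<lambda>t. X t (fst x))"
    using X_continuous x by (auto simp: space_pair_measure)
  ultimately show "(\<lambda>n. X (real (?q n (snd x)) / real (Suc n)) (fst x)) \<longlonglongrightarrow> Xt x"
    using r unfolding r_def[symmetric]
    by (intro continuous_on_tendsto_compose[where f="\<lambda>t. X t (fst x)"]) auto
qed

lemma a_le_b: "a \<le> b"
  using X_range[of _ 0] not_empty by fastforce

text \<open>\<open>h\<close> is controlled only on \<open>{a..b}\<close>. Clamping its argument
  makes it continuous on the whole line and changes nothing on the range of the solution.\<close>

lemma clamp_measurable: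
  fixes h :: "real \<Rightarrow> real"
  assumes h: "continuous_on {a..b} h"
  shows "(\<lambda>x. h (max a (min b x))) \<in> borel_measurable borel"
  using a_le_b
  by (intro borel_measurable_continuous_onI continuous_on_compose2[OF h]) (auto intro!: continuous_intros)

lemma function_X_jointly_measurable:
  fixes h :: "real \<Rightarrow> real"
  assumes h: "continuous_on {a..b} h"
  shows "(\<lambda>x. h (Xt x)) \<in> borel_measurable MT"
proof -
  note [measurable] = clamp_measurable[OF h]
  have "(\<lambda>x. h (max a (min b (Xt x)))) \<in> borel_measurable MT"
    by (rule measurable_compose[OF X_jointly_measurable]) measurable
  moreover have "h (max a (min b (Xt x))) = h (Xt x)"
    if "x \<in> space MT" for x
    using X_range[of "fst x" "max 0 (snd x)"] that by (auto simp: space_pair_measure min_def max_def)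
  ultimately show ?thesis by (subst (asm) measurable_cong) auto
qed

lemma function_X_continuous:
  fixes h :: "real \<Rightarrow> real"
  assumes "continuous_on {a..b} h" "\<omega> \<in> space M"
  shows "continuous_on {0..} (\<lambda>r. h (X r \<omega>))"
  using X_continuous[OF assms(2)] X_range[OF assms(2)]
  by (intro continuous_on_compose2[OF assms(1)]) auto

lemma function_X_adapted:
  fixes h :: "real \<Rightarrow> real"
  assumes h: "continuous_on {a..b} h" and "0 \<le> t"
  shows "(\<lambda>\<omega>. h (X t \<omega>)) \<in> borel_measurable (F t)"
proof -
  from measurable_compose[OF X_adapted[OF \<open>0 \<le> t\<close>] clamp_measurable[OF h]]
  have "(\<lambda>\<omega>. h (max a (min b (X t \<omega>)))) \<in> borel_measurable (F t)" .
  moreover have "h (max a (min b (X t \<omega>))) = h (X t \<omega>)" if "\<omega> \<in> space (F t)" for \<omega>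
    using X_range[of \<omega> t] that \<open>0 \<le> t\<close> by (auto simp: min_def max_def)
  ultimately show ?thesis by (subst (asm) measurable_cong) auto
qed

definition path_integral :: "(real \<Rightarrow> real) \<Rightarrow> real \<Rightarrow> real \<Rightarrow> 'w \<Rightarrow> real" where
  "path_integral h s t \<omega> = integral {s..t} (\<lambda>r. h (X r \<omega>))"

lemma path_integrable:
  fixes h :: "real \<Rightarrow> real"
  assumes "continuous_on {a..b} h" "\<omega> \<in> space M" "0 \<le> s"
  shows "(\<lambda>r. h (X r \<omega>)) integrable_on {s..t}"
  by (rule integrable_continuous_interval[OF continuous_on_subset[OF function_X_continuous[OF assms(1,2)]]])
     (use assms(3) in auto)

lemma path_integral_add:
  fixes h :: "real \<Rightarrow> real"
  assumes "continuous_on {a..b} h" "\<omega> \<in> space M" "0 \<le> s" "s \<le> r" "r \<le> t"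
  shows "path_integral h s t \<omega> = path_integral h s r \<omega> + path_integral h r t \<omega>"
  unfolding path_integral_def
  using Henstock_Kurzweil_Integration.integral_combine[OF assms(4,5) path_integrable[OF assms(1-3)]] by simp

lemma path_integral_bound:
  fixes h :: "real \<Rightarrow> real"
  assumes "continuous_on {a..b} h" "\<omega> \<in> space M" "0 \<le> s" "s \<le> t"
    and K: "\<And>x. x \<in> {a..b} \<Longrightarrow> \<bar>h x\<bar> \<le> K"
  shows "\<bar>path_integral h s t \<omega>\<bar> \<le> K * (t - s)"
proof -
  have "continuous_on {s..t} (\<lambda>r. h (X r \<omega>))"
    using function_X_continuous[OF assms(1,2)] by (rule continuous_on_subset) (use assms(3) in auto)
  moreover have "norm (h (X r \<omega>)) \<le> K" if "r \<in> {s..t}" for r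
    using K[OF X_range[OF assms(2), of r]] that assms(3) by auto
  ultimately show ?thesis
    unfolding path_integral_def using integral_bound[OF assms(4), of "\<lambda>r. h (X r \<omega>)" K] by simp
qed

text \<open>The equation is stated with the gauge integral, while measurability in
  \<open>\<omega>\<close> and Fubini call for the Lebesgue integral; the half-open interval matches
  the cut-off integrands.\<close>

lemma path_integral_eq_lebesgue:
  fixes h :: "real \<Rightarrow> real"
  assumes h: "continuous_on {a..b} h" and \<omega>: "\<omega> \<in> space M" and s: "0 \<le> s"
  shows "path_integral h s t \<omega> = (\<integral>r. h (X (max 0 r) \<omega>) * indicator {s..<t} r \<partial>lborel)"
proof -
  have c: "continuous_on {s..t} (\<lambda>r. h (X r \<omega>))"
    by (rule continuous_on_subset[OF function_X_continuous[OF h \<omega>]]) (use s in auto)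
  have "path_integral h s t \<omega> = (LINT r:{s..t}|lborel. h (X r \<omega>))"
    unfolding path_integral_def
    by (rule set_borel_integral_eq_integral(2)[symmetric, OF borel_integrable_atLeastAtMost'[OF c]])
  also have "\<dots> = (\<integral>r. indicator {s..t} r * h (X (max 0 r) \<omega>) \<partial>lborel)"
    unfolding set_lebesgue_integral_def using s
    by (intro Bochner_Integration.integral_cong) (auto simp: indicator_def max_def)
  also have "\<dots> = (\<integral>r. h (X (max 0 r) \<omega>) * indicator {s..<t} r \<partial>lborel)"
  proof (rule integral_cong_AE)
    have [measurable]: "(\<lambda>r. h (X (max 0 r) \<omega>)) \<in> borel_measurable lborel"
      using measurable_compose[OF measurable_Pair1'[OF \<omega>] function_X_jointly_measurable[OF h]] by simp
    show "(\<lambda>r. indicator {s..t} r * h (X (max 0 r) \<omega>)) \<in> borel_measurable lborel"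
      "(\<lambda>r. h (X (max 0 r) \<omega>) * indicator {s..<t} r) \<in> borel_measurable lborel"
      by measurable
    show "AE r in lborel. indicator {s..t} r * h (X (max 0 r) \<omega>) = h (X (max 0 r) \<omega>) * indicator {s..<t} r"
      using AE_lborel_singleton[of t] by eventually_elim (auto simp: indicator_def)
  qed
  finally show ?thesis .
qed

lemma path_integral_measurable:
  fixes h :: "real \<Rightarrow> real"
  assumes h: "continuous_on {a..b} h" and s: "0 \<le> s"
  shows "path_integral h s t \<in> borel_measurable M"
proof -
  note [measurable] = function_X_jointly_measurable[OF h]
  have "(\<lambda>x. h (Xt x) * indicator {s..<t} (snd x)) \<in> borel_measurable MT"
    by measurable
  then have "(\<lambda>\<omega>. \<integral>r. h (X (max 0 r) \<omega>) * indicator {s..<t} r \<partial>lborel) \<in> borel_measurable M"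
    by (intro lborel.borel_measurable_lebesgue_integral) (simp add: case_prod_beta')
  then show ?thesis
    by (subst measurable_cong[OF path_integral_eq_lebesgue[OF h _ s]])
qed

lemma product_path_integral:
  fixes h :: "real \<Rightarrow> real"
  assumes h: "continuous_on {a..b} h" and st: "0 \<le> s" "s \<le> t"
    and Z: "Z \<in> borel_measurable M" "\<And>\<omega>. \<omega> \<in> space M \<Longrightarrow> \<bar>Z \<omega>\<bar> \<le> c"
  shows "integrable MT (\<lambda>x. Z (fst x) * (h (Xt x) * indicator {s..<t} (snd x)))"
    "(\<integral>x. Z (fst x) * (h (Xt x) * indicator {s..<t} (snd x)) \<partial>MT)
      = expectation (\<lambda>\<omega>. Z \<omega> * path_integral h s t \<omega>)"
proof -
  note [measurable] = function_X_jointly_measurable[OF h] Z(1)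
  obtain K where K: "\<forall>x\<in>{a..b}. \<bar>h x\<bar> \<le> K" using continuous_on_Icc_bounded[OF h] by blast
  show *: "integrable MT (\<lambda>x. Z (fst x) * (h (Xt x) * indicator {s..<t} (snd x)))"
  proof (rule Bochner_Integration.integrable_bound)
    show "integrable MT (\<lambda>x. (c * K) * indicator {s..<t} (snd x))"
      using integrable_tensor(1)[of "\<lambda>_. c * K" "{s..<t}"] st by simp
    have "\<bar>Z (fst x) * h (Xt x)\<bar> \<le> \<bar>c * K\<bar>"
      if "x \<in> space MT" for x
    proof -
      have "fst x \<in> space M" using that by (auto simp: space_pair_measure)
      then have "\<bar>Z (fst x)\<bar> \<le> c" "\<bar>h (Xt x)\<bar> \<le> K"
        using Z(2) K X_range[of "fst x" "max 0 (snd x)"] by auto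
      then have "\<bar>Z (fst x)\<bar> * \<bar>h (Xt x)\<bar> \<le> c * K"
        by (intro mult_mono) auto
      then show ?thesis unfolding abs_mult[of "Z (fst x)"] by linarith
    qed
    then show "AE x in MT. norm (Z (fst x) * (h (Xt x) * indicator {s..<t} (snd x)))
        \<le> norm ((c * K) * indicator {s..<t} (snd x))"
      unfolding real_norm_def mult.assoc[symmetric] abs_mult[of _ "indicator _ _"]
      by (intro AE_I2 mult_right_mono) simp_all
  qed measurable
  show "(\<integral>x. Z (fst x) * (h (Xt x) * indicator {s..<t} (snd x)) \<partial>MT)
      = expectation (\<lambda>\<omega>. Z \<omega> * path_integral h s t \<omega>)"
    unfolding P.integral_fst'[OF *, symmetric]
    by (intro Bochner_Integration.integral_cong refl)
       (simp add: path_integral_eq_lebesgue[OF h _ st(1)] del: mult.assoc)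
qed

text \<open>This is the increment of the stochastic integral over \<open>[s, t]\<close>, recovered
  pathwise from the solution so that no version of the integral has to be chosen.\<close>

definition martingale_part :: "real \<Rightarrow> real \<Rightarrow> 'w \<Rightarrow> real" where
  "martingale_part s t \<omega> = X t \<omega> - X s \<omega> - path_integral f s t \<omega>"

text \<open>For any versions \<open>J\<close> and \<open>J'\<close> of the Ito integral up to
  \<open>s\<close> and \<open>t\<close> the martingale part is almost surely \<open>J' - J\<close>,
  and the integrand \<open>sqrt (2 * g)\<close> squares to \<open>2 * g\<close>.\<close>

lemma martingale_part_moments:
  assumes st: "0 \<le> s" "s \<le> t"
    and Z: "Z \<in> borel_measurable (F s)" "\<And>\<omega>. \<omega> \<in> space M \<Longrightarrow> \<bar>Z \<omega>\<bar> \<le> c"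
  shows "expectation (\<lambda>\<omega>. Z \<omega> * martingale_part s t \<omega>) = 0"
    "expectation (\<lambda>\<omega>. Z \<omega> * (martingale_part s t \<omega>)\<^sup>2)
      = expectation (\<lambda>\<omega>. Z \<omega> * path_integral (\<lambda>x. 2 * g x) s t \<omega>)"
proof -
  let ?H = "\<lambda>s \<omega>. sqrt (2 * g (X s \<omega>))"
  have st': "0 \<le> t" using st by simp
  obtain J where J: "has_ito_integral M F W s ?H J"
    and XJ: "AE \<omega> in M. X s \<omega> = x0 + integral {0..s} (\<lambda>s. f (X s \<omega>)) + J \<omega>"
    using solution st(1) unfolding sde_solution_def by blast
  obtain J' where J': "has_ito_integral M F W t ?H J'"
    and XJ': "AE \<omega> in M. X t \<omega> = x0 + integral {0..t} (\<lambda>s. f (X s \<omega>)) + J' \<omega>"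
    using solution st' unfolding sde_solution_def by blast
  have [measurable]: "J \<in> borel_measurable M" "J' \<in> borel_measurable M"
    using J J' by (auto simp: has_ito_integral_def)
  have Zm[measurable]: "Z \<in> borel_measurable M" by (rule borel_measurable_F[OF st(1) Z(1)])
  have [measurable]: "martingale_part s t \<in> borel_measurable M"
    unfolding martingale_part_def[abs_def] using st(1) st'
    by (intro borel_measurable_diff X_measurable path_integral_measurable continuous_drift)
  have D: "AE \<omega> in M. martingale_part s t \<omega> = J' \<omega> - J \<omega>"
    using XJ XJ' AE_space
  proof eventually_elim
    case (elim \<omega>)
    then show ?case
      using path_integral_add[OF continuous_drift elim(3) order_refl st]
      by (simp add: martingale_part_def path_integral_def)
  qed
  have g2: "continuous_on {a..b} (\<lambda>x. 2 * g x)" "continuous_on {a..b} (\<lambda>x. sqrt (2 * g x))"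
    by (intro continuous_intros continuous_diffusion)+
  note [measurable] = function_X_jointly_measurable[OF g2(1)] function_X_jointly_measurable[OF g2(2)]
  have Heq: "?H (snd x) (fst x) * indicator {0..<t} (snd x)
      = sqrt (2 * g (Xt x)) * indicator {0..<t} (snd x)" for x :: "'w \<times> real"
    by (auto simp: indicator_def max_def)
  have Hm: "(\<lambda>x. ?H (snd x) (fst x) * indicator {0..<t} (snd x)) \<in> borel_measurable MT"
    unfolding Heq by measurable
  note inc = ito_integral_increment[OF J J' st Hm Z]
  have "expectation (\<lambda>\<omega>. Z \<omega> * martingale_part s t \<omega>) = expectation (\<lambda>\<omega>. Z \<omega> * (J' \<omega> - J \<omega>))"
    by (rule integral_cong_AE) (use D in \<open>measurable, auto\<close>)
  then show "expectation (\<lambda>\<omega>. Z \<omega> * martingale_part s t \<omega>) = 0" using inc(1) by simp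
  have "expectation (\<lambda>\<omega>. Z \<omega> * (martingale_part s t \<omega>)\<^sup>2) = expectation (\<lambda>\<omega>. Z \<omega> * (J' \<omega> - J \<omega>)\<^sup>2)"
    by (rule integral_cong_AE) (use D in \<open>measurable, auto\<close>)
  also have "\<dots> = (\<integral>x. Z (fst x) * (?H (snd x) (fst x) * indicator {s..<t} (snd x))\<^sup>2 \<partial>MT)"
    by (rule inc(2))
  also have "\<dots> = (\<integral>x. Z (fst x) * (2 * g (Xt x) * indicator {s..<t} (snd x)) \<partial>MT)"
  proof (rule Bochner_Integration.integral_cong[OF refl])
    fix x assume "x \<in> space MT"
    then have "fst x \<in> space M" by (auto simp: space_pair_measure)
    then have "0 \<le> snd x \<Longrightarrow> 0 \<le> g (X (snd x) (fst x))"
      using diffusion_nonneg X_range by blast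
    then show "Z (fst x) * (?H (snd x) (fst x) * indicator {s..<t} (snd x))\<^sup>2
       = Z (fst x) * (2 * g (Xt x) * indicator {s..<t} (snd x))"
      using st(1) by (auto simp: indicator_def max_def)
  qed
  also have "\<dots> = expectation (\<lambda>\<omega>. Z \<omega> * path_integral (\<lambda>x. 2 * g x) s t \<omega>)"
    by (rule product_path_integral(2)[OF g2(1) st Zm Z(2)])
  finally show "expectation (\<lambda>\<omega>. Z \<omega> * (martingale_part s t \<omega>)\<^sup>2)
      = expectation (\<lambda>\<omega>. Z \<omega> * path_integral (\<lambda>x. 2 * g x) s t \<omega>)" .
qed

end

section \<open>Dynkin's formula\<close>

context prob_space
begin

text \<open>The solution stays in \<open>{a..b}\<close>, so all variables of the discretisation are
  bounded. The class is closed under the algebraic operations, which reduces every integrability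
  question to the shape of the expression.\<close>

definition bounded_rv :: "('a \<Rightarrow> real) \<Rightarrow> bool" where
  "bounded_rv Y \<longleftrightarrow> Y \<in> borel_measurable M \<and> (\<exists>c. \<forall>\<omega>\<in>space M. \<bar>Y \<omega>\<bar> \<le> c)"

lemma bounded_rvI:
  "Y \<in> borel_measurable M \<Longrightarrow> (\<And>\<omega>. \<omega> \<in> space M \<Longrightarrow> \<bar>Y \<omega>\<bar> \<le> c) \<Longrightarrow> bounded_rv Y"
  unfolding bounded_rv_def by blast

lemma bounded_rv_measurable: "bounded_rv Y \<Longrightarrow> Y \<in> borel_measurable M"
  unfolding bounded_rv_def by blast

lemma bounded_rv_integrable: "bounded_rv Y \<Longrightarrow> integrable M Y"
  unfolding bounded_rv_def by (auto intro!: AE_I2 integrable_const_bound)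

lemma bounded_rv_const: "bounded_rv (\<lambda>_. c)"
  by (rule bounded_rvI[where c="\<bar>c\<bar>"]) auto

lemma bounded_rv_add:
  assumes "bounded_rv Y" "bounded_rv Z" shows "bounded_rv (\<lambda>\<omega>. Y \<omega> + Z \<omega>)"
proof -
  obtain c d where "\<forall>\<omega>\<in>space M. \<bar>Y \<omega>\<bar> \<le> c" "\<forall>\<omega>\<in>space M. \<bar>Z \<omega>\<bar> \<le> d"
    using assms by (auto simp: bounded_rv_def)
  then have "\<bar>Y \<omega> + Z \<omega>\<bar> \<le> c + d" if "\<omega> \<in> space M" for \<omega>
    using that abs_triangle_ineq[of "Y \<omega>" "Z \<omega>"] by fastforce
  with borel_measurable_add[OF assms[THEN bounded_rv_measurable]] show ?thesis
    by (rule bounded_rvI)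
qed

lemma bounded_rv_mult:
  assumes "bounded_rv Y" "bounded_rv Z" shows "bounded_rv (\<lambda>\<omega>. Y \<omega> * Z \<omega>)"
proof -
  obtain c d where c: "\<forall>\<omega>\<in>space M. \<bar>Y \<omega>\<bar> \<le> c" "\<forall>\<omega>\<in>space M. \<bar>Z \<omega>\<bar> \<le> d"
    using assms by (auto simp: bounded_rv_def)
  have "\<bar>Y \<omega> * Z \<omega>\<bar> \<le> c * d" if "\<omega> \<in> space M" for \<omega>
    unfolding abs_mult
    by (intro mult_mono order_trans[OF abs_ge_zero bspec[OF c(1) that]] bspec[OF c(1)] bspec[OF c(2)] that) simp
  with borel_measurable_times[OF assms[THEN bounded_rv_measurable]] show ?thesis
    by (rule bounded_rvI)
qed

lemma bounded_rv_diff: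
  assumes "bounded_rv Y" "bounded_rv Z" shows "bounded_rv (\<lambda>\<omega>. Y \<omega> - Z \<omega>)"
  using bounded_rv_add[OF assms(1) bounded_rv_mult[OF bounded_rv_const[of "-1"] assms(2)]] by simp

lemma bounded_rv_power2:
  assumes "bounded_rv Y" shows "bounded_rv (\<lambda>\<omega>. (Y \<omega>)\<^sup>2)"
  unfolding power2_eq_square by (rule bounded_rv_mult[OF assms assms])

lemma bounded_rv_sum:
  assumes "finite I" "\<And>i. i \<in> I \<Longrightarrow> bounded_rv (Y i)" shows "bounded_rv (\<lambda>\<omega>. \<Sum>i\<in>I. Y i \<omega>)"
  using assms by (induction I) (auto intro: bounded_rv_const bounded_rv_add)

lemmas bounded_rv_intros = bounded_rv_const bounded_rv_add bounded_rv_mult bounded_rv_diff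
  bounded_rv_power2 bounded_rv_sum

lemma expectation_abs_le_sqrt:
  assumes "bounded_rv Y"
  shows "expectation (\<lambda>\<omega>. \<bar>Y \<omega>\<bar>) \<le> sqrt (expectation (\<lambda>\<omega>. (Y \<omega>)\<^sup>2))"
  using Cauchy_Schwarz_integral[OF bounded_rv_measurable[OF assms], of "\<lambda>_. 1"]
    bounded_rv_integrable[OF bounded_rv_power2[OF assms]] by (simp add: prob_space)

end

lemma Taylor_cubic:
  fixes \<phi> \<phi>1 \<phi>2 \<phi>3 :: "real \<Rightarrow> real"
  assumes "\<And>x. x \<in> {a..b} \<Longrightarrow> (\<phi> has_real_derivative \<phi>1 x) (at x)"
    and "\<And>x. x \<in> {a..b} \<Longrightarrow> (\<phi>1 has_real_derivative \<phi>2 x) (at x)"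
    and "\<And>x. x \<in> {a..b} \<Longrightarrow> (\<phi>2 has_real_derivative \<phi>3 x) (at x)"
    and K: "\<And>x. x \<in> {a..b} \<Longrightarrow> \<bar>\<phi>3 x\<bar> \<le> K"
    and x: "x \<in> {a..b}" and y: "y \<in> {a..b}"
  shows "\<bar>\<phi> y - \<phi> x - \<phi>1 x * (y - x) - \<phi>2 x / 2 * (y - x)\<^sup>2\<bar> \<le> K * \<bar>y - x\<bar> ^ 3"
proof (cases "x = y")
  case False
  define diff where "diff m = (if m = 0 then \<phi> else if m = 1 then \<phi>1 else if m = 2 then \<phi>2 else \<phi>3)" for m :: nat
  have D: "\<forall>m t. m < 3 \<and> a \<le> t \<and> t \<le> b \<longrightarrow> DERIV (diff m) t :> diff (Suc m) t"
  proof (intro allI impI)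
    fix m :: nat and t assume mt: "m < 3 \<and> a \<le> t \<and> t \<le> b"
    then consider "m = 0" | "m = 1" | "m = 2" by linarith
    then show "DERIV (diff m) t :> diff (Suc m) t"
      by cases (use mt assms(1-3)[of t] in \<open>auto simp: diff_def\<close>)
  qed
  have "\<exists>t. a \<le> t \<and> t \<le> b \<and>
      \<phi> y = (\<Sum>m<3. (diff m x / fact m) * (y - x)^m) + (diff 3 t / fact 3) * (y - x)^3"
  proof (cases "x < y")
    case True
    have "\<forall>m t. m < 3 \<and> x \<le> t \<and> t \<le> y \<longrightarrow> DERIV (diff m) t :> diff (Suc m) t" using D x y by auto
    from Taylor_up[where diff=diff and f=\<phi> and n=3 and a=x and b=y and c=x, OF _ _ this]
    obtain t where "x < t" "t < y"
      "\<phi> y = (\<Sum>m<3. (diff m x / fact m) * (y - x)^m) + (diff 3 t / fact 3) * (y - x)^3"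
      using True by (auto simp: diff_def)
    then show ?thesis using x y by (intro exI[of _ t]) simp
  next
    case False
    have "\<forall>m t. m < 3 \<and> y \<le> t \<and> t \<le> x \<longrightarrow> DERIV (diff m) t :> diff (Suc m) t" using D x y by auto
    from Taylor_down[where diff=diff and f=\<phi> and n=3 and a=y and b=x and c=x, OF _ _ this]
    obtain t where "y < t" "t < x"
      "\<phi> y = (\<Sum>m<3. (diff m x / fact m) * (y - x)^m) + (diff 3 t / fact 3) * (y - x)^3"
      using False \<open>x \<noteq> y\<close> by (auto simp: diff_def)
    then show ?thesis using x y by (intro exI[of _ t]) simp
  qed
  then obtain t where t: "t \<in> {a..b}"
    and eq: "\<phi> y = (\<Sum>m<3. (diff m x / fact m) * (y - x)^m) + (diff 3 t / fact 3) * (y - x)^3" by auto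
  have "\<phi> y - \<phi> x - \<phi>1 x * (y - x) - \<phi>2 x / 2 * (y - x)\<^sup>2 = \<phi>3 t / 6 * (y - x)^3"
    unfolding eq by (simp add: diff_def eval_nat_numeral)
  then have "\<bar>\<phi> y - \<phi> x - \<phi>1 x * (y - x) - \<phi>2 x / 2 * (y - x)\<^sup>2\<bar> = (\<bar>\<phi>3 t\<bar> / 6) * \<bar>y - x\<bar> ^ 3"
    by (simp only: abs_mult power_abs abs_divide abs_numeral)
  also have "\<dots> \<le> K * \<bar>y - x\<bar> ^ 3"
  proof (rule mult_right_mono)
    show "\<bar>\<phi>3 t\<bar> / 6 \<le> K" using K[OF t] abs_ge_zero[of "\<phi>3 t"] by linarith
  qed simp
  finally show ?thesis .
qed simp

text \<open>Three derivatives are required so that the second-order Taylor remainder is cubic in the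
  increment and \<open>\<phi>2\<close> is Lipschitz. A single \<open>K\<close> bounds the
  coefficients and all derivatives; \<open>T\<close> is the time horizon.\<close>

locale bounded_sde_test = bounded_sde M F W f g a b x0 X
  for M :: "'w measure" and F :: "real \<Rightarrow> 'w measure" and W :: "real \<Rightarrow> 'w \<Rightarrow> real"
    and f g :: "real \<Rightarrow> real" and a b x0 :: real and X :: "real \<Rightarrow> 'w \<Rightarrow> real" +
  fixes \<phi> \<phi>1 \<phi>2 \<phi>3 :: "real \<Rightarrow> real" and K T :: real
  assumes \<phi>_deriv: "\<And>x. x \<in> {a..b} \<Longrightarrow> (\<phi> has_real_derivative \<phi>1 x) (at x)"
    and \<phi>1_deriv: "\<And>x. x \<in> {a..b} \<Longrightarrow> (\<phi>1 has_real_derivative \<phi>2 x) (at x)"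
    and \<phi>2_deriv: "\<And>x. x \<in> {a..b} \<Longrightarrow> (\<phi>2 has_real_derivative \<phi>3 x) (at x)"
    and K_f: "\<And>x. x \<in> {a..b} \<Longrightarrow> \<bar>f x\<bar> \<le> K"
    and K_g: "\<And>x. x \<in> {a..b} \<Longrightarrow> \<bar>2 * g x\<bar> \<le> K"
    and K_\<phi>1: "\<And>x. x \<in> {a..b} \<Longrightarrow> \<bar>\<phi>1 x\<bar> \<le> K"
    and K_\<phi>2: "\<And>x. x \<in> {a..b} \<Longrightarrow> \<bar>\<phi>2 x\<bar> \<le> K"
    and K_\<phi>3: "\<And>x. x \<in> {a..b} \<Longrightarrow> \<bar>\<phi>3 x\<bar> \<le> K"
    and T_nonneg: "0 \<le> T"
begin

lemma K_nonneg: "0 \<le> K"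
  using K_f[of a] a_le_b by simp

lemma K_g': "x \<in> {a..b} \<Longrightarrow> \<bar>g x\<bar> \<le> K"
  using K_g[of x] by simp

lemma continuous_test:
  "continuous_on {a..b} \<phi>" "continuous_on {a..b} \<phi>1" "continuous_on {a..b} \<phi>2"
  using \<phi>_deriv \<phi>1_deriv \<phi>2_deriv by (meson DERIV_isCont continuous_at_imp_continuous_on)+

lemma continuous_2g: "continuous_on {a..b} (\<lambda>x. 2 * g x)"
  by (intro continuous_intros continuous_diffusion)

lemma bounded_rv_function_X:
  fixes h :: "real \<Rightarrow> real"
  assumes h: "continuous_on {a..b} h" and t: "0 \<le> t"
  shows "bounded_rv (\<lambda>\<omega>. h (X t \<omega>))"
proof -
  obtain C where C: "\<forall>x\<in>{a..b}. \<bar>h x\<bar> \<le> C" using continuous_on_Icc_bounded[OF h] by blast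
  show ?thesis
    by (rule bounded_rvI[OF borel_measurable_F[OF t function_X_adapted[OF h t]] bspec[OF C X_range[OF _ t]]])
qed

lemma bounded_rv_X: "0 \<le> t \<Longrightarrow> bounded_rv (X t)"
  using bounded_rv_function_X[of "\<lambda>x. x" t] by (simp add: continuous_on_id)

lemma bounded_rv_path_integral:
  fixes h :: "real \<Rightarrow> real"
  assumes h: "continuous_on {a..b} h" and st: "0 \<le> s" "s \<le> t"
  shows "bounded_rv (path_integral h s t)"
proof -
  obtain C where C: "\<forall>x\<in>{a..b}. \<bar>h x\<bar> \<le> C" using continuous_on_Icc_bounded[OF h] by blast
  show ?thesis
    by (rule bounded_rvI[OF path_integral_measurable[OF h st(1)] path_integral_bound[OF h _ st bspec[OF C]]])
qed

lemma bounded_rv_martingale_part: "0 \<le> s \<Longrightarrow> s \<le> t \<Longrightarrow> bounded_rv (martingale_part s t)"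
  unfolding martingale_part_def[abs_def]
  by (intro bounded_rv_intros bounded_rv_X bounded_rv_path_integral continuous_drift) auto

text \<open>The increment is a martingale part \<open>D\<close> plus a drift part \<open>A\<close>,
  and \<open>(D + A)\<^sup>2 \<le> 2 * D\<^sup>2 + 2 * A\<^sup>2\<close>. The first square has
  conditional mean at most \<open>K * (t - s)\<close>; the second is at most
  \<open>K\<^sup>2 * (t - s)\<^sup>2\<close>, made linear by \<open>t - s \<le> T\<close>.\<close>

lemma increment_second_moment:
  assumes st: "0 \<le> s" "s \<le> t" "t - s \<le> T"
    and Z: "Z \<in> borel_measurable (F s)" "bounded_rv Z" "\<And>\<omega>. \<omega> \<in> space M \<Longrightarrow> 0 \<le> Z \<omega>"
  shows "expectation (\<lambda>\<omega>. Z \<omega> * (X t \<omega> - X s \<omega>)\<^sup>2) \<le> (2 * K + 2 * K\<^sup>2 * T) * (t - s) * expectation Z"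
proof -
  have st': "0 \<le> t" using st by linarith
  obtain c where c: "\<forall>\<omega>\<in>space M. \<bar>Z \<omega>\<bar> \<le> c" using Z(2) by (auto simp: bounded_rv_def)
  note bd = bounded_rv_intros bounded_rv_X[OF st(1)] bounded_rv_X[OF st'] Z(2)
    bounded_rv_martingale_part[OF st(1,2)] bounded_rv_path_integral[OF continuous_drift st(1,2)]
    bounded_rv_path_integral[OF continuous_2g st(1,2)]
  have "expectation (\<lambda>\<omega>. Z \<omega> * (X t \<omega> - X s \<omega>)\<^sup>2)
     \<le> expectation (\<lambda>\<omega>. 2 * (Z \<omega> * (martingale_part s t \<omega>)\<^sup>2) + 2 * K\<^sup>2 * T * (t - s) * Z \<omega>)"
  proof (rule Bochner_Integration.integral_mono)
    fix \<omega> assume \<omega>: "\<omega> \<in> space M"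
    let ?A = "path_integral f s t \<omega>" and ?D = "martingale_part s t \<omega>"
    have "?A\<^sup>2 \<le> (K * (t - s))\<^sup>2"
      using power_mono[OF path_integral_bound[OF continuous_drift \<omega> st(1,2) K_f], of 2] by simp
    also have "\<dots> = K\<^sup>2 * ((t - s) * (t - s))" by (simp add: power2_eq_square)
    also have "\<dots> \<le> K\<^sup>2 * (T * (t - s))" using st by (intro mult_left_mono mult_right_mono) auto
    finally have A: "?A\<^sup>2 \<le> K\<^sup>2 * (T * (t - s))" .
    have "(X t \<omega> - X s \<omega>)\<^sup>2 = (?D + ?A)\<^sup>2" by (simp add: martingale_part_def)
    also have "\<dots> \<le> 2 * ?D\<^sup>2 + 2 * ?A\<^sup>2"
      using zero_le_power2[of "?D - ?A"] by (simp add: power2_sum power2_diff)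
    also have "\<dots> \<le> 2 * ?D\<^sup>2 + 2 * (K\<^sup>2 * (T * (t - s)))" using A by simp
    finally have "Z \<omega> * (X t \<omega> - X s \<omega>)\<^sup>2 \<le> Z \<omega> * (2 * ?D\<^sup>2 + 2 * (K\<^sup>2 * (T * (t - s))))"
      by (rule mult_left_mono[OF _ Z(3)[OF \<omega>]])
    then show "Z \<omega> * (X t \<omega> - X s \<omega>)\<^sup>2 \<le> 2 * (Z \<omega> * ?D\<^sup>2) + 2 * K\<^sup>2 * T * (t - s) * Z \<omega>"
      by (simp add: algebra_simps)
  qed (intro bounded_rv_integrable bd)+
  also have "\<dots> = 2 * expectation (\<lambda>\<omega>. Z \<omega> * (martingale_part s t \<omega>)\<^sup>2) + 2 * K\<^sup>2 * T * (t - s) * expectation Z"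
    by (subst Bochner_Integration.integral_add) (intro bounded_rv_integrable bd | simp)+
  also have "expectation (\<lambda>\<omega>. Z \<omega> * (martingale_part s t \<omega>)\<^sup>2)
      = expectation (\<lambda>\<omega>. Z \<omega> * path_integral (\<lambda>x. 2 * g x) s t \<omega>)"
    by (rule martingale_part_moments(2)[OF st(1,2) Z(1) bspec[OF c]])
  also have "\<dots> \<le> expectation (\<lambda>\<omega>. Z \<omega> * (K * (t - s)))"
  proof (rule Bochner_Integration.integral_mono)
    fix \<omega> assume \<omega>: "\<omega> \<in> space M"
    show "Z \<omega> * path_integral (\<lambda>x. 2 * g x) s t \<omega> \<le> Z \<omega> * (K * (t - s))"
      using path_integral_bound[OF continuous_2g \<omega> st(1,2) K_g]
      by (intro mult_left_mono Z(3)[OF \<omega>]) linarith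
  qed (intro bounded_rv_integrable bd)+
  also have "\<dots> = expectation Z * (K * (t - s))" by simp
  finally show ?thesis by (simp add: algebra_simps)
qed

section \<open>Equidistant partitions and the discrete quadratic variation\<close>

definition pt :: "nat \<Rightarrow> nat \<Rightarrow> real" where
  "pt N i = T * real i / real N"

lemma pt_nonneg: "0 \<le> pt N i"
  using T_nonneg by (simp add: pt_def)

lemma pt_Suc: "pt N (Suc i) = pt N i + T / real N"
  by (simp add: pt_def distrib_left add_divide_distrib)

lemma pt_mono: "pt N i \<le> pt N (Suc i)"
  using T_nonneg by (simp add: pt_Suc)

lemma pt_0 [simp]: "pt N 0 = 0"
  by (simp add: pt_def)

lemma pt_last: "0 < N \<Longrightarrow> pt N N = T"
  by (simp add: pt_def)

lemma pt_le: "i \<le> N \<Longrightarrow> pt N i \<le> T"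
  using T_nonneg by (cases "N = 0") (auto simp: pt_def divide_le_eq intro: mult_left_mono)

lemma mesh_le: "0 < N \<Longrightarrow> T / real N \<le> T"
  using T_nonneg by (simp add: divide_le_eq mult_le_cancel_left1)

definition incr :: "nat \<Rightarrow> nat \<Rightarrow> 'w \<Rightarrow> real" where
  "incr N i \<omega> = X (pt N (Suc i)) \<omega> - X (pt N i) \<omega>"

definition quadratic_sum :: "nat \<Rightarrow> nat \<Rightarrow> 'w \<Rightarrow> real" where
  "quadratic_sum N k \<omega> = (\<Sum>i<k. (incr N i \<omega>)\<^sup>2)"

definition max_incr :: "nat \<Rightarrow> 'w \<Rightarrow> real" where
  "max_incr N \<omega> = Max ((\<lambda>i. \<bar>incr N i \<omega>\<bar>) ` {..<N})"

lemma bounded_rv_incr: "bounded_rv (incr N i)"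
  unfolding incr_def[abs_def] by (intro bounded_rv_intros bounded_rv_X pt_nonneg)

lemma incr_bound: "\<omega> \<in> space M \<Longrightarrow> \<bar>incr N i \<omega>\<bar> \<le> b - a"
  using X_range[of \<omega> "pt N i"] X_range[of \<omega> "pt N (Suc i)"] pt_nonneg[of N i] pt_nonneg[of N "Suc i"]
  unfolding incr_def by fastforce

lemma incr_adapted: "i < k \<Longrightarrow> incr N i \<in> borel_measurable (F (pt N k))"
proof -
  assume "i < k"
  then have "pt N i \<le> pt N k" "pt N (Suc i) \<le> pt N k"
    using T_nonneg by (auto simp: pt_def intro!: divide_right_mono mult_left_mono)
  then have "X (pt N i) \<in> borel_measurable (F (pt N k))" "X (pt N (Suc i)) \<in> borel_measurable (F (pt N k))"
    by (auto intro: borel_measurable_F_mono[OF _ X_adapted[OF pt_nonneg]])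
  then show ?thesis unfolding incr_def[abs_def] by (rule borel_measurable_diff[rotated])
qed

lemma bounded_rv_quadratic_sum: "bounded_rv (quadratic_sum N k)"
  unfolding quadratic_sum_def[abs_def] by (intro bounded_rv_intros bounded_rv_incr) simp

lemma quadratic_sum_nonneg: "0 \<le> quadratic_sum N k \<omega>"
  unfolding quadratic_sum_def by (intro sum_nonneg) simp

lemma quadratic_sum_adapted: "quadratic_sum N k \<in> borel_measurable (F (pt N k))"
  unfolding quadratic_sum_def[abs_def]
  by (intro borel_measurable_sum borel_measurable_power incr_adapted) simp

lemma max_incr_nonneg: "0 < N \<Longrightarrow> 0 \<le> max_incr N \<omega>"
  unfolding max_incr_def by (subst Max_ge_iff) (auto simp: lessThan_empty_iff)

lemma incr_le_max: "i < N \<Longrightarrow> \<bar>incr N i \<omega>\<bar> \<le> max_incr N \<omega>"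
  unfolding max_incr_def by (intro Max_ge) auto

lemma max_incr_le: "0 < N \<Longrightarrow> (\<And>i. i < N \<Longrightarrow> \<bar>incr N i \<omega>\<bar> \<le> c) \<Longrightarrow> max_incr N \<omega> \<le> c"
  unfolding max_incr_def by (subst Max_le_iff) (auto simp: lessThan_empty_iff)

lemma bounded_rv_max_incr: "0 < N \<Longrightarrow> bounded_rv (max_incr N)"
proof (rule bounded_rvI)
  have [measurable]: "\<And>i. incr N i \<in> borel_measurable M" by (rule bounded_rv_measurable[OF bounded_rv_incr])
  show "max_incr N \<in> borel_measurable M"
    unfolding max_incr_def[abs_def] by (intro borel_measurable_Max) auto
  assume "0 < N"
  then show "\<bar>max_incr N \<omega>\<bar> \<le> b - a" if "\<omega> \<in> space M" for \<omega>
    using max_incr_le[OF _ incr_bound[OF that]] max_incr_nonneg by simp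
qed

abbreviation "speed \<equiv> 2 * K + 2 * K\<^sup>2 * T"

lemma speed_nonneg: "0 \<le> speed"
  using K_nonneg T_nonneg by simp

lemma incr_second_moment:
  assumes N: "0 < N"
    and Z: "Z \<in> borel_measurable (F (pt N i))" "bounded_rv Z" "\<And>\<omega>. \<omega> \<in> space M \<Longrightarrow> 0 \<le> Z \<omega>"
  shows "expectation (\<lambda>\<omega>. Z \<omega> * (incr N i \<omega>)\<^sup>2) \<le> speed * (T / real N) * expectation Z"
  using increment_second_moment[OF pt_nonneg pt_mono _ Z] mesh_le[OF N]
  by (simp add: incr_def pt_Suc)

lemma expectation_quadratic_sum:
  assumes N: "0 < N" and "k \<le> N"
  shows "expectation (quadratic_sum N k) \<le> speed * T"
proof -
  have "expectation (quadratic_sum N k) = (\<Sum>i<k. expectation (\<lambda>\<omega>. (incr N i \<omega>)\<^sup>2))"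
    unfolding quadratic_sum_def[abs_def]
    by (intro Bochner_Integration.integral_sum bounded_rv_integrable bounded_rv_intros bounded_rv_incr)
  also have "\<dots> \<le> (\<Sum>i<k. speed * (T / real N))"
  proof (rule sum_mono)
    fix i
    show "expectation (\<lambda>\<omega>. (incr N i \<omega>)\<^sup>2) \<le> speed * (T / real N)"
      using incr_second_moment[OF N, of "\<lambda>_. 1" i] by (simp add: bounded_rv_const prob_space)
  qed
  also have "\<dots> = real k * (speed * (T / real N))" by simp
  also have "\<dots> \<le> real N * (speed * (T / real N))"
    using \<open>k \<le> N\<close> speed_nonneg T_nonneg by (intro mult_right_mono mult_nonneg_nonneg) auto
  also have "\<dots> = speed * T" using N by simp
  finally show ?thesis .
qed

text \<open>Uniform integrability of the discrete quadratic variation: this is what allows the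
  third-order Taylor terms to be dropped without any moment bounds beyond the second.\<close>

lemma expectation_quadratic_sum_square:
  assumes N: "0 < N"
  shows "expectation (\<lambda>\<omega>. (quadratic_sum N N \<omega>)\<^sup>2) \<le> (2 * (speed * T) + (b - a)\<^sup>2) * (speed * T)"
proof -
  let ?c = "(2 * (speed * T) + (b - a)\<^sup>2) * (speed * (T / real N))"
  note bd = bounded_rv_integrable bounded_rv_intros bounded_rv_incr bounded_rv_quadratic_sum
  \<comment> \<open>Here \<open>q\<close> is the next squared increment and
    \<open>c = (b - a)\<^sup>2\<close> bounds it, so \<open>q\<^sup>2 \<le> c * q\<close>:
    boundedness of the path stands in for a fourth moment. The remaining factor
    \<open>2 * p + c\<close> is known at time \<open>pt N k\<close>, so the weighted second-moment
    bound applies to it.\<close>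
  have alg: "(p + q)\<^sup>2 \<le> p\<^sup>2 + (2 * p + c) * q" if "q * q \<le> c * q" for p q c :: real
    using that by (simp add: power2_eq_square algebra_simps)
  have alg': "real k * (u * v) + v * u = real (Suc k) * (u * v)" for u v :: real and k
    by (simp add: algebra_simps)
  have "expectation (\<lambda>\<omega>. (quadratic_sum N k \<omega>)\<^sup>2) \<le> real k * ?c" if "k \<le> N" for k
    using that
  proof (induction k)
    case 0 show ?case by (simp add: quadratic_sum_def)
  next
    case (Suc k)
    have "expectation (\<lambda>\<omega>. (quadratic_sum N (Suc k) \<omega>)\<^sup>2)
       \<le> expectation (\<lambda>\<omega>. (quadratic_sum N k \<omega>)\<^sup>2 + (2 * quadratic_sum N k \<omega> + (b - a)\<^sup>2) * (incr N k \<omega>)\<^sup>2)"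
    proof (rule Bochner_Integration.integral_mono)
      fix \<omega> assume \<omega>: "\<omega> \<in> space M"
      have "(incr N k \<omega>)\<^sup>2 \<le> (b - a)\<^sup>2" using power_mono[OF incr_bound[OF \<omega>, of N k] abs_ge_zero, of 2] by simp
      then have "(incr N k \<omega>)\<^sup>2 * (incr N k \<omega>)\<^sup>2 \<le> (b - a)\<^sup>2 * (incr N k \<omega>)\<^sup>2" by (rule mult_right_mono) simp
      then show "(quadratic_sum N (Suc k) \<omega>)\<^sup>2
         \<le> (quadratic_sum N k \<omega>)\<^sup>2 + (2 * quadratic_sum N k \<omega> + (b - a)\<^sup>2) * (incr N k \<omega>)\<^sup>2"
        unfolding quadratic_sum_def sum.lessThan_Suc by (rule alg)
    qed (intro bd)+
    also have "\<dots> = expectation (\<lambda>\<omega>. (quadratic_sum N k \<omega>)\<^sup>2)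
       + expectation (\<lambda>\<omega>. (2 * quadratic_sum N k \<omega> + (b - a)\<^sup>2) * (incr N k \<omega>)\<^sup>2)"
      by (rule Bochner_Integration.integral_add) (intro bd)+
    also have "\<dots> \<le> real k * ?c + speed * (T / real N) * expectation (\<lambda>\<omega>. 2 * quadratic_sum N k \<omega> + (b - a)\<^sup>2)"
    proof (intro add_mono Suc.IH incr_second_moment[OF N])
      show "(\<lambda>\<omega>. 2 * quadratic_sum N k \<omega> + (b - a)\<^sup>2) \<in> borel_measurable (F (pt N k))"
        using quadratic_sum_adapted[of N k] by simp
      show "bounded_rv (\<lambda>\<omega>. 2 * quadratic_sum N k \<omega> + (b - a)\<^sup>2)" by (intro bd)
      show "0 \<le> 2 * quadratic_sum N k \<omega> + (b - a)\<^sup>2" for \<omega>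
        using quadratic_sum_nonneg[of N k \<omega>] by simp
      show "k \<le> N" using Suc.prems by simp
    qed
    also have "expectation (\<lambda>\<omega>. 2 * quadratic_sum N k \<omega> + (b - a)\<^sup>2)
        = 2 * expectation (quadratic_sum N k) + (b - a)\<^sup>2"
      using bounded_rv_integrable[OF bounded_rv_quadratic_sum[of N k]] by (simp add: prob_space)
    also have "real k * ?c + speed * (T / real N) * (2 * expectation (quadratic_sum N k) + (b - a)\<^sup>2)
        \<le> real k * ?c + speed * (T / real N) * (2 * (speed * T) + (b - a)\<^sup>2)"
      using expectation_quadratic_sum[OF N, of k] Suc.prems speed_nonneg T_nonneg
      by (intro add_left_mono mult_left_mono add_right_mono mult_nonneg_nonneg) auto
    also have "\<dots> = real (Suc k) * ?c" by (rule alg')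
    finally show ?case .
  qed
  from this[of N] have "expectation (\<lambda>\<omega>. (quadratic_sum N N \<omega>)\<^sup>2) \<le> real N * ?c" by simp
  also have "real N * ?c = (2 * (speed * T) + (b - a)\<^sup>2) * (speed * T)" using N by simp
  finally show ?thesis .
qed

lemma path_modulus:
  assumes \<omega>: "\<omega> \<in> space M" and "0 < e"
  shows "\<exists>n0. \<forall>n\<ge>n0. \<forall>r\<in>{0..T}. \<forall>r'\<in>{0..T}. \<bar>r - r'\<bar> \<le> T / real (Suc n) \<longrightarrow> \<bar>X r \<omega> - X r' \<omega>\<bar> < e"
proof -
  have "uniformly_continuous_on {0..T} (\<lambda>t. X t \<omega>)"
    by (intro compact_uniformly_continuous continuous_on_subset[OF X_continuous[OF \<omega>]]) auto
  then obtain d where d: "d > 0" "\<And>r r'. r \<in> {0..T} \<Longrightarrow> r' \<in> {0..T} \<Longrightarrow> dist r' r < d \<Longrightarrow> dist (X r' \<omega>) (X r \<omega>) < e"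
    using \<open>0 < e\<close> unfolding uniformly_continuous_on_def by blast
  have "(\<lambda>n. T / real (Suc n)) \<longlonglongrightarrow> 0"
    by (rule LIMSEQ_Suc[OF lim_const_over_n])
  then have "\<forall>\<^sub>F n in sequentially. T / real (Suc n) < d" using d(1) by (rule order_tendstoD)
  then obtain n0 where "\<And>n. n \<ge> n0 \<Longrightarrow> T / real (Suc n) < d" by (auto simp: eventually_sequentially)
  then show ?thesis using d(2) by (intro exI[of _ n0]) (fastforce simp: dist_real_def)
qed

lemma max_incr_tendsto:
  assumes \<omega>: "\<omega> \<in> space M"
  shows "(\<lambda>n. max_incr (Suc n) \<omega>) \<longlonglongrightarrow> 0"
proof (rule LIMSEQ_I)
  fix e :: real assume e: "0 < e"
  obtain n0 where n0: "\<forall>n\<ge>n0. \<forall>r\<in>{0..T}. \<forall>r'\<in>{0..T}. \<bar>r - r'\<bar> \<le> T / real (Suc n)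
      \<longrightarrow> \<bar>X r \<omega> - X r' \<omega>\<bar> < e / 2"
    using path_modulus[OF \<omega> half_gt_zero[OF e]] by (elim exE)
  have "max_incr (Suc n) \<omega> \<le> e / 2" if n: "n \<ge> n0" for n
  proof (rule max_incr_le)
    fix i assume "i < Suc n"
    then have "pt (Suc n) i \<in> {0..T}" "pt (Suc n) (Suc i) \<in> {0..T}"
      using pt_nonneg pt_le[of i "Suc n"] pt_le[of "Suc i" "Suc n"] by auto
    moreover have "\<bar>pt (Suc n) (Suc i) - pt (Suc n) i\<bar> \<le> T / real (Suc n)"
      using T_nonneg unfolding pt_Suc by simp
    ultimately show "\<bar>incr (Suc n) i \<omega>\<bar> \<le> e / 2"
      unfolding incr_def using n0 n by (intro less_imp_le) blast
  qed simp
  then show "\<exists>no. \<forall>n\<ge>no. norm (max_incr (Suc n) \<omega> - 0) < e"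
    using max_incr_nonneg[of "Suc _" \<omega>] e by (intro exI[of _ n0]) fastforce
qed

text \<open>Uniform continuity of each path gives pointwise convergence, and the diameter of the
  state space gives a dominating constant.\<close>

lemma max_incr_mean_square: "(\<lambda>n. expectation (\<lambda>\<omega>. (max_incr (Suc n) \<omega>)\<^sup>2)) \<longlonglongrightarrow> 0"
proof -
  have "(\<lambda>n. expectation (\<lambda>\<omega>. (max_incr (Suc n) \<omega>)\<^sup>2)) \<longlonglongrightarrow> expectation (\<lambda>_. 0)"
  proof (rule integral_dominated_convergence[where w="\<lambda>_. (b - a)\<^sup>2"])
    show "AE \<omega> in M. (\<lambda>n. (max_incr (Suc n) \<omega>)\<^sup>2) \<longlonglongrightarrow> 0"
    proof (rule AE_I2)
      fix \<omega> assume "\<omega> \<in> space M"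
      then show "(\<lambda>n. (max_incr (Suc n) \<omega>)\<^sup>2) \<longlonglongrightarrow> 0"
        using tendsto_power[OF max_incr_tendsto, of \<omega> 2] by simp
    qed
    show "AE \<omega> in M. norm ((max_incr (Suc n) \<omega>)\<^sup>2) \<le> (b - a)\<^sup>2" for n
    proof (rule AE_I2)
      fix \<omega> assume \<omega>: "\<omega> \<in> space M"
      have "max_incr (Suc n) \<omega> \<le> b - a" by (rule max_incr_le[OF _ incr_bound[OF \<omega>]]) simp
      then show "norm ((max_incr (Suc n) \<omega>)\<^sup>2) \<le> (b - a)\<^sup>2"
        using power_mono[of "max_incr (Suc n) \<omega>" "b - a" 2] max_incr_nonneg[of "Suc n" \<omega>] by simp
    qed
    show "(\<lambda>\<omega>. (max_incr (Suc n) \<omega>)\<^sup>2) \<in> borel_measurable M" for n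
      by (rule bounded_rv_measurable[OF bounded_rv_power2[OF bounded_rv_max_incr]]) simp
  qed simp_all
  then show ?thesis by simp
qed

section \<open>The generator along the partition\<close>

lemma test_lipschitz:
  assumes "x \<in> {a..b}" "y \<in> {a..b}"
  shows "\<bar>\<phi>1 x - \<phi>1 y\<bar> \<le> K * \<bar>x - y\<bar>" "\<bar>\<phi>2 x - \<phi>2 y\<bar> \<le> K * \<bar>x - y\<bar>"
  using field_differentiable_bound[OF convex_real_interval(5) DERIV_subset[OF \<phi>1_deriv subset_UNIV] _ assms, of K]
    field_differentiable_bound[OF convex_real_interval(5) DERIV_subset[OF \<phi>2_deriv subset_UNIV] _ assms, of K]
    K_\<phi>2 K_\<phi>3 by auto

text \<open>The generator of the diffusion: the volatility is \<open>sqrt (2 * g)\<close>, so the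
  factor one half of Ito's formula cancels against the 2.\<close>

definition gen :: "real \<Rightarrow> real" where
  "gen x = f x * \<phi>1 x + g x * \<phi>2 x"

lemma continuous_gen: "continuous_on {a..b} gen"
  unfolding gen_def[abs_def]
  by (intro continuous_intros continuous_drift continuous_diffusion continuous_test)

text \<open>The derivatives of the test function are frozen at the left end of the step, while
  \<open>f\<close> and \<open>g\<close> stay under the time integral. This is exactly what the
  conditional moments of the increment produce.\<close>

definition gen_piece :: "nat \<Rightarrow> nat \<Rightarrow> 'w \<Rightarrow> real" where
  "gen_piece N i \<omega> = \<phi>1 (X (pt N i) \<omega>) * path_integral f (pt N i) (pt N (Suc i)) \<omega>
    + \<phi>2 (X (pt N i) \<omega>) * path_integral g (pt N i) (pt N (Suc i)) \<omega>"

lemma bounded_rv_gen_piece: "bounded_rv (gen_piece N i)"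
  unfolding gen_piece_def[abs_def]
  by (intro bounded_rv_add bounded_rv_mult bounded_rv_function_X bounded_rv_path_integral
      continuous_test continuous_drift continuous_diffusion pt_nonneg pt_mono)

lemma path_integral_bound_K:
  assumes "\<omega> \<in> space M"
  shows "\<bar>path_integral f (pt N i) (pt N (Suc i)) \<omega>\<bar> \<le> K * (T / real N)"
    "\<bar>path_integral g (pt N i) (pt N (Suc i)) \<omega>\<bar> \<le> K * (T / real N)"
  using path_integral_bound[OF continuous_drift assms pt_nonneg pt_mono K_f]
    path_integral_bound[OF continuous_diffusion assms pt_nonneg pt_mono K_g'] by (simp_all add: pt_Suc)

lemma gen_piece_bound:
  assumes \<omega>: "\<omega> \<in> space M"
  shows "\<bar>gen_piece N i \<omega>\<bar> \<le> 2 * K\<^sup>2 * (T / real N)"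
proof -
  have x: "X (pt N i) \<omega> \<in> {a..b}" by (rule X_range[OF \<omega> pt_nonneg])
  have "\<bar>gen_piece N i \<omega>\<bar> \<le> \<bar>\<phi>1 (X (pt N i) \<omega>)\<bar> * \<bar>path_integral f (pt N i) (pt N (Suc i)) \<omega>\<bar>
     + \<bar>\<phi>2 (X (pt N i) \<omega>)\<bar> * \<bar>path_integral g (pt N i) (pt N (Suc i)) \<omega>\<bar>"
    unfolding gen_piece_def abs_mult[symmetric] by (rule abs_triangle_ineq)
  also have "\<dots> \<le> K * (K * (T / real N)) + K * (K * (T / real N))"
    by (intro add_mono mult_mono K_\<phi>1 K_\<phi>2 x path_integral_bound_K \<omega> K_nonneg abs_ge_zero)
  finally show ?thesis by (simp add: power2_eq_square)
qed

text \<open>Only \<open>\<phi>1\<close> and \<open>\<phi>2\<close> are frozen, so their Lipschitz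
  constant \<open>K\<close> and the bound \<open>K\<close> on \<open>f\<close> and \<open>g\<close>
  suffice; each of the two terms contributes \<open>K\<^sup>2 * e\<close> per unit of time.\<close>

lemma gen_piece_error:
  assumes \<omega>: "\<omega> \<in> space M" and e: "\<And>r. r \<in> {pt N i..pt N (Suc i)} \<Longrightarrow> \<bar>X (pt N i) \<omega> - X r \<omega>\<bar> \<le> e"
  shows "\<bar>gen_piece N i \<omega> - path_integral gen (pt N i) (pt N (Suc i)) \<omega>\<bar> \<le> (2 * K\<^sup>2 * e) * (T / real N)"
proof -
  let ?s = "pt N i" and ?t = "pt N (Suc i)"
  have x: "X ?s \<omega> \<in> {a..b}" by (rule X_range[OF \<omega> pt_nonneg])
  have e0: "0 \<le> e" using e[of ?s] pt_mono[of N i] by simp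
  have I: "((\<lambda>r. h (X r \<omega>)) has_integral path_integral h ?s ?t \<omega>) {?s..?t}"
    if "continuous_on {a..b} h" for h :: "real \<Rightarrow> real"
    unfolding path_integral_def by (rule integrable_integral[OF path_integrable[OF that \<omega> pt_nonneg]])
  have "((\<lambda>r. \<phi>1 (X ?s \<omega>) * f (X r \<omega>) + \<phi>2 (X ?s \<omega>) * g (X r \<omega>) - gen (X r \<omega>)) has_integral
      (gen_piece N i \<omega> - path_integral gen ?s ?t \<omega>)) {?s..?t}"
    unfolding gen_piece_def
    by (intro has_integral_diff has_integral_add has_integral_mult_right I continuous_drift
        continuous_diffusion continuous_gen)
  moreover have "norm (\<phi>1 (X ?s \<omega>) * f (X r \<omega>) + \<phi>2 (X ?s \<omega>) * g (X r \<omega>) - gen (X r \<omega>)) \<le> 2 * K\<^sup>2 * e"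
    if r: "r \<in> {?s..?t}" for r
  proof -
    have y: "X r \<omega> \<in> {a..b}" using X_range[OF \<omega>, of r] r pt_nonneg[of N i] by simp
    have eq: "\<phi>1 (X ?s \<omega>) * f (X r \<omega>) + \<phi>2 (X ?s \<omega>) * g (X r \<omega>) - gen (X r \<omega>)
      = (\<phi>1 (X ?s \<omega>) - \<phi>1 (X r \<omega>)) * f (X r \<omega>) + (\<phi>2 (X ?s \<omega>) - \<phi>2 (X r \<omega>)) * g (X r \<omega>)"
      by (simp add: gen_def algebra_simps)
    have "norm (\<phi>1 (X ?s \<omega>) * f (X r \<omega>) + \<phi>2 (X ?s \<omega>) * g (X r \<omega>) - gen (X r \<omega>))
      \<le> \<bar>\<phi>1 (X ?s \<omega>) - \<phi>1 (X r \<omega>)\<bar> * \<bar>f (X r \<omega>)\<bar> + \<bar>\<phi>2 (X ?s \<omega>) - \<phi>2 (X r \<omega>)\<bar> * \<bar>g (X r \<omega>)\<bar>"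
      unfolding eq abs_mult[symmetric] real_norm_def by (rule abs_triangle_ineq)
    also have "\<dots> \<le> (K * e) * K + (K * e) * K"
      by (intro add_mono mult_mono K_f[OF y] K_g'[OF y] mult_nonneg_nonneg K_nonneg e0 abs_ge_zero
          order_trans[OF test_lipschitz(1)[OF x y]] order_trans[OF test_lipschitz(2)[OF x y]]
          mult_left_mono[OF e[OF r]])
    finally show ?thesis by (simp add: power2_eq_square)
  qed
  ultimately have "norm (gen_piece N i \<omega> - path_integral gen ?s ?t \<omega>) \<le> (2 * K\<^sup>2 * e) * measure lborel {?s..?t}"
    using e0 by (intro has_integral_bound_real[of _ "{}"]) auto
  also have "measure lborel {?s..?t} = T / real N" using pt_mono[of N i] by (simp add: pt_Suc)
  finally show ?thesis by simp
qed

lemma path_integral_split: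
  assumes "continuous_on {a..b} h" "\<omega> \<in> space M"
  shows "path_integral h 0 (pt N k) \<omega> = (\<Sum>i<k. path_integral h (pt N i) (pt N (Suc i)) \<omega>)"
proof (induction k)
  case (Suc k)
  then show ?case using path_integral_add[OF assms order_refl pt_nonneg[of N k] pt_mono] by simp
qed (simp add: path_integral_def)

lemma gen_sum_tendsto:
  assumes \<omega>: "\<omega> \<in> space M"
  shows "(\<lambda>n. \<Sum>i<Suc n. gen_piece (Suc n) i \<omega>) \<longlonglongrightarrow> path_integral gen 0 T \<omega>"
proof (rule LIMSEQ_I)
  fix e :: real assume e: "0 < e"
  \<comment> \<open>The errors of all steps add up to \<open>2 * K\<^sup>2 * T * d\<close>; the
    extra 1 in the denominator makes this strictly less than \<open>e\<close> and keeps the quotient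
    meaningful when \<open>K\<close> or \<open>T\<close> is zero.\<close>
  define d where "d = e / (2 * K\<^sup>2 * T + 1)"
  have den: "0 < 2 * K\<^sup>2 * T + 1" using T_nonneg by (simp add: add_nonneg_pos)
  then have d: "0 < d" using e by (simp add: d_def)
  obtain n0 where n0: "\<forall>n\<ge>n0. \<forall>r\<in>{0..T}. \<forall>r'\<in>{0..T}. \<bar>r - r'\<bar> \<le> T / real (Suc n)
      \<longrightarrow> \<bar>X r \<omega> - X r' \<omega>\<bar> < d"
    using path_modulus[OF \<omega> d] by (elim exE)
  have "\<bar>(\<Sum>i<Suc n. gen_piece (Suc n) i \<omega>) - path_integral gen 0 T \<omega>\<bar> < e" if n: "n \<ge> n0" for n
  proof -
    let ?N = "Suc n"
    have eq: "(\<Sum>i<?N. gen_piece ?N i \<omega>) - path_integral gen 0 T \<omega>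
      = (\<Sum>i<?N. gen_piece ?N i \<omega> - path_integral gen (pt ?N i) (pt ?N (Suc i)) \<omega>)"
      using path_integral_split[OF continuous_gen \<omega>, of ?N ?N] unfolding pt_last[OF zero_less_Suc]
      by (simp only: sum_subtractf)
    have "\<bar>(\<Sum>i<?N. gen_piece ?N i \<omega>) - path_integral gen 0 T \<omega>\<bar>
      \<le> (\<Sum>i<?N. \<bar>gen_piece ?N i \<omega> - path_integral gen (pt ?N i) (pt ?N (Suc i)) \<omega>\<bar>)"
      unfolding eq by (rule sum_abs)
    also have "\<dots> \<le> (\<Sum>i<?N. (2 * K\<^sup>2 * d) * (T / real ?N))"
    proof (rule sum_mono)
      fix i assume "i \<in> {..<?N}"
      then have "i \<le> ?N" "Suc i \<le> ?N" by simp_all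
      from pt_le[OF this(1)] pt_le[OF this(2)] pt_nonneg[of ?N i]
      have i: "pt ?N i \<in> {0..T}" "pt ?N (Suc i) \<le> T" by simp_all
      show "\<bar>gen_piece ?N i \<omega> - path_integral gen (pt ?N i) (pt ?N (Suc i)) \<omega>\<bar> \<le> (2 * K\<^sup>2 * d) * (T / real ?N)"
      proof (rule gen_piece_error[OF \<omega>])
        fix r assume r: "r \<in> {pt ?N i..pt ?N (Suc i)}"
        then have "r \<in> {0..T}" "\<bar>pt ?N i - r\<bar> \<le> T / real ?N"
          using i unfolding pt_Suc by auto
        then show "\<bar>X (pt ?N i) \<omega> - X r \<omega>\<bar> \<le> d" using n0 n i(1) by (intro less_imp_le) blast
      qed
    qed
    also have "\<dots> = real ?N * ((2 * K\<^sup>2 * d) * (T / real ?N))" by (simp only: sum_constant card_lessThan)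
    also have "\<dots> = 2 * K\<^sup>2 * T * d" by (simp del: of_nat_Suc)
    also have "\<dots> < (2 * K\<^sup>2 * T + 1) * d" using d by (simp add: distrib_right)
    also have "\<dots> = e" using den by (simp add: d_def)
    finally show ?thesis .
  qed
  then show "\<exists>no. \<forall>n\<ge>no. norm ((\<Sum>i<Suc n. gen_piece (Suc n) i \<omega>) - path_integral gen 0 T \<omega>) < e"
    unfolding real_norm_def by blast
qed

lemma expectation_gen_sum_tendsto:
  "(\<lambda>n. expectation (\<lambda>\<omega>. \<Sum>i<Suc n. gen_piece (Suc n) i \<omega>)) \<longlonglongrightarrow> expectation (path_integral gen 0 T)"
proof (rule integral_dominated_convergence[where w="\<lambda>_. 2 * K\<^sup>2 * T"])
  show "AE \<omega> in M. (\<lambda>n. \<Sum>i<Suc n. gen_piece (Suc n) i \<omega>) \<longlonglongrightarrow> path_integral gen 0 T \<omega>"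
    by (rule AE_I2) (rule gen_sum_tendsto)
  show "AE \<omega> in M. norm (\<Sum>i<Suc n. gen_piece (Suc n) i \<omega>) \<le> 2 * K\<^sup>2 * T" for n
  proof (rule AE_I2)
    fix \<omega> assume \<omega>: "\<omega> \<in> space M"
    have "norm (\<Sum>i<Suc n. gen_piece (Suc n) i \<omega>) \<le> (\<Sum>i<Suc n. 2 * K\<^sup>2 * (T / real (Suc n)))"
      unfolding real_norm_def by (rule order_trans[OF sum_abs sum_mono[OF gen_piece_bound[OF \<omega>]]])
    also have "\<dots> = real (Suc n) * (2 * K\<^sup>2 * (T / real (Suc n)))" by (simp only: sum_constant card_lessThan)
    also have "\<dots> = 2 * K\<^sup>2 * T" by (simp del: of_nat_Suc)
    finally show "norm (\<Sum>i<Suc n. gen_piece (Suc n) i \<omega>) \<le> 2 * K\<^sup>2 * T" .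
  qed
  show "(\<lambda>\<omega>. \<Sum>i<Suc n. gen_piece (Suc n) i \<omega>) \<in> borel_measurable M" for n
    by (intro bounded_rv_measurable bounded_rv_sum bounded_rv_gen_piece) simp
  show "path_integral gen 0 T \<in> borel_measurable M"
    by (rule path_integral_measurable[OF continuous_gen order_refl])
qed simp

text \<open>The second-order term contains the square of the martingale part, not of the whole
  increment, because the weighted mean of the former is known exactly. The discrepancy is counted as
  part of the error.\<close>

definition taylor_error :: "nat \<Rightarrow> nat \<Rightarrow> 'w \<Rightarrow> real" where
  "taylor_error N i \<omega> = \<phi> (X (pt N (Suc i)) \<omega>) - \<phi> (X (pt N i) \<omega>) - \<phi>1 (X (pt N i) \<omega>) * incr N i \<omega>
    - \<phi>2 (X (pt N i) \<omega>) / 2 * (martingale_part (pt N i) (pt N (Suc i)) \<omega>)\<^sup>2"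

lemma bounded_rv_martingale_piece: "bounded_rv (martingale_part (pt N i) (pt N (Suc i)))"
  by (rule bounded_rv_martingale_part[OF pt_nonneg pt_mono])

lemma bounded_rv_test:
  "bounded_rv (\<lambda>\<omega>. \<phi> (X (pt N i) \<omega>))" "bounded_rv (\<lambda>\<omega>. \<phi>1 (X (pt N i) \<omega>))"
  "bounded_rv (\<lambda>\<omega>. \<phi>2 (X (pt N i) \<omega>))"
  by (intro bounded_rv_function_X continuous_test pt_nonneg)+

lemma bounded_rv_taylor_error: "bounded_rv (taylor_error N i)"
  unfolding taylor_error_def[abs_def] divide_inverse
  by (intro bounded_rv_diff bounded_rv_mult bounded_rv_power2 bounded_rv_const bounded_rv_test
      bounded_rv_incr bounded_rv_martingale_piece)

text \<open>Tested against functions of \<open>X (pt N i)\<close>, the martingale part has mean zero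
  and its square has the mean of twice the time integral of \<open>g\<close>. Hence the terms
  subtracted in \<open>taylor_error\<close> have exactly the mean of
  \<open>gen_piece\<close>.\<close>

lemma expectation_taylor_error:
  "expectation (\<lambda>\<omega>. \<phi> (X (pt N (Suc i)) \<omega>)) - expectation (\<lambda>\<omega>. \<phi> (X (pt N i) \<omega>)) - expectation (gen_piece N i)
    = expectation (taylor_error N i)"
proof -
  let ?s = "pt N i" and ?t = "pt N (Suc i)"
  let ?D = "martingale_part ?s ?t" and ?x = "X ?s"
  note bd = bounded_rv_integrable bounded_rv_diff bounded_rv_mult bounded_rv_power2 bounded_rv_test
    bounded_rv_gen_piece bounded_rv_martingale_piece bounded_rv_taylor_error
    bounded_rv_path_integral[OF continuous_diffusion pt_nonneg pt_mono]
  have 1: "expectation (\<lambda>\<omega>. \<phi>1 (?x \<omega>) * ?D \<omega>) = 0"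
    by (rule martingale_part_moments(1)[OF pt_nonneg pt_mono function_X_adapted[OF continuous_test(2) pt_nonneg]
          K_\<phi>1[OF X_range[OF _ pt_nonneg]]])
  have "expectation (\<lambda>\<omega>. \<phi>2 (?x \<omega>) * (?D \<omega>)\<^sup>2)
      = expectation (\<lambda>\<omega>. \<phi>2 (?x \<omega>) * path_integral (\<lambda>x. 2 * g x) ?s ?t \<omega>)"
    by (rule martingale_part_moments(2)[OF pt_nonneg pt_mono function_X_adapted[OF continuous_test(3) pt_nonneg]
          K_\<phi>2[OF X_range[OF _ pt_nonneg]]])
  also have "\<dots> = expectation (\<lambda>\<omega>. 2 * (\<phi>2 (?x \<omega>) * path_integral g ?s ?t \<omega>))"
    by (simp add: path_integral_def mult.left_commute)
  finally have 2: "expectation (\<lambda>\<omega>. \<phi>2 (?x \<omega>) * (?D \<omega>)\<^sup>2) = 2 * expectation (\<lambda>\<omega>. \<phi>2 (?x \<omega>) * path_integral g ?s ?t \<omega>)"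
    by simp
  have i1: "integrable M (\<lambda>\<omega>. \<phi>1 (?x \<omega>) * ?D \<omega>)" by (intro bd)
  have i2: "integrable M (\<lambda>\<omega>. \<phi>2 (?x \<omega>) * (?D \<omega>)\<^sup>2)" by (intro bd)
  have i3: "integrable M (\<lambda>\<omega>. \<phi>2 (?x \<omega>) * path_integral g ?s ?t \<omega>)" by (intro bd)
  have i4: "integrable M (taylor_error N i)" "integrable M (gen_piece N i)" by (intro bd)+
  have i5: "integrable M (\<lambda>\<omega>. \<phi> (X ?t \<omega>))" "integrable M (\<lambda>\<omega>. \<phi> (?x \<omega>))" by (intro bd)+
  have "expectation (\<lambda>\<omega>. \<phi> (X ?t \<omega>)) - expectation (\<lambda>\<omega>. \<phi> (?x \<omega>)) - expectation (gen_piece N i)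
    = expectation (\<lambda>\<omega>. \<phi> (X ?t \<omega>) - \<phi> (?x \<omega>) - gen_piece N i \<omega>)"
    using i4 i5 by simp
  also have "\<dots> = expectation (\<lambda>\<omega>. taylor_error N i \<omega> + \<phi>1 (?x \<omega>) * ?D \<omega> + (1 / 2) * (\<phi>2 (?x \<omega>) * (?D \<omega>)\<^sup>2)
      - \<phi>2 (?x \<omega>) * path_integral g ?s ?t \<omega>)"
  proof (rule Bochner_Integration.integral_cong[OF refl])
    fix \<omega>
    have "incr N i \<omega> = path_integral f ?s ?t \<omega> + ?D \<omega>" by (simp add: incr_def martingale_part_def)
    then show "\<phi> (X ?t \<omega>) - \<phi> (?x \<omega>) - gen_piece N i \<omega> = taylor_error N i \<omega> + \<phi>1 (?x \<omega>) * ?D \<omega>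
      + (1 / 2) * (\<phi>2 (?x \<omega>) * (?D \<omega>)\<^sup>2) - \<phi>2 (?x \<omega>) * path_integral g ?s ?t \<omega>"
      by (simp add: taylor_error_def gen_piece_def distrib_left)
  qed
  also have "\<dots> = expectation (taylor_error N i)"
    using i1 i2 i3 i4 1 2 by simp
  finally show ?thesis .
qed

text \<open>The three terms are arranged for summation over \<open>N\<close> steps: they add up to
  multiples of \<open>max_incr\<close> times the quadratic sum, of \<open>max_incr\<close>, and of
  the mesh, and all of these vanish in the mean.\<close>

lemma taylor_error_bound:
  assumes \<omega>: "\<omega> \<in> space M" and i: "i < N"
  shows "\<bar>taylor_error N i \<omega>\<bar> \<le> K * (max_incr N \<omega> * (incr N i \<omega>)\<^sup>2) + K\<^sup>2 * (T / real N) * max_incr N \<omega>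
    + K ^ 3 * (T / real N)\<^sup>2"
proof -
  let ?s = "pt N i" and ?t = "pt N (Suc i)"
  let ?D = "martingale_part ?s ?t \<omega>" and ?A = "path_integral f ?s ?t \<omega>" and ?d = "incr N i \<omega>"
    and ?m = "max_incr N \<omega>" and ?h = "T / real N"
  let ?R = "\<phi> (X ?t \<omega>) - \<phi> (X ?s \<omega>) - \<phi>1 (X ?s \<omega>) * (X ?t \<omega> - X ?s \<omega>)
      - \<phi>2 (X ?s \<omega>) / 2 * (X ?t \<omega> - X ?s \<omega>)\<^sup>2"
  have x: "X ?s \<omega> \<in> {a..b}" "X ?t \<omega> \<in> {a..b}" by (intro X_range[OF \<omega> pt_nonneg])+
  have D: "?D = ?d - ?A" by (simp add: incr_def martingale_part_def)
  have A: "\<bar>?A\<bar> \<le> K * ?h" by (rule path_integral_bound_K(1)[OF \<omega>])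
  have m: "\<bar>?d\<bar> \<le> ?m" by (rule incr_le_max[OF i])
  have h: "0 \<le> ?h" using T_nonneg by simp
  \<comment> \<open>Exchanging the squared increment for the squared martingale part costs
    \<open>?d\<^sup>2 - (?d - ?A)\<^sup>2 = ?A * (2 * ?d - ?A)\<close>, where \<open>?A\<close> is
    of the order of the mesh.\<close>
  have "taylor_error N i \<omega> = (?R) + (\<phi>2 (X ?s \<omega>) / 2) * (?A * (2 * ?d - ?A))"
    unfolding taylor_error_def D incr_def[of N i \<omega>, symmetric]
    by (simp add: power2_eq_square algebra_simps)
  then have "\<bar>taylor_error N i \<omega>\<bar> \<le> \<bar>?R\<bar> + \<bar>(\<phi>2 (X ?s \<omega>) / 2) * (?A * (2 * ?d - ?A))\<bar>"
    by (simp only: abs_triangle_ineq)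
  also have "\<dots> \<le> K * (?m * ?d\<^sup>2) + (K / 2) * ((K * ?h) * (2 * ?m + K * ?h))"
  proof (rule add_mono)
    have "\<bar>?R\<bar> \<le> K * \<bar>?d\<bar> ^ 3"
      unfolding incr_def by (rule Taylor_cubic[OF \<phi>_deriv \<phi>1_deriv \<phi>2_deriv K_\<phi>3 x])
    also have "\<bar>?d\<bar> ^ 3 = \<bar>?d\<bar> * ?d\<^sup>2" by (simp add: eval_nat_numeral)
    also have "K * (\<bar>?d\<bar> * ?d\<^sup>2) \<le> K * (?m * ?d\<^sup>2)"
      by (intro mult_left_mono mult_right_mono m K_nonneg zero_le_power2)
    finally show "\<bar>?R\<bar> \<le> K * (?m * ?d\<^sup>2)" .
    have "\<bar>2 * ?d - ?A\<bar> \<le> 2 * ?m + K * ?h" using A m by linarith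
    moreover have "\<bar>\<phi>2 (X ?s \<omega>) / 2\<bar> \<le> K / 2" using K_\<phi>2[OF x(1)] by simp
    ultimately show "\<bar>(\<phi>2 (X ?s \<omega>) / 2) * (?A * (2 * ?d - ?A))\<bar> \<le> (K / 2) * ((K * ?h) * (2 * ?m + K * ?h))"
      unfolding abs_mult[of _ "?A * (2 * ?d - ?A)"] abs_mult[of ?A]
      using A K_nonneg h by (intro mult_mono mult_nonneg_nonneg) auto
  qed
  also have "\<dots> = K * (?m * ?d\<^sup>2) + K\<^sup>2 * ?h * ?m + (K ^ 3 * ?h\<^sup>2) / 2"
    by (simp add: power2_eq_square power3_eq_cube algebra_simps)
  also have "\<dots> \<le> K * (?m * ?d\<^sup>2) + K\<^sup>2 * ?h * ?m + K ^ 3 * ?h\<^sup>2"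
  proof -
    have "0 \<le> K ^ 3 * ?h\<^sup>2" using K_nonneg by simp
    then show ?thesis by linarith
  qed
  finally show ?thesis .
qed

lemma dynkin_error:
  assumes N: "0 < N"
  shows "\<bar>expectation (\<lambda>\<omega>. \<phi> (X T \<omega>)) - expectation (\<lambda>\<omega>. \<phi> (X 0 \<omega>)) - expectation (\<lambda>\<omega>. \<Sum>i<N. gen_piece N i \<omega>)\<bar>
    \<le> K * expectation (\<lambda>\<omega>. max_incr N \<omega> * quadratic_sum N N \<omega>) + K\<^sup>2 * T * expectation (max_incr N)
      + K ^ 3 * T * (T / real N)"
proof -
  let ?m = "\<lambda>i. expectation (\<lambda>\<omega>. \<phi> (X (pt N i) \<omega>))"
  have sum_affine: "(\<Sum>i<N. u * (v * q i) + c) = u * (v * (\<Sum>i<N. q i)) + real N * c"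
    for u v c :: real and q
    by (simp add: sum.distrib sum_distrib_left)
  note bd = bounded_rv_integrable bounded_rv_gen_piece bounded_rv_taylor_error bounded_rv_sum
    bounded_rv_mult bounded_rv_max_incr[OF N] bounded_rv_quadratic_sum finite_lessThan
  have "expectation (\<lambda>\<omega>. \<phi> (X T \<omega>)) - expectation (\<lambda>\<omega>. \<phi> (X 0 \<omega>)) = (\<Sum>i<N. ?m (Suc i) - ?m i)"
    using sum_lessThan_telescope[of ?m N] unfolding pt_0 pt_last[OF N] by (rule sym)
  moreover have "expectation (\<lambda>\<omega>. \<Sum>i<N. gen_piece N i \<omega>) = (\<Sum>i<N. expectation (gen_piece N i))"
    by (rule Bochner_Integration.integral_sum) (intro bd)
  ultimately have eq: "expectation (\<lambda>\<omega>. \<phi> (X T \<omega>)) - expectation (\<lambda>\<omega>. \<phi> (X 0 \<omega>)) - expectation (\<lambda>\<omega>. \<Sum>i<N. gen_piece N i \<omega>)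
    = (\<Sum>i<N. expectation (taylor_error N i))"
    by (simp only: sum_subtractf[symmetric] expectation_taylor_error)
  have eq': "(\<Sum>i<N. expectation (taylor_error N i)) = expectation (\<lambda>\<omega>. \<Sum>i<N. taylor_error N i \<omega>)"
    by (rule Bochner_Integration.integral_sum[symmetric]) (intro bd)
  have "\<bar>expectation (\<lambda>\<omega>. \<Sum>i<N. taylor_error N i \<omega>)\<bar> \<le> expectation (\<lambda>\<omega>. \<bar>\<Sum>i<N. taylor_error N i \<omega>\<bar>)"
    by (rule integral_abs_bound)
  also have "\<dots> \<le> expectation (\<lambda>\<omega>. K * (max_incr N \<omega> * quadratic_sum N N \<omega>) + K\<^sup>2 * T * max_incr N \<omega>
      + K ^ 3 * T * (T / real N))"
  proof (rule Bochner_Integration.integral_mono)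
    show "integrable M (\<lambda>\<omega>. \<bar>\<Sum>i<N. taylor_error N i \<omega>\<bar>)"
      by (intro integrable_abs bd)
    show "integrable M (\<lambda>\<omega>. K * (max_incr N \<omega> * quadratic_sum N N \<omega>) + K\<^sup>2 * T * max_incr N \<omega>
      + K ^ 3 * T * (T / real N))"
      by (intro bounded_rv_integrable bounded_rv_add bounded_rv_const bd)
    fix \<omega> assume \<omega>: "\<omega> \<in> space M"
    have "\<bar>\<Sum>i<N. taylor_error N i \<omega>\<bar> \<le> (\<Sum>i<N. \<bar>taylor_error N i \<omega>\<bar>)" by (rule sum_abs)
    also have "\<dots> \<le> (\<Sum>i<N. K * (max_incr N \<omega> * (incr N i \<omega>)\<^sup>2) + (K\<^sup>2 * (T / real N) * max_incr N \<omega>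
      + K ^ 3 * (T / real N)\<^sup>2))"
      using taylor_error_bound[OF \<omega>] by (intro sum_mono) (simp add: add.assoc)
    also have "\<dots> = K * (max_incr N \<omega> * quadratic_sum N N \<omega>) + real N * (K\<^sup>2 * (T / real N) * max_incr N \<omega>
      + K ^ 3 * (T / real N)\<^sup>2)"
      unfolding quadratic_sum_def by (rule sum_affine)
    also have "\<dots> = K * (max_incr N \<omega> * quadratic_sum N N \<omega>) + K\<^sup>2 * T * max_incr N \<omega> + K ^ 3 * T * (T / real N)"
      using N by (simp add: distrib_left power2_eq_square)
    finally show "\<bar>\<Sum>i<N. taylor_error N i \<omega>\<bar> \<le> K * (max_incr N \<omega> * quadratic_sum N N \<omega>) + K\<^sup>2 * T * max_incr N \<omega>
      + K ^ 3 * T * (T / real N)" .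
  qed
  also have "\<dots> = K * expectation (\<lambda>\<omega>. max_incr N \<omega> * quadratic_sum N N \<omega>) + K\<^sup>2 * T * expectation (max_incr N)
      + K ^ 3 * T * (T / real N)"
  proof -
    have "integrable M (\<lambda>\<omega>. max_incr N \<omega> * quadratic_sum N N \<omega>)" "integrable M (max_incr N)"
      by (intro bd)+
    then show ?thesis by (simp add: prob_space)
  qed
  finally show ?thesis unfolding eq eq' .
qed

text \<open>By Cauchy-Schwarz the mean of \<open>max_incr\<close> times the quadratic sum is at most
  \<open>v n * C\<close>: the root mean square of the largest increment tends to zero, while the
  second moment of the quadratic sum is bounded by a constant independent of the partition.\<close>

theorem dynkin:
  "expectation (\<lambda>\<omega>. \<phi> (X T \<omega>)) - expectation (\<lambda>\<omega>. \<phi> (X 0 \<omega>)) = expectation (path_integral gen 0 T)"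
proof -
  define v where "v n = sqrt (expectation (\<lambda>\<omega>. (max_incr (Suc n) \<omega>)\<^sup>2))" for n
  define C where "C = sqrt ((2 * (speed * T) + (b - a)\<^sup>2) * (speed * T))"
  let ?\<Delta> = "expectation (\<lambda>\<omega>. \<phi> (X T \<omega>)) - expectation (\<lambda>\<omega>. \<phi> (X 0 \<omega>))"
  let ?S = "\<lambda>n. expectation (\<lambda>\<omega>. \<Sum>i<Suc n. gen_piece (Suc n) i \<omega>)"
  have v: "v \<longlonglongrightarrow> 0" unfolding v_def using tendsto_real_sqrt[OF max_incr_mean_square] by simp
  have bound: "norm (?\<Delta> - ?S n) \<le> K * (v n * C) + K\<^sup>2 * T * v n + K ^ 3 * T * (T / real (Suc n))" for n
  proof -
    let ?N = "Suc n"
    have N: "0 < ?N" by simp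
    note m = bounded_rv_max_incr[OF N]
    have "expectation (max_incr ?N) \<le> v n"
      unfolding v_def using expectation_abs_le_sqrt[OF m] max_incr_nonneg[OF N] by simp
    moreover have "expectation (\<lambda>\<omega>. max_incr ?N \<omega> * quadratic_sum ?N ?N \<omega>) \<le> v n * C"
    proof -
      have "expectation (\<lambda>\<omega>. max_incr ?N \<omega> * quadratic_sum ?N ?N \<omega>)
        = expectation (\<lambda>\<omega>. \<bar>max_incr ?N \<omega> * quadratic_sum ?N ?N \<omega>\<bar>)"
        using max_incr_nonneg[OF N] quadratic_sum_nonneg by simp
      also have "\<dots> \<le> v n * sqrt (expectation (\<lambda>\<omega>. (quadratic_sum ?N ?N \<omega>)\<^sup>2))"
        unfolding v_def
        by (intro Cauchy_Schwarz_integral bounded_rv_measurable[OF m]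
            bounded_rv_measurable[OF bounded_rv_quadratic_sum] bounded_rv_integrable bounded_rv_power2 m
            bounded_rv_quadratic_sum)
      also have "\<dots> \<le> v n * C"
        unfolding C_def using expectation_quadratic_sum_square[OF N]
        by (intro mult_left_mono real_sqrt_le_mono) (simp_all add: v_def)
      finally show ?thesis .
    qed
    ultimately have "K * expectation (\<lambda>\<omega>. max_incr ?N \<omega> * quadratic_sum ?N ?N \<omega>) + K\<^sup>2 * T * expectation (max_incr ?N)
      + K ^ 3 * T * (T / real ?N) \<le> K * (v n * C) + K\<^sup>2 * T * v n + K ^ 3 * T * (T / real ?N)"
      using K_nonneg T_nonneg by (intro add_mono mult_left_mono order_refl mult_nonneg_nonneg) auto
    with dynkin_error[OF N] show ?thesis unfolding real_norm_def by linarith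
  qed
  have "(\<lambda>n. K * (v n * C) + K\<^sup>2 * T * v n + K ^ 3 * T * (T / real (Suc n)))
      \<longlonglongrightarrow> K * (0 * C) + K\<^sup>2 * T * 0 + K ^ 3 * T * 0"
    by (intro tendsto_add tendsto_mult tendsto_const v LIMSEQ_Suc[OF lim_const_over_n])
  then have "(\<lambda>n. K * (v n * C) + K\<^sup>2 * T * v n + K ^ 3 * T * (T / real (Suc n))) \<longlonglongrightarrow> 0"
    by simp
  then have "(\<lambda>n. ?\<Delta> - ?S n) \<longlonglongrightarrow> 0"
    by (rule Lim_null_comparison[OF always_eventually[OF allI[OF bound]]])
  from tendsto_diff[OF tendsto_const[of ?\<Delta>] this] have "?S \<longlonglongrightarrow> ?\<Delta>" by simp
  then show ?thesis using LIMSEQ_unique[OF expectation_gen_sum_tendsto] by simp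
qed

end

section \<open>Test functions\<close>

text \<open>The test function is hidden behind an existential so that only \<open>\<rho>\<close> and
  \<open>B\<close> remain visible; \<open>B\<close> can then be kept fixed along a sequence of
  functions \<open>\<rho>\<close>. Only \<open>\<phi>3\<close> carries an explicit derivative bound,
  since \<open>\<phi>1\<close> and \<open>\<phi>2\<close> are differentiable and so bounded on the
  compact interval.\<close>

definition generator_bound ::
  "real \<Rightarrow> real \<Rightarrow> (real \<Rightarrow> real) \<Rightarrow> (real \<Rightarrow> real) \<Rightarrow> (real \<Rightarrow> real) \<Rightarrow> real \<Rightarrow> bool" where
  "generator_bound a b f g \<rho> B \<longleftrightarrow> (\<exists>\<phi> \<phi>1 \<phi>2 \<phi>3 K. \<forall>x\<in>{a..b}.
     (\<phi> has_real_derivative \<phi>1 x) (at x) \<and> (\<phi>1 has_real_derivative \<phi>2 x) (at x) \<and>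
     (\<phi>2 has_real_derivative \<phi>3 x) (at x) \<and> \<bar>\<phi>3 x\<bar> \<le> K \<and> 0 \<le> \<phi> x \<and> \<phi> x \<le> B \<and>
     f x * \<phi>1 x + g x * \<phi>2 x \<le> - \<rho> x)"

text \<open>Reflecting the interval changes the sign of the odd derivatives; with the sign of the
  drift changed as well, the generator is preserved.\<close>

lemma generator_bound_reflect:
  assumes "generator_bound a b (\<lambda>x. - f (a + b - x)) (\<lambda>x. g (a + b - x)) \<rho> B"
  shows "generator_bound a b f g (\<lambda>x. \<rho> (a + b - x)) B"
proof -
  obtain \<phi> \<phi>1 \<phi>2 \<phi>3 K where t: "\<forall>x\<in>{a..b}.
     (\<phi> has_real_derivative \<phi>1 x) (at x) \<and> (\<phi>1 has_real_derivative \<phi>2 x) (at x) \<and>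
     (\<phi>2 has_real_derivative \<phi>3 x) (at x) \<and> \<bar>\<phi>3 x\<bar> \<le> K \<and> 0 \<le> \<phi> x \<and> \<phi> x \<le> B \<and>
     - f (a + b - x) * \<phi>1 x + g (a + b - x) * \<phi>2 x \<le> - \<rho> x"
    using assms unfolding generator_bound_def by (elim exE)
  have "((\<lambda>x. h (a + b - x)) has_real_derivative - D) (at x)"
    if "(h has_real_derivative D) (at (a + b - x))" for h D x
  proof -
    have "((\<lambda>x. a + b - x) has_real_derivative -1) (at x)"
      by (auto intro!: derivative_eq_intros)
    from DERIV_chain2[OF that this] show ?thesis by simp
  qed
  note d = this
  show ?thesis unfolding generator_bound_def
  proof (rule exI[of _ "\<lambda>x. \<phi> (a + b - x)"], rule exI[of _ "\<lambda>x. - \<phi>1 (a + b - x)"],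
      rule exI[of _ "\<lambda>x. \<phi>2 (a + b - x)"], rule exI[of _ "\<lambda>x. - \<phi>3 (a + b - x)"], rule exI[of _ K], rule ballI)
    fix x assume "x \<in> {a..b}"
    then have "a + b - x \<in> {a..b}" by auto
    note y = bspec[OF t this]
    have "((\<lambda>x. - \<phi>1 (a + b - x)) has_real_derivative - (- \<phi>2 (a + b - x))) (at x)"
      by (rule DERIV_minus[OF d]) (use y in blast)
    then show "((\<lambda>x. \<phi> (a + b - x)) has_real_derivative - \<phi>1 (a + b - x)) (at x) \<and>
      ((\<lambda>x. - \<phi>1 (a + b - x)) has_real_derivative \<phi>2 (a + b - x)) (at x) \<and>
      ((\<lambda>x. \<phi>2 (a + b - x)) has_real_derivative - \<phi>3 (a + b - x)) (at x) \<and>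
      \<bar>- \<phi>3 (a + b - x)\<bar> \<le> K \<and> 0 \<le> \<phi> (a + b - x) \<and> \<phi> (a + b - x) \<le> B \<and>
      f x * - \<phi>1 (a + b - x) + g x * \<phi>2 (a + b - x) \<le> - \<rho> (a + b - x)"
      using y d[of \<phi>] d[of \<phi>2] by simp
  qed
qed

text \<open>The test function is \<open>\<phi> = sqrt (u + \<epsilon>)\<close> with \<open>u = (1 - exp (- C (x - a))) / C\<close>. The exponential
  makes the drift term nonpositive, and concavity of the square root produces the term
  \<open>g / (x - a + \<epsilon>)\<close>, which is of order one up to the boundary.\<close>

lemma generator_bound_at_left_end:
  fixes a b C :: real and f g w :: "real \<Rightarrow> real"
  assumes ab: "a < b" and C: "0 < C"
    and g: "\<And>x. x \<in> {a..b} \<Longrightarrow> 0 \<le> g x"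
    and fg: "\<And>x. x \<in> {a..b} \<Longrightarrow> f x \<le> C * g x"
    and w: "\<And>x. x \<in> {a..b} \<Longrightarrow> w x * (x - a) \<le> (C * g x - f x) * (x - a) + g x"
  shows "\<exists>c B. 0 < c \<and> 0 \<le> B \<and> (\<forall>\<epsilon>. 0 < \<epsilon> \<longrightarrow> \<epsilon> \<le> 1 \<longrightarrow>
    generator_bound a b f g (\<lambda>x. c * (w x * (x - a) / (x - a + \<epsilon>))) B)"
proof -
  \<comment> \<open>For \<open>\<epsilon> \<le> 1\<close>, \<open>D\<close> bounds
    \<open>u + \<epsilon>\<close>, and \<open>m\<close> is the least value of the exponential on
    \<open>{a..b}\<close>. The drift and the diffusion term call for
    \<open>c \<le> m / (2 * sqrt D)\<close> and \<open>c \<le> m\<^sup>2 / (4 * sqrt D)\<close>;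
    since \<open>m \<le> 1\<close>, the second condition implies the first.\<close>
  define D where "D = 1 / C + 1"
  define m where "m = exp (- C * (b - a))"
  define c where "c = m\<^sup>2 / (4 * sqrt D)"
  have D0: "0 < D" using C by (simp add: D_def add_pos_pos)
  then have D: "0 < sqrt D" by simp
  have m: "0 < m" "m \<le> 1" using C ab by (simp_all add: m_def)
  have c: "0 < c" using D m by (simp add: c_def)
  have "generator_bound a b f g (\<lambda>x. c * (w x * (x - a) / (x - a + \<epsilon>))) (sqrt D)"
    if \<epsilon>: "0 < \<epsilon>" "\<epsilon> \<le> 1" for \<epsilon>
  proof -
    define E where "E x = exp (- C * (x - a))" for x
    define v where "v x = (1 - E x) / C + \<epsilon>" for x
    define s where "s x = sqrt (v x)" for x
    define \<phi>1 where "\<phi>1 x = E x / (2 * s x)" for x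
    define \<phi>2 where "\<phi>2 x = - C * E x / (2 * s x) - (E x)\<^sup>2 / (4 * s x ^ 3)" for x
    define \<phi>3 where "\<phi>3 x = C\<^sup>2 * E x / (2 * s x) + 3 * C * (E x)\<^sup>2 / (4 * s x ^ 3) + 3 * E x ^ 3 / (8 * s x ^ 5)" for x
    have E1: "E x \<le> 1" if "x \<in> {a..b}" for x using that C by (simp add: E_def)
    have v0: "0 < v x" if "x \<in> {a..b}" for x
      unfolding v_def using E1[OF that] C \<epsilon>(1) by (intro add_nonneg_pos divide_nonneg_pos) auto
    have s0: "0 < s x" if "x \<in> {a..b}" for x using v0[OF that] by (simp add: s_def)
    have ss: "s x ^ 2 = v x" if "x \<in> {a..b}" for x using v0[OF that] by (simp add: s_def)
    have dE: "(E has_real_derivative - C * E x) (at x)" for x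
      unfolding E_def[abs_def] by (auto intro!: derivative_eq_intros)
    have dv: "(v has_real_derivative E x) (at x)" for x
      unfolding v_def[abs_def] using C by (auto intro!: derivative_eq_intros dE)
    have ds: "(s has_real_derivative \<phi>1 x) (at x)" if x: "x \<in> {a..b}" for x
      unfolding s_def[abs_def] \<phi>1_def
      using v0[OF x] by (auto intro!: derivative_eq_intros dv simp: field_simps)
    have d1: "(\<phi>1 has_real_derivative \<phi>2 x) (at x)" if x: "x \<in> {a..b}" for x
    proof -
      have "(\<phi>1 has_real_derivative ((- C * E x) * (2 * s x) - E x * (2 * \<phi>1 x)) / ((2 * s x) * (2 * s x))) (at x)"
        unfolding \<phi>1_def[abs_def] using s0[OF x] ds[OF x]
        by (intro DERIV_divide dE DERIV_cmult) (auto simp: \<phi>1_def[abs_def])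
      also have "((- C * E x) * (2 * s x) - E x * (2 * \<phi>1 x)) / ((2 * s x) * (2 * s x)) = \<phi>2 x"
        using s0[OF x] by (simp add: \<phi>1_def \<phi>2_def field_simps power2_eq_square power3_eq_cube)
      finally show ?thesis .
    qed
    have ds3: "((\<lambda>x. 4 * s x ^ 3) has_real_derivative 12 * (s x)\<^sup>2 * \<phi>1 x) (at x)" if x: "x \<in> {a..b}" for x
      by (auto intro!: derivative_eq_intros ds[OF x])
    have dE2: "((\<lambda>x. (E x)\<^sup>2) has_real_derivative - 2 * C * (E x)\<^sup>2) (at x)" for x
      by (auto intro!: derivative_eq_intros dE simp: power2_eq_square)
    have d2: "(\<phi>2 has_real_derivative \<phi>3 x) (at x)" if x: "x \<in> {a..b}" for x
    proof -
      have *: "\<phi>2 = (\<lambda>x. - C * \<phi>1 x - (E x)\<^sup>2 / (4 * s x ^ 3))"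
        by (simp add: fun_eq_iff \<phi>1_def \<phi>2_def)
      have "((\<lambda>x. - C * \<phi>1 x - (E x)\<^sup>2 / (4 * s x ^ 3)) has_real_derivative - C * \<phi>2 x
        - ((- 2 * C * (E x)\<^sup>2) * (4 * s x ^ 3) - (E x)\<^sup>2 * (12 * (s x)\<^sup>2 * \<phi>1 x)) / ((4 * s x ^ 3) * (4 * s x ^ 3))) (at x)"
        using s0[OF x] by (intro DERIV_diff DERIV_cmult DERIV_divide dE2 ds3[OF x] d1[OF x]) auto
      also have "- C * \<phi>2 x
        - ((- 2 * C * (E x)\<^sup>2) * (4 * s x ^ 3) - (E x)\<^sup>2 * (12 * (s x)\<^sup>2 * \<phi>1 x)) / ((4 * s x ^ 3) * (4 * s x ^ 3)) = \<phi>3 x"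
        using s0[OF x] unfolding \<phi>1_def \<phi>2_def \<phi>3_def
        by (simp add: field_simps) (simp add: eval_nat_numeral algebra_simps)
      finally show ?thesis unfolding * .
    qed
    have "continuous_on {a..b} \<phi>3"
    proof -
      have "continuous_on {a..b} E" "continuous_on {a..b} s"
        using dE ds by (meson DERIV_isCont continuous_at_imp_continuous_on)+
      then show ?thesis unfolding \<phi>3_def[abs_def] using s0 less_imp_neq[OF s0]
        by (intro continuous_intros) (auto dest: s0)
    qed
    then obtain K where K: "\<forall>x\<in>{a..b}. \<bar>\<phi>3 x\<bar> \<le> K" using continuous_on_Icc_bounded by blast
    show ?thesis unfolding generator_bound_def
    proof (rule exI[of _ s], rule exI[of _ \<phi>1], rule exI[of _ \<phi>2], rule exI[of _ \<phi>3], rule exI[of _ K],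
        intro ballI conjI)
      fix x assume x: "x \<in> {a..b}"
      show "(s has_real_derivative \<phi>1 x) (at x)" "(\<phi>1 has_real_derivative \<phi>2 x) (at x)"
        "(\<phi>2 has_real_derivative \<phi>3 x) (at x)" "\<bar>\<phi>3 x\<bar> \<le> K" "0 \<le> s x"
        using ds d1 d2 K s0 x by (auto intro: less_imp_le)
      have E0: "0 < E x" by (simp add: E_def)
      have "v x \<le> 1 / C + \<epsilon>" unfolding v_def using E0 C by (intro add_right_mono divide_right_mono) auto
      then show sD: "s x \<le> sqrt D" unfolding s_def D_def using \<epsilon> by simp
      have mE: "m \<le> E x" unfolding m_def E_def using x C by simp
      \<comment> \<open>\<open>y\<close> dominates \<open>v x\<close> because
        \<open>1 - exp (- z) \<le> z\<close>; thus \<open>1 / y\<close> is a lower bound for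
        \<open>1 / v x\<close>.\<close>
      define y where "y = x - a + \<epsilon>"
      have y: "0 < y" using x \<epsilon> by (simp add: y_def)
      have "1 - E x \<le> C * (x - a)" unfolding E_def using exp_ge_add_one_self[of "- C * (x - a)"] by simp
      then have "(1 - E x) / C \<le> x - a" using C by (simp add: divide_le_eq mult.commute)
      then have vy: "v x \<le> y" by (simp add: v_def y_def)
      have q: "0 \<le> C * g x - f x" using fg[OF x] by simp
      have "c * (w x * (x - a)) \<le> c * ((C * g x - f x) * (x - a) + g x)"
        using w[OF x] c by simp
      also have "\<dots> \<le> c * ((C * g x - f x) * y + g x)"
        using q c \<epsilon> by (intro mult_left_mono add_right_mono) (auto simp: y_def)
      finally have "c * (w x * (x - a)) / y \<le> c * ((C * g x - f x) * y + g x) / y"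
        using y by (intro divide_right_mono) auto
      also have "\<dots> = c * (C * g x - f x) + c * g x / y"
        using y by (simp add: field_simps)
      \<comment> \<open>The comparison is made term by term. The diffusion term uses
        \<open>s x ^ 3 = s x * v x\<close> with \<open>s x \<le> sqrt D\<close> and
        \<open>v x \<le> y\<close>.\<close>
      also have "\<dots> \<le> (E x / (2 * s x)) * (C * g x - f x) + g x * ((E x)\<^sup>2 / (4 * s x ^ 3))"
      proof (rule add_mono)
        have "m\<^sup>2 \<le> m" using m by (simp add: power2_eq_square mult_left_le)
        then have m2: "m\<^sup>2 \<le> 2 * m" using m by linarith
        have "c = m\<^sup>2 / (4 * sqrt D)" by (rule c_def)
        also have "\<dots> \<le> (2 * m) / (4 * sqrt D)" using m2 D by (intro divide_right_mono) auto
        also have "\<dots> = m / (2 * sqrt D)" by simp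
        also have "\<dots> \<le> E x / (2 * s x)" using mE sD s0[OF x] m by (intro frac_le) auto
        finally show "c * (C * g x - f x) \<le> (E x / (2 * s x)) * (C * g x - f x)"
          using q by (rule mult_right_mono)
        have s3: "s x ^ 3 = s x * v x" using ss[OF x] by (simp add: power3_eq_cube power2_eq_square)
        have "c / y = m\<^sup>2 / (4 * (sqrt D * y))" by (simp add: c_def)
        also have "\<dots> \<le> (E x)\<^sup>2 / (4 * (s x * v x))"
          using mE sD s0[OF x] v0[OF x] vy m D0
          by (intro frac_le power_mono mult_left_mono mult_mono) auto
        finally have "c / y \<le> (E x)\<^sup>2 / (4 * s x ^ 3)" unfolding s3 .
        then have "g x * (c / y) \<le> g x * ((E x)\<^sup>2 / (4 * s x ^ 3))" using g[OF x] by (rule mult_left_mono)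
        then show "c * g x / y \<le> g x * ((E x)\<^sup>2 / (4 * s x ^ 3))" by (simp add: mult.commute)
      qed
      \<comment> \<open>The second derivative of \<open>u\<close> is \<open>- C * E\<close>; it
        supplies the \<open>C * g x\<close> that outweighs the drift.\<close>
      also have "\<dots> = - (f x * \<phi>1 x + g x * \<phi>2 x)"
        by (simp add: \<phi>1_def \<phi>2_def algebra_simps diff_divide_distrib)
      finally show "f x * \<phi>1 x + g x * \<phi>2 x \<le> - (c * (w x * (x - a) / (x - a + \<epsilon>)))"
        by (simp add: y_def)
    qed
  qed
  moreover have "0 \<le> sqrt D" using D by simp
  ultimately show ?thesis using c by blast
qed

lemma generator_bound_at_right_end:
  fixes a b C :: real and f g w :: "real \<Rightarrow> real"
  assumes ab: "a < b" and C: "0 < C"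
    and g: "\<And>x. x \<in> {a..b} \<Longrightarrow> 0 \<le> g x"
    and fg: "\<And>x. x \<in> {a..b} \<Longrightarrow> - f x \<le> C * g x"
    and w: "\<And>x. x \<in> {a..b} \<Longrightarrow> w x * (b - x) \<le> (C * g x + f x) * (b - x) + g x"
  shows "\<exists>c B. 0 < c \<and> 0 \<le> B \<and> (\<forall>\<epsilon>. 0 < \<epsilon> \<longrightarrow> \<epsilon> \<le> 1 \<longrightarrow>
    generator_bound a b f g (\<lambda>x. c * (w x * (b - x) / (b - x + \<epsilon>))) B)"
proof -
  have "\<exists>c B. 0 < c \<and> 0 \<le> B \<and> (\<forall>\<epsilon>. 0 < \<epsilon> \<longrightarrow> \<epsilon> \<le> 1 \<longrightarrow>
    generator_bound a b (\<lambda>x. - f (a + b - x)) (\<lambda>x. g (a + b - x))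
      (\<lambda>x. c * (w (a + b - x) * (x - a) / (x - a + \<epsilon>))) B)"
  proof (rule generator_bound_at_left_end[OF ab C])
    fix x assume "x \<in> {a..b}"
    then have y: "a + b - x \<in> {a..b}" by auto
    show "0 \<le> g (a + b - x)" "- f (a + b - x) \<le> C * g (a + b - x)"
      "w (a + b - x) * (x - a) \<le> (C * g (a + b - x) - - f (a + b - x)) * (x - a) + g (a + b - x)"
      using g[OF y] fg[OF y] w[OF y] by simp_all
  qed
  then obtain c B where cB: "0 < c" "0 \<le> B" and gb: "\<forall>\<epsilon>. 0 < \<epsilon> \<longrightarrow> \<epsilon> \<le> 1 \<longrightarrow>
    generator_bound a b (\<lambda>x. - f (a + b - x)) (\<lambda>x. g (a + b - x))
      (\<lambda>x. c * (w (a + b - x) * (x - a) / (x - a + \<epsilon>))) B" by (elim exE conjE)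
  have "generator_bound a b f g (\<lambda>x. c * (w x * (b - x) / (b - x + \<epsilon>))) B" if "0 < \<epsilon>" "\<epsilon> \<le> 1" for \<epsilon>
    using generator_bound_reflect[OF gb[rule_format, OF that]] by simp
  with cB show ?thesis by blast
qed

section \<open>Occupation times\<close>

context bounded_sde
begin

interpretation P: pair_sigma_finite M lborel ..

text \<open>In Dynkin's formula \<open>- gen\<close> dominates \<open>\<rho>\<close>, and the
  difference of the two means of \<open>\<phi>\<close> is at most \<open>B\<close>. The bound is
  free of \<open>t\<close>, so the horizon may later tend to infinity.\<close>

lemma expectation_path_integral_le:
  assumes gb: "generator_bound a b f g \<rho> B" and \<rho>: "continuous_on {a..b} \<rho>" and t: "0 \<le> t"
  shows "expectation (path_integral \<rho> 0 t) \<le> B"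
proof -
  obtain \<phi> \<phi>1 \<phi>2 \<phi>3 K3 where tf: "\<forall>x\<in>{a..b}.
     (\<phi> has_real_derivative \<phi>1 x) (at x) \<and> (\<phi>1 has_real_derivative \<phi>2 x) (at x) \<and>
     (\<phi>2 has_real_derivative \<phi>3 x) (at x) \<and> \<bar>\<phi>3 x\<bar> \<le> K3 \<and> 0 \<le> \<phi> x \<and> \<phi> x \<le> B \<and>
     f x * \<phi>1 x + g x * \<phi>2 x \<le> - \<rho> x"
    using gb unfolding generator_bound_def by (elim exE)
  have c: "continuous_on {a..b} \<phi>1" "continuous_on {a..b} \<phi>2"
    using tf by (meson DERIV_isCont continuous_at_imp_continuous_on)+
  have c2: "continuous_on {a..b} (\<lambda>x. 2 * g x)" by (intro continuous_intros continuous_diffusion)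
  obtain K1 K2 K4 K5 where K: "\<forall>x\<in>{a..b}. \<bar>\<phi>1 x\<bar> \<le> K1" "\<forall>x\<in>{a..b}. \<bar>\<phi>2 x\<bar> \<le> K2"
    "\<forall>x\<in>{a..b}. \<bar>f x\<bar> \<le> K4" "\<forall>x\<in>{a..b}. \<bar>2 * g x\<bar> \<le> K5"
    using continuous_on_Icc_bounded[OF c(1)] continuous_on_Icc_bounded[OF c(2)]
      continuous_on_Icc_bounded[OF continuous_drift] continuous_on_Icc_bounded[OF c2] by (elim exE)
  define K where "K = max K1 (max K2 (max K3 (max K4 K5)))"
  interpret D: bounded_sde_test M F W f g a b x0 X \<phi> \<phi>1 \<phi>2 \<phi>3 K t
  proof
    fix x assume x: "x \<in> {a..b}"
    note y = bspec[OF tf x]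
    show "(\<phi> has_real_derivative \<phi>1 x) (at x)" "(\<phi>1 has_real_derivative \<phi>2 x) (at x)"
      "(\<phi>2 has_real_derivative \<phi>3 x) (at x)" using y by blast+
    show "\<bar>f x\<bar> \<le> K" "\<bar>2 * g x\<bar> \<le> K" "\<bar>\<phi>1 x\<bar> \<le> K" "\<bar>\<phi>2 x\<bar> \<le> K" "\<bar>\<phi>3 x\<bar> \<le> K"
      using y K[THEN bspec, OF x] unfolding K_def by (simp_all add: le_max_iff_disj)
  qed (rule t)
  have iphi: "integrable M (\<lambda>\<omega>. \<phi> (X s \<omega>))" if "0 \<le> s" for s
    by (rule bounded_rv_integrable[OF D.bounded_rv_function_X[OF D.continuous_test(1) that]])
  have irho: "integrable M (path_integral \<rho> 0 t)"
    by (rule bounded_rv_integrable[OF D.bounded_rv_path_integral[OF \<rho> order_refl t]])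
  have igen: "integrable M (path_integral D.gen 0 t)"
    by (rule bounded_rv_integrable[OF D.bounded_rv_path_integral[OF D.continuous_gen order_refl t]])
  have "expectation (path_integral \<rho> 0 t) \<le> expectation (\<lambda>\<omega>. - path_integral D.gen 0 t \<omega>)"
  proof (rule Bochner_Integration.integral_mono)
    fix \<omega> assume \<omega>: "\<omega> \<in> space M"
    have "path_integral D.gen 0 t \<omega> \<le> integral {0..t} (\<lambda>r. - \<rho> (X r \<omega>))"
      unfolding path_integral_def
    proof (rule integral_le)
      show "(\<lambda>r. D.gen (X r \<omega>)) integrable_on {0..t}"
        by (rule path_integrable[OF D.continuous_gen \<omega> order_refl])
      show "(\<lambda>r. - \<rho> (X r \<omega>)) integrable_on {0..t}"
        by (rule integrable_neg[OF path_integrable[OF \<rho> \<omega> order_refl]])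
      show "D.gen (X r \<omega>) \<le> - \<rho> (X r \<omega>)" if "r \<in> {0..t}" for r
        using bspec[OF tf X_range[OF \<omega>, of r]] that by (simp add: D.gen_def)
    qed
    then show "path_integral \<rho> 0 t \<omega> \<le> - path_integral D.gen 0 t \<omega>"
      by (simp add: path_integral_def)
  qed (use igen irho in auto)
  also have "\<dots> = expectation (\<lambda>\<omega>. \<phi> (X 0 \<omega>)) - expectation (\<lambda>\<omega>. \<phi> (X t \<omega>))"
    using D.dynkin by simp
  also have "\<dots> \<le> expectation (\<lambda>_. B) - expectation (\<lambda>_. 0)"
  proof (rule diff_mono; rule Bochner_Integration.integral_mono)
    fix \<omega> assume \<omega>: "\<omega> \<in> space M"
    show "\<phi> (X 0 \<omega>) \<le> B" using bspec[OF tf X_range[OF \<omega> order_refl]] by blast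
    show "0 \<le> \<phi> (X t \<omega>)" using bspec[OF tf X_range[OF \<omega> t]] by blast
  qed (use iphi t in auto)
  also have "\<dots> = B" by (simp add: prob_space)
  finally show ?thesis .
qed

text \<open>\<open>Xt\<close> extends the path constantly to negative times, which the indicator
  removes again. Values are extended reals since the integral over the half-line may be
  infinite.\<close>

definition occupation :: "(real \<Rightarrow> real) \<Rightarrow> 'w \<times> real \<Rightarrow> ennreal" where
  "occupation \<rho> x = ennreal (\<rho> (Xt x)) * indicator {0..} (snd x)"

text \<open>Fatou's lemma takes two limits at once: \<open>\<rho> n\<close> tends to
  \<open>\<rho>'\<close> while the horizon \<open>real n\<close> grows. The limit may be
  discontinuous, so its measurability is also obtained from the pointwise limit.\<close>

lemma mean_occupation:
  assumes gb: "\<And>n::nat. generator_bound a b f g (\<rho> n) B" and \<rho>: "\<And>n. continuous_on {a..b} (\<rho> n)"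
    and nonneg: "\<And>n x. x \<in> {a..b} \<Longrightarrow> 0 \<le> \<rho> n x"
    and lim: "\<And>x. x \<in> {a..b} \<Longrightarrow> (\<lambda>n. \<rho> n x) \<longlonglongrightarrow> \<rho>' x"
  shows "occupation \<rho>' \<in> borel_measurable MT"
    "(\<integral>\<^sup>+x. occupation \<rho>' x \<partial>MT) \<le> ennreal B"
proof -
  define u where "u n x = ennreal (\<rho> n (Xt x) * indicator {0..<real n} (snd x))"
    for n and x :: "'w \<times> real"
  note [measurable] = function_X_jointly_measurable[OF \<rho>]
  have um[measurable]: "u n \<in> borel_measurable MT" for n
    unfolding u_def[abs_def] by measurable
  have range: "Xt x \<in> {a..b}" if "x \<in> space MT" for x
    using that by (intro X_range) (auto simp: space_pair_measure)
  have eq: "occupation \<rho>' x = liminf (\<lambda>n. u n x)" if x: "x \<in> space MT" for x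
  proof -
    have "(\<lambda>n. \<rho> n (Xt x) * indicator {0..<real n} (snd x))
      \<longlonglongrightarrow> \<rho>' (Xt x) * indicator {0..} (snd x)"
    proof (intro tendsto_mult lim range[OF x] tendsto_eventually)
      obtain N :: nat where "snd x < real N" using reals_Archimedean2 by blast
      then show "\<forall>\<^sub>F n in sequentially. indicator {0..<real n} (snd x) = (indicator {0..} (snd x) :: real)"
        by (intro eventually_sequentiallyI[of N]) (auto simp: indicator_def)
    qed
    then have "(\<lambda>n. u n x) \<longlonglongrightarrow> ennreal (\<rho>' (Xt x) * indicator {0..} (snd x))"
      unfolding u_def by (rule tendsto_ennrealI)
    also have "ennreal (\<rho>' (Xt x) * indicator {0..} (snd x)) = occupation \<rho>' x"
      by (cases "0 \<le> snd x") (simp_all add: occupation_def)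
    finally show ?thesis by (rule lim_imp_Liminf[OF sequentially_bot, symmetric])
  qed
  show "occupation \<rho>' \<in> borel_measurable MT"
    by (subst measurable_cong[OF eq]) measurable
  have "(\<integral>\<^sup>+x. u n x \<partial>MT) \<le> ennreal B" for n
  proof -
    have "(\<integral>\<^sup>+x. u n x \<partial>MT) = ennreal (expectation (path_integral (\<rho> n) 0 (real n)))"
      using nonneg[OF range]
        product_path_integral[OF \<rho>, of 0 "real n" "\<lambda>_. 1" 1]
      unfolding u_def by (subst nn_integral_eq_integral) auto
    also have "\<dots> \<le> ennreal B"
      by (rule ennreal_leI[OF expectation_path_integral_le[OF gb \<rho>]]) simp
    finally show ?thesis .
  qed
  then have "liminf (\<lambda>n. \<integral>\<^sup>+x. u n x \<partial>MT) \<le> ennreal B"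
    by (intro order_trans[OF Liminf_le_Limsup Limsup_bounded]) auto
  moreover have "(\<integral>\<^sup>+x. occupation \<rho>' x \<partial>MT) = (\<integral>\<^sup>+x. liminf (\<lambda>n. u n x) \<partial>MT)"
    by (rule nn_integral_cong[OF eq])
  moreover have "\<dots> \<le> liminf (\<lambda>n. \<integral>\<^sup>+x. u n x \<partial>MT)"
    by (rule nn_integral_liminf) measurable
  ultimately show "(\<integral>\<^sup>+x. occupation \<rho>' x \<partial>MT) \<le> ennreal B" by (simp only: order_trans)
qed

definition finite_occupation :: "(real \<Rightarrow> real) \<Rightarrow> bool" where
  "finite_occupation \<rho> \<longleftrightarrow> occupation \<rho> \<in> borel_measurable MT \<and>
    (\<integral>\<^sup>+x. occupation \<rho> x \<partial>MT) < \<infinity>"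

text \<open>Here \<open>d\<close> is the distance to an endpoint and
  \<open>\<epsilon> = 1 / (n + 1)\<close>: the factor \<open>d / (d + \<epsilon>)\<close> tends to 1
  where \<open>d\<close> is positive and is 0 at the endpoint itself.\<close>

lemma finite_occupation_limit:
  assumes gb: "\<exists>c B. 0 < c \<and> 0 \<le> B \<and> (\<forall>\<epsilon>. 0 < \<epsilon> \<longrightarrow> \<epsilon> \<le> 1 \<longrightarrow>
      generator_bound a b f g (\<lambda>x. c * (w x * d x / (d x + \<epsilon>))) B)"
    and w: "\<And>x. x \<in> {a..b} \<Longrightarrow> 0 \<le> w x" "continuous_on {a..b} w"
    and d: "\<And>x. x \<in> {a..b} \<Longrightarrow> 0 \<le> d x" "continuous_on {a..b} d"
  shows "\<exists>c>0. finite_occupation (\<lambda>x. c * (if d x = 0 then 0 else w x))"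
proof -
  obtain c B where c: "0 < c" and gb: "\<forall>\<epsilon>. 0 < \<epsilon> \<longrightarrow> \<epsilon> \<le> 1 \<longrightarrow>
    generator_bound a b f g (\<lambda>x. c * (w x * d x / (d x + \<epsilon>))) B"
    using gb by (elim exE conjE)
  let ?\<rho> = "\<lambda>n x. c * (w x * d x / (d x + 1 / real (Suc n)))"
  have pos: "0 < d x + 1 / real (Suc n)" if "x \<in> {a..b}" for x n
    using d(1)[OF that] by (intro add_nonneg_pos) auto
  have 1: "generator_bound a b f g (?\<rho> n) B" for n
    by (rule gb[rule_format]) simp_all
  have 2: "continuous_on {a..b} (?\<rho> n)" for n
    using pos[of _ n] by (intro continuous_intros w(2) d(2)) (metis less_irrefl)
  have 3: "0 \<le> ?\<rho> n x" if "x \<in> {a..b}" for n x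
    using c w(1)[OF that] d(1)[OF that] pos[OF that, of n]
    by (intro mult_nonneg_nonneg divide_nonneg_pos) auto
  have 4: "(\<lambda>n. ?\<rho> n x) \<longlonglongrightarrow> c * (if d x = 0 then 0 else w x)" for x
  proof (cases "d x = 0")
    case False
    have "(\<lambda>n. ?\<rho> n x) \<longlonglongrightarrow> c * (w x * d x / (d x + 0))"
      using False by (intro tendsto_intros LIMSEQ_Suc[OF lim_1_over_n]) simp
    then show ?thesis using False by simp
  qed simp
  from mean_occupation[OF 1 2 3 4] show ?thesis
    using c unfolding finite_occupation_def by (intro exI[of _ c]) (auto intro: le_less_trans)
qed

lemma finite_occupation_at_left_end:
  assumes ab: "a < b" and C: "0 < C"
    and fg: "\<And>x. x \<in> {a..b} \<Longrightarrow> f x \<le> C * g x"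
    and w: "\<And>x. x \<in> {a..b} \<Longrightarrow> 0 \<le> w x" "continuous_on {a..b} w"
      "\<And>x. x \<in> {a..b} \<Longrightarrow> w x * (x - a) \<le> (C * g x - f x) * (x - a) + g x"
  shows "\<exists>c>0. finite_occupation (\<lambda>x. c * (if x = a then 0 else w x))"
proof -
  have "\<exists>c>0. finite_occupation (\<lambda>x. c * (if x - a = 0 then 0 else w x))"
    by (rule finite_occupation_limit[OF generator_bound_at_left_end[OF ab C diffusion_nonneg fg w(3)] w(1,2)])
       (auto intro!: continuous_intros)
  then show ?thesis by simp
qed

lemma finite_occupation_at_right_end:
  assumes ab: "a < b" and C: "0 < C"
    and fg: "\<And>x. x \<in> {a..b} \<Longrightarrow> - f x \<le> C * g x"
    and w: "\<And>x. x \<in> {a..b} \<Longrightarrow> 0 \<le> w x" "continuous_on {a..b} w"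
      "\<And>x. x \<in> {a..b} \<Longrightarrow> w x * (b - x) \<le> (C * g x + f x) * (b - x) + g x"
  shows "\<exists>c>0. finite_occupation (\<lambda>x. c * (if x = b then 0 else w x))"
proof -
  have "\<exists>c>0. finite_occupation (\<lambda>x. c * (if b - x = 0 then 0 else w x))"
    by (rule finite_occupation_limit[OF generator_bound_at_right_end[OF ab C diffusion_nonneg fg w(3)] w(1,2)])
       (auto intro!: continuous_intros)
  then show ?thesis by (simp add: eq_commute[of b])
qed

text \<open>The entry time is the Lebesgue measure of the set of times preceding it, and at all
  these times the path is outside \<open>A\<close>.\<close>

lemma entry_time_le_occupation:
  assumes U: "\<And>r. 0 \<le> r \<Longrightarrow> X r \<omega> \<notin> A \<Longrightarrow> 1 \<le> k * U r"
  shows "entry_time X A \<omega> \<le> (\<integral>\<^sup>+r. k * U r \<partial>lborel)"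
proof -
  let ?\<tau> = "entry_time X A \<omega>"
  let ?S = "{r. 0 \<le> r \<and> ennreal r < ?\<tau>}"
  have S: "?S = {0..} \<and> ?\<tau> = \<infinity> \<or> (\<exists>t\<ge>0. ?S = {0..<t} \<and> ?\<tau> = ennreal t)"
    by (cases ?\<tau>) (auto simp: ennreal_less_iff)
  have [measurable]: "?S \<in> sets lborel" using S by auto
  have "emeasure lborel ({0..} :: real set) = \<infinity>"
  proof -
    have "ennreal (real n) \<le> emeasure lborel ({0..} :: real set)" for n :: nat
      using emeasure_mono[of "{0..real n}" "{0..}" lborel] by simp
    then show ?thesis using ennreal_Ex_less_of_nat[of "emeasure lborel ({0..} :: real set)"]
      by (metis ennreal_of_nat_eq_real_of_nat infinity_ennreal_def not_less top.not_eq_extremum)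
  qed
  then have "?\<tau> = emeasure lborel ?S" using S by auto
  also have "\<dots> = (\<integral>\<^sup>+r. indicator ?S r \<partial>lborel)" by simp
  also have "\<dots> \<le> (\<integral>\<^sup>+r. k * U r \<partial>lborel)"
  proof (rule nn_integral_mono)
    fix r :: real
    show "indicator ?S r \<le> k * U r"
    proof (cases "r \<in> ?S")
      case True
      have "?\<tau> \<le> ennreal r" if "X r \<omega> \<in> A"
        unfolding entry_time_def using that True by (intro INF_lower) simp
      then have "X r \<omega> \<notin> A" using True by auto
      then show ?thesis using U[of r] True by (simp add: indicator_def)
    qed simp
  qed
  finally show ?thesis .
qed

text \<open>The pathwise bound is integrated by Tonelli; monotonicity of the nonnegative integral
  does not involve measurability of the entry time. The two densities serve the two endpoints, and
  with one absorbing endpoint the same density is supplied twice.\<close>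

lemma mean_entry_time_finite:
  assumes fin: "finite_occupation \<rho>1" "finite_occupation \<rho>2" and k: "0 < k"
    and nonneg: "\<And>x. x \<in> {a..b} \<Longrightarrow> 0 \<le> \<rho>1 x" "\<And>x. x \<in> {a..b} \<Longrightarrow> 0 \<le> \<rho>2 x"
    and le: "\<And>x. x \<in> {a..b} \<Longrightarrow> x \<notin> A \<Longrightarrow> k \<le> \<rho>1 x + \<rho>2 x"
  shows "(\<integral>\<^sup>+\<omega>. entry_time X A \<omega> \<partial>M) < \<infinity>"
proof -
  let ?U = "\<lambda>x. occupation \<rho>1 x + occupation \<rho>2 x" and ?k = "ennreal (1 / k)"
  have [measurable]: "occupation \<rho>1 \<in> borel_measurable MT"
    "occupation \<rho>2 \<in> borel_measurable MT"
    using fin by (simp_all add: finite_occupation_def)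
  have U: "1 \<le> ?k * ?U (\<omega>, r)" if \<omega>: "\<omega> \<in> space M" and r: "0 \<le> r" and X: "X r \<omega> \<notin> A" for \<omega> r
  proof -
    note x = X_range[OF \<omega> r]
    have "1 \<le> 1 / k * (\<rho>1 (X r \<omega>) + \<rho>2 (X r \<omega>))" using le[OF x X] k by (simp add: pos_le_divide_eq)
    then have "ennreal 1 \<le> ennreal (1 / k * (\<rho>1 (X r \<omega>) + \<rho>2 (X r \<omega>)))" by (rule ennreal_leI)
    also have "\<dots> = ?k * ?U (\<omega>, r)"
      using k r nonneg[OF x] by (simp add: occupation_def ennreal_mult ennreal_plus del: times_divide_eq_left)
    finally show ?thesis by simp
  qed
  have "(\<integral>\<^sup>+\<omega>. entry_time X A \<omega> \<partial>M) \<le> (\<integral>\<^sup>+\<omega>. \<integral>\<^sup>+r. ?k * ?U (\<omega>, r) \<partial>lborel \<partial>M)"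
    by (intro nn_integral_mono entry_time_le_occupation U)
  also have "\<dots> = (\<integral>\<^sup>+x. ?k * ?U x \<partial>MT)"
    by (rule lborel.nn_integral_fst) measurable
  also have "\<dots> = ?k * (\<integral>\<^sup>+x. ?U x \<partial>MT)"
    by (rule nn_integral_cmult) measurable
  also have "(\<integral>\<^sup>+x. ?U x \<partial>MT)
      = (\<integral>\<^sup>+x. occupation \<rho>1 x \<partial>MT) + (\<integral>\<^sup>+x. occupation \<rho>2 x \<partial>MT)"
    by (rule nn_integral_add) measurable
  also have "?k * \<dots> < \<infinity>"
    using fin by (simp add: finite_occupation_def ennreal_mult_less_top)
  finally show ?thesis .
qed

end

section \<open>Coefficients near the boundary\<close>

lemma C2_extension_lipschitz:
  assumes "C2_extension a b h hx"
  shows "continuous_on {a..b} h" "\<exists>L\<ge>0. \<forall>x\<in>{a..b}. \<forall>y\<in>{a..b}. \<bar>h x - h y\<bar> \<le> L * \<bar>x - y\<bar>"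
proof -
  obtain l u h' h'' where lu: "l < a" "b < u"
    and d: "\<forall>x\<in>{l<..<u}. (hx has_real_derivative h' x) (at x) \<and> (h' has_real_derivative h'' x) (at x)"
    and eq: "\<forall>x\<in>{a..b}. hx x = h x"
    using assms unfolding C2_extension_def C2_on_def by (elim exE conjE)
  have d': "(hx has_real_derivative h' x) (at x)" "(h' has_real_derivative h'' x) (at x)" if "x \<in> {a..b}" for x
    using d lu that by auto
  have c: "continuous_on {a..b} hx" "continuous_on {a..b} h'"
    using d' by (meson DERIV_isCont continuous_at_imp_continuous_on)+
  show "continuous_on {a..b} h" using c(1) by (rule continuous_on_eq) (use eq in auto)
  obtain L where L: "\<forall>x\<in>{a..b}. \<bar>h' x\<bar> \<le> L" using continuous_on_Icc_bounded[OF c(2)] by blast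
  have "\<bar>h x - h y\<bar> \<le> \<bar>L\<bar> * \<bar>x - y\<bar>" if xy: "x \<in> {a..b}" "y \<in> {a..b}" for x y
  proof -
    have "norm (hx x - hx y) \<le> \<bar>L\<bar> * norm (x - y)"
    proof (rule field_differentiable_bound[OF convex_real_interval(5) _ _ xy])
      fix z assume z: "z \<in> {a..b}"
      show "(hx has_field_derivative h' z) (at z within {a..b})"
        using d'(1)[OF z] by (rule DERIV_subset) simp
      show "norm (h' z) \<le> \<bar>L\<bar>" using bspec[OF L z] by simp
    qed
    then show ?thesis using eq xy by simp
  qed
  then show "\<exists>L\<ge>0. \<forall>x\<in>{a..b}. \<forall>y\<in>{a..b}. \<bar>h x - h y\<bar> \<le> L * \<bar>x - y\<bar>"
    by (intro exI[of _ "\<bar>L\<bar>"]) simp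
qed

text \<open>Nonnegativity to the right of \<open>a\<close> makes the nonzero derivative
  \<open>D\<close> positive, so the difference quotient eventually exceeds
  \<open>D / 2\<close>.\<close>

lemma linear_growth_at_simple_zero:
  fixes h :: "real \<Rightarrow> real"
  assumes ab: "a < b" and d: "(h has_real_derivative D) (at a)" "D \<noteq> 0" "h a = 0"
    and nonneg: "\<And>x. x \<in> {a..b} \<Longrightarrow> 0 \<le> h x"
  shows "\<exists>c>0. \<exists>e>a. \<forall>x\<in>{a..<e}. c * (x - a) \<le> h x"
proof -
  have "((\<lambda>x. (h x - h a) / (x - a)) \<longlongrightarrow> D) (at a)"
    using d(1) by (simp add: has_field_derivative_iff)
  then have lim: "((\<lambda>x. h x / (x - a)) \<longlongrightarrow> D) (at_right a)"
    using d(3) by (simp add: filterlim_at_split)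
  have "\<forall>\<^sub>F x in at_right a. 0 \<le> h x / (x - a)"
    using eventually_at_right_real[OF ab] by eventually_elim (use nonneg in auto)
  then have "0 \<le> D" by (rule tendsto_lowerbound[OF lim]) simp
  then have D: "D / 2 < D" using d(2) by simp
  have "\<forall>\<^sub>F x in at_right a. D / 2 < h x / (x - a)"
    by (rule order_tendstoD(1)[OF lim D])
  then obtain e where e: "e > a" "\<forall>x>a. x < e \<longrightarrow> D / 2 < h x / (x - a)"
    unfolding eventually_at_right_field by blast
  have "D / 2 * (x - a) \<le> h x" if x: "x \<in> {a..<e}" for x
  proof (cases "x = a")
    case False
    then have "a < x" using x by simp
    then show ?thesis using e(2) x by (auto simp: pos_less_divide_eq intro: less_imp_le)
  qed (simp add: d(3))
  then show ?thesis using e(1) \<open>0 \<le> D\<close> d(2) by (intro exI[of _ "D / 2"]) auto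
qed

text \<open>Near each endpoint \<open>g\<close> grows at least linearly, the right end being treated
  by reflection; on the compact middle part it has a positive minimum.\<close>

lemma quadratic_lower_bound:
  assumes ab: "a < b" and C2: "C2_extension a b g gx"
    and nonneg: "\<And>x. x \<in> {a..b} \<Longrightarrow> 0 \<le> g x"
    and zeros: "\<And>x. x \<in> {a..b} \<Longrightarrow> g x = 0 \<longleftrightarrow> x \<in> {a, b}"
    and da: "deriv gx a \<noteq> 0" and db: "deriv gx b \<noteq> 0"
  shows "\<exists>\<kappa>>0. \<forall>x\<in>{a..b}. \<kappa> * ((x - a) * (b - x)) \<le> g x"
proof -
  obtain l u h' h'' where lu: "l < a" "b < u"
    and d: "\<forall>x\<in>{l<..<u}. (gx has_real_derivative h' x) (at x) \<and> (h' has_real_derivative h'' x) (at x)"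
    and eq: "\<forall>x\<in>{a..b}. gx x = g x"
    using C2 unfolding C2_extension_def C2_on_def by (elim exE conjE)
  have d': "(gx has_real_derivative h' x) (at x)" if "x \<in> {a..b}" for x
    using d lu that by auto
  have ends: "a \<in> {a..b}" "b \<in> {a..b}" using ab by auto
  have h': "h' a \<noteq> 0" "h' b \<noteq> 0"
    using da db DERIV_imp_deriv[OF d'[OF ends(1)]] DERIV_imp_deriv[OF d'[OF ends(2)]] by simp_all
  have gx0: "gx a = 0" "gx b = 0" using eq zeros ends by auto
  have "\<exists>c>0. \<exists>e>a. \<forall>x\<in>{a..<e}. c * (x - a) \<le> gx x"
    by (rule linear_growth_at_simple_zero[OF ab d'[OF ends(1)] h'(1) gx0(1)]) (use eq nonneg in auto)
  then obtain c1 e1 where c1: "0 < c1" and e1: "a < e1" "\<forall>x\<in>{a..<e1}. c1 * (x - a) \<le> gx x" by blast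
  have "\<exists>c>0. \<exists>e>a. \<forall>x\<in>{a..<e}. c * (x - a) \<le> gx (a + b - x)"
  proof (rule linear_growth_at_simple_zero[OF ab])
    have "((\<lambda>x. a + b - x) has_real_derivative -1) (at a)"
      by (auto intro!: derivative_eq_intros)
    from DERIV_chain2[OF _ this, of gx "h' b"] d'[OF ends(2)]
    show "((\<lambda>x. gx (a + b - x)) has_real_derivative - h' b) (at a)" by simp
    show "0 \<le> gx (a + b - x)" if "x \<in> {a..b}" for x
      using eq nonneg[of "a + b - x"] that by auto
  qed (use h' gx0 in auto)
  then obtain c2 e2 where c2: "0 < c2" and e2: "a < e2" "\<forall>x\<in>{a..<e2}. c2 * (x - a) \<le> gx (a + b - x)" by blast
  have "\<exists>m>0. \<forall>x\<in>{e1..a + b - e2}. m \<le> g x"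
  proof (cases "{e1..a + b - e2} = {}")
    case False
    have sub: "{e1..a + b - e2} \<subseteq> {a<..<b}" using e1 e2 by auto
    have "continuous_on {e1..a + b - e2} g"
      by (rule continuous_on_subset[OF C2_extension_lipschitz(1)[OF C2]]) (use sub in auto)
    from continuous_attains_inf[OF compact_Icc False this]
    obtain z where z: "z \<in> {e1..a + b - e2}" "\<forall>y\<in>{e1..a + b - e2}. g z \<le> g y" by blast
    have "z \<in> {a<..<b}" using z(1) sub by blast
    then have "0 < g z" using nonneg[of z] zeros[of z] by (auto simp: less_le)
    then show ?thesis using z(2) by blast
  qed (auto intro: exI[of _ 1])
  then obtain m where m: "0 < m" "\<forall>x\<in>{e1..a + b - e2}. m \<le> g x" by blast
  \<comment> \<open>In each of the three regions the factors of \<open>(x - a) * (b - x)\<close>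
    that do not help are bounded by \<open>b - a\<close>; this gives the three candidates for
    \<open>\<kappa>\<close>.\<close>
  define \<kappa> where "\<kappa> = min (c1 / (b - a)) (min (c2 / (b - a)) (m / ((b - a) * (b - a))))"
  have \<kappa>: "0 < \<kappa>" using c1 c2 m ab by (simp add: \<kappa>_def)
  have \<kappa>le: "\<kappa> \<le> c1 / (b - a)" "\<kappa> \<le> c2 / (b - a)" "\<kappa> \<le> m / ((b - a) * (b - a))" by (auto simp: \<kappa>_def)
  have "\<kappa> * ((x - a) * (b - x)) \<le> g x" if x: "x \<in> {a..b}" for x
  proof -
    have pos: "0 \<le> x - a" "0 \<le> b - x" "x - a \<le> b - a" "b - x \<le> b - a" using x by auto
    consider "x < e1" | "a + b - e2 < x" | "x \<in> {e1..a + b - e2}" by fastforce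
    then show ?thesis
    proof cases
      case 1
      have "\<kappa> * ((x - a) * (b - x)) \<le> c1 / (b - a) * ((x - a) * (b - a))"
        using pos \<kappa>le \<kappa> c1 ab by (intro mult_mono) auto
      also have "\<dots> = c1 * (x - a)" using ab by simp
      also have "\<dots> \<le> g x" using bspec[OF e1(2), of x] bspec[OF eq x] 1 x by simp
      finally show ?thesis .
    next
      case 2
      have "\<kappa> * ((x - a) * (b - x)) \<le> c2 / (b - a) * ((b - a) * (b - x))"
        using pos \<kappa>le \<kappa> c2 ab by (intro mult_mono) auto
      also have "\<dots> = c2 * (b - x)" using ab by simp
      also have "\<dots> \<le> g x" using bspec[OF e2(2), of "a + b - x"] 2 x eq by simp
      finally show ?thesis .
    next
      case 3
      have "\<kappa> * ((x - a) * (b - x)) \<le> m / ((b - a) * (b - a)) * ((b - a) * (b - a))"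
        using pos \<kappa>le \<kappa> m ab by (intro mult_mono) auto
      also have "\<dots> = m" using ab by simp
      also have "\<dots> \<le> g x" using m(2) 3 by blast
      finally show ?thesis .
    qed
  qed
  then show ?thesis using \<kappa> by blast
qed

text \<open>Since \<open>b - a = (b - x) + (x - a)\<close>, using the bound at \<open>a\<close> with
  the first summand and the bound at \<open>b\<close> with the second gives
  \<open>\<bar>f x\<bar> * (b - a) \<le> 2 * L * (x - a) * (b - x)\<close>, a multiple of the lower
  bound for \<open>g\<close>.\<close>

lemma drift_dominated_by_diffusion:
  fixes f g :: "real \<Rightarrow> real"
  assumes ab: "a < b" and \<kappa>: "0 < \<kappa>" and L: "0 \<le> L"
    and fa: "\<And>x. x \<in> {a..b} \<Longrightarrow> \<bar>f x\<bar> \<le> L * (x - a)"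
    and fb: "\<And>x. x \<in> {a..b} \<Longrightarrow> \<bar>f x\<bar> \<le> L * (b - x)"
    and g: "\<And>x. x \<in> {a..b} \<Longrightarrow> \<kappa> * ((x - a) * (b - x)) \<le> g x"
  shows "\<exists>C>0. \<forall>x\<in>{a..b}. \<bar>f x\<bar> \<le> C * g x"
proof -
  define C where "C = 2 * L / (\<kappa> * (b - a)) + 1"
  have C: "0 < C" using L \<kappa> ab by (simp add: C_def add_nonneg_pos)
  have "\<bar>f x\<bar> \<le> C * g x" if x: "x \<in> {a..b}" for x
  proof -
    have pos: "0 \<le> (x - a) * (b - x)" using x by simp
    have "\<bar>f x\<bar> * (b - a) = \<bar>f x\<bar> * (b - x) + \<bar>f x\<bar> * (x - a)" by (simp add: algebra_simps)
    also have "\<dots> \<le> (L * (x - a)) * (b - x) + (L * (b - x)) * (x - a)"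
      using fa[OF x] fb[OF x] x by (intro add_mono mult_right_mono) auto
    also have "\<dots> = 2 * L * ((x - a) * (b - x))" by (simp add: algebra_simps)
    finally have "\<bar>f x\<bar> \<le> 2 * L * ((x - a) * (b - x)) / (b - a)"
      using ab by (simp add: pos_le_divide_eq)
    also have "\<dots> = 2 * L / (\<kappa> * (b - a)) * (\<kappa> * ((x - a) * (b - x)))" using \<kappa> by simp
    also have "\<dots> \<le> C * (\<kappa> * ((x - a) * (b - x)))"
      using \<kappa> pos by (intro mult_right_mono) (auto simp: C_def)
    also have "\<dots> \<le> C * g x" using g[OF x] C by simp
    finally show ?thesis .
  qed
  then show ?thesis using C by blast
qed

text \<open>Near \<open>b\<close> the inward drift alone gives the second inequality. Away from
  \<open>b\<close>, \<open>g\<close> is at least a multiple of \<open>x - a\<close>, which both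
  dominates the drift and supplies the lower bound.\<close>

lemma drift_dominated_inward:
  fixes f g :: "real \<Rightarrow> real"
  assumes ab: "a < b" and \<kappa>: "0 < \<kappa>" and L: "0 \<le> L" and fb0: "f b < 0"
    and fa: "\<And>x. x \<in> {a..b} \<Longrightarrow> \<bar>f x\<bar> \<le> L * (x - a)"
    and fb: "\<And>x. x \<in> {a..b} \<Longrightarrow> \<bar>f x - f b\<bar> \<le> L * (b - x)"
    and g: "\<And>x. x \<in> {a..b} \<Longrightarrow> \<kappa> * ((x - a) * (b - x)) \<le> g x"
  shows "\<exists>C>0. \<exists>k>0. \<forall>x\<in>{a..b}. f x \<le> C * g x \<and> k * (x - a) \<le> (C * g x - f x) * (x - a) + g x"
proof -
  \<comment> \<open>\<open>\<eta>\<close> is half the inward drift at \<open>b\<close>, and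
    \<open>L * d \<le> \<eta>\<close> keeps the drift below \<open>- \<eta>\<close> within distance
    \<open>d\<close> of \<open>b\<close>. Farther away
    \<open>g x \<ge> \<kappa> * d * (x - a)\<close>, which determines \<open>C\<close> and the
    second candidate for \<open>k\<close>; the added 1 keeps \<open>C\<close> positive when
    \<open>L = 0\<close>.\<close>
  define \<eta> where "\<eta> = - f b / 2"
  define d where "d = \<eta> / (L + 1)"
  define C where "C = L / (\<kappa> * d) + 1"
  define k where "k = min \<eta> (\<kappa> * d)"
  have \<eta>: "0 < \<eta>" using fb0 by (simp add: \<eta>_def)
  have d: "0 < d" using \<eta> L by (simp add: d_def)
  have C: "0 < C" using L \<kappa> d by (simp add: C_def add_nonneg_pos)
  have k: "0 < k" "k \<le> \<eta>" "k \<le> \<kappa> * d" using \<eta> \<kappa> d by (simp_all add: k_def)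
  have "f x \<le> C * g x \<and> k * (x - a) \<le> (C * g x - f x) * (x - a) + g x" if x: "x \<in> {a..b}" for x
  proof -
    have xa: "0 \<le> x - a" "0 \<le> b - x" using x by auto
    have g0: "0 \<le> g x" using g[OF x] \<kappa> xa by (meson mult_nonneg_nonneg less_imp_le order_trans)
    show ?thesis
    proof (cases "b - x \<le> d")
      case True
      have "L * (b - x) \<le> L * d" using True L by (rule mult_left_mono)
      also have "\<dots> \<le> \<eta>" using \<eta> L by (simp add: d_def pos_divide_le_eq algebra_simps)
      finally have f: "f x \<le> - \<eta>" using fb[OF x] by (simp add: \<eta>_def)
      have "0 \<le> C * g x" using C g0 by simp
      then have "k \<le> C * g x - f x" using f k(2) by linarith
      then have "k * (x - a) \<le> (C * g x - f x) * (x - a)" using xa(1) by (rule mult_right_mono)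
      then show ?thesis using f \<eta> \<open>0 \<le> C * g x\<close> g0 by linarith
    next
      case False
      have "\<kappa> * d * (x - a) \<le> \<kappa> * ((x - a) * (b - x))"
        using False \<kappa> xa by (simp add: mult.assoc mult.commute[of d] mult_left_mono)
      also note g[OF x]
      finally have gd: "\<kappa> * d * (x - a) \<le> g x" .
      have "f x \<le> L * (x - a)" using fa[OF x] by simp
      also have "\<dots> = L / (\<kappa> * d) * (\<kappa> * d * (x - a))" using \<kappa> d by simp
      also have "\<dots> \<le> L / (\<kappa> * d) * g x" using gd L \<kappa> d by (intro mult_left_mono) auto
      also have "\<dots> \<le> C * g x" using g0 by (intro mult_right_mono) (auto simp: C_def)
      finally have f: "f x \<le> C * g x" .
      have "k * (x - a) \<le> \<kappa> * d * (x - a)" using k(3) xa(1) by (rule mult_right_mono)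
      moreover have "0 \<le> (C * g x - f x) * (x - a)" using f xa(1) by simp
      ultimately show ?thesis using gd f by linarith
    qed
  qed
  then show ?thesis using C k(1) by blast
qed

section \<open>Absorbing endpoints and the conclusion\<close>

lemma (in brownian_motion) has_ito_integral_zero:
  assumes "0 \<le> t"
  shows "has_ito_integral M F W t (\<lambda>s \<omega>. 0) (\<lambda>\<omega>. 0)"
  unfolding has_ito_integral_def
proof (intro conjI)
  show "ito_integrand M F t (\<lambda>s \<omega>. 0)" by (simp add: ito_integrand_def)
  show "\<exists>n p \<xi>. (\<forall>k::nat. elementary_integrand M F t (n k) (p k) (\<xi> k)) \<and>
        (\<lambda>k. \<integral>\<^sup>+\<omega>. (\<integral>\<^sup>+s\<in>{0..t}.
            ennreal ((elementary_process (n k) (p k) (\<xi> k) s \<omega> - 0)\<^sup>2) \<partial>lborel) \<partial>M) \<longlonglongrightarrow> 0 \<and>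
        (\<lambda>k. \<integral>\<^sup>+\<omega>. ennreal ((elementary_integral W (n k) (p k) (\<xi> k) \<omega> - 0)\<^sup>2) \<partial>M) \<longlonglongrightarrow> 0"
  \<comment> \<open>A single block on \<open>[0, t]\<close> with coefficient zero; an empty
    partition would force \<open>t = 0\<close>.\<close>
  proof (rule exI[of _ "\<lambda>k. 1"], rule exI[of _ "\<lambda>k i. if i = 0 then 0 else t"], rule exI[of _ "\<lambda>k i \<omega>. 0"],
      intro conjI allI)
    show "elementary_integrand M F t 1 (\<lambda>i. if i = 0 then 0 else t) (\<lambda>i \<omega>. 0)"
      using assms by (auto simp: elementary_integrand_def)
  qed (simp_all add: elementary_process_def elementary_integral_def)
qed simp

text \<open>If the constant process is a solution, its martingale part over \<open>[0, 1]\<close> is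
  the number \<open>- f c\<close>, whose mean must vanish. Conversely, \<open>g c = 0\<close> makes
  the stochastic integral zero, and without drift the equation holds trivially.\<close>

lemma (in brownian_motion) absorbing_iff_drift_zero:
  assumes f: "continuous_on {a..b} f" and g: "continuous_on {a..b} g" "\<And>x. x \<in> {a..b} \<Longrightarrow> 0 \<le> g x"
    and c: "c \<in> {a..b}" "g c = 0"
  shows "absorbing M F W f g a b c \<longleftrightarrow> f c = 0"
proof
  assume "absorbing M F W f g a b c"
  then interpret S: bounded_sde M F W f g a b c "\<lambda>t \<omega>. c"
    by unfold_locales (use f g in \<open>auto simp: absorbing_def\<close>)
  have "expectation (\<lambda>\<omega>. 1 * S.martingale_part 0 1 \<omega>) = 0"
    by (rule S.martingale_part_moments(1)[where c=1]) auto
  then show "f c = 0"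
    by (simp add: S.martingale_part_def S.path_integral_def prob_space)
next
  assume fc: "f c = 0"
  show "absorbing M F W f g a b c"
    unfolding absorbing_def sde_solution_def using fc c has_ito_integral_zero
    by (auto intro!: exI[of _ "\<lambda>_. 0"])
qed

theorem theorem4p1:
  fixes a b :: real
    and f g fx gx :: "real \<Rightarrow> real"
    and M :: "'w measure" and F :: "real \<Rightarrow> 'w measure" and W :: "real \<Rightarrow> 'w \<Rightarrow> real"
    and X :: "real \<Rightarrow> real \<Rightarrow> 'w \<Rightarrow> real"
  assumes "a < b"
    and "C2_extension a b f fx" and "C2_extension a b g gx"
    and "\<And>x. x \<in> {a..b} \<Longrightarrow> 0 \<le> g x"
    and "\<And>x. x \<in> {a..b} \<Longrightarrow> g x = 0 \<longleftrightarrow> x \<in> {a, b}"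
    and "deriv gx a \<noteq> 0" and "deriv gx b \<noteq> 0"
    and "0 \<le> f a" and "f b \<le> 0"
    and "brownian_motion M F W"
    and "\<And>x0. x0 \<in> {a..b} \<Longrightarrow> sde_solution M F W f g a b x0 (X x0)"
    and "accessible M a b X a" and "accessible M a b X b"
    and "(absorbing M F W f g a b a \<and> (absorbing M F W f g a b b \<or> reflecting M a b X b)) \<or>
         (absorbing M F W f g a b b \<and> (absorbing M F W f g a b a \<or> reflecting M a b X a))"
  shows "\<forall>x0\<in>{a..b}.
    (\<integral>\<^sup>+\<omega>. entry_time (X x0) {c \<in> {a, b}. absorbing M F W f g a b c} \<omega> \<partial>M) < \<infinity>"
proof
  fix x0 assume x0: "x0 \<in> {a..b}"
  note ab = \<open>a < b\<close> and nonneg = assms(4)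
  have ends: "a \<in> {a..b}" "b \<in> {a..b}" using ab by auto
  have g0: "g a = 0" "g b = 0" using assms(5) ends by auto
  note cf = C2_extension_lipschitz(1)[OF assms(2)] and cg = C2_extension_lipschitz(1)[OF assms(3)]
  interpret brownian_motion M F W by (rule assms(10))
  interpret S: bounded_sde M F W f g a b x0 "X x0"
    by unfold_locales (rule assms(11)[OF x0] cf cg nonneg | assumption)+
  have absorbing: "absorbing M F W f g a b a \<longleftrightarrow> f a = 0" "absorbing M F W f g a b b \<longleftrightarrow> f b = 0"
    using absorbing_iff_drift_zero[OF cf cg nonneg ends(1) g0(1)]
      absorbing_iff_drift_zero[OF cf cg nonneg ends(2) g0(2)] by simp_all
  define A where "A = {c \<in> {a, b}. absorbing M F W f g a b c}"
  have A: "A = {c \<in> {a, b}. f c = 0}" using absorbing by (auto simp: A_def)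
  obtain L where L: "0 \<le> L" and lip: "\<forall>x\<in>{a..b}. \<forall>y\<in>{a..b}. \<bar>f x - f y\<bar> \<le> L * \<bar>x - y\<bar>"
    using C2_extension_lipschitz(2)[OF assms(2)] by blast
  have lipa: "\<bar>f x - f a\<bar> \<le> L * (x - a)" and lipb: "\<bar>f x - f b\<bar> \<le> L * (b - x)" if "x \<in> {a..b}" for x
    using bspec[OF bspec[OF lip that] ends(1)] bspec[OF bspec[OF lip that] ends(2)] that by auto
  obtain \<kappa> where \<kappa>: "0 < \<kappa>" and glow: "\<forall>x\<in>{a..b}. \<kappa> * ((x - a) * (b - x)) \<le> g x"
    using quadratic_lower_bound[OF ab assms(3-7)] by blast
  \<comment> \<open>At least one endpoint is absorbing and so has zero drift; at the other the drift
    is zero or, by the sign conditions, strictly inward.\<close>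
  consider "f a = 0" "f b = 0" | "f a = 0" "f b < 0" | "f b = 0" "0 < f a"
    using assms(8,9,14) absorbing by linarith
  then have "(\<integral>\<^sup>+\<omega>. entry_time (X x0) A \<omega> \<partial>M) < \<infinity>"
  proof cases
    case 1
    obtain C where C: "0 < C" and fC: "\<forall>x\<in>{a..b}. \<bar>f x\<bar> \<le> C * g x"
      using drift_dominated_by_diffusion[OF ab \<kappa> L, of f g] lipa lipb glow 1 by auto
    have fg: "f x \<le> C * g x" "- f x \<le> C * g x" if "x \<in> {a..b}" for x
      using bspec[OF fC that] by auto
    \<comment> \<open>The generator vanishes at \<open>b\<close> too, so the weight has to vanish
      there; with \<open>\<kappa> * (b - x)\<close> its product with \<open>x - a\<close> is
      precisely the lower bound for \<open>g\<close>.\<close>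
    have "\<exists>c>0. S.finite_occupation (\<lambda>x. c * (if x = a then 0 else \<kappa> * (b - x)))"
    proof (rule S.finite_occupation_at_left_end[OF ab C fg(1)])
      show "continuous_on {a..b} (\<lambda>x. \<kappa> * (b - x))" by (intro continuous_intros)
      fix x assume x: "x \<in> {a..b}"
      show "0 \<le> \<kappa> * (b - x)" using \<kappa> x by simp
      have "0 \<le> (C * g x - f x) * (x - a)" using fg(1)[OF x] x by simp
      then show "\<kappa> * (b - x) * (x - a) \<le> (C * g x - f x) * (x - a) + g x"
        using bspec[OF glow x] by (simp add: ac_simps)
    qed
    then obtain c1 where c1: "0 < c1" and
      o1: "S.finite_occupation (\<lambda>x. c1 * (if x = a then 0 else \<kappa> * (b - x)))"
      by (elim exE conjE)
    have "\<exists>c>0. S.finite_occupation (\<lambda>x. c * (if x = b then 0 else \<kappa> * (x - a)))"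
    proof (rule S.finite_occupation_at_right_end[OF ab C fg(2)])
      show "continuous_on {a..b} (\<lambda>x. \<kappa> * (x - a))" by (intro continuous_intros)
      fix x assume x: "x \<in> {a..b}"
      show "0 \<le> \<kappa> * (x - a)" using \<kappa> x by simp
      have "0 \<le> (C * g x + f x) * (b - x)" using fg(2)[OF x] x by simp
      then show "\<kappa> * (x - a) * (b - x) \<le> (C * g x + f x) * (b - x) + g x"
        using bspec[OF glow x] by (simp add: mult.assoc)
    qed
    then obtain c2 where c2: "0 < c2" and
      o2: "S.finite_occupation (\<lambda>x. c2 * (if x = b then 0 else \<kappa> * (x - a)))"
      by (elim exE conjE)
    \<comment> \<open>Off the endpoints the two densities together dominate a constant, because
      \<open>(b - x) + (x - a) = b - a\<close>.\<close>
    define c where "c = min c1 c2 * (\<kappa> * (b - a))"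
    show ?thesis
    proof (rule S.mean_entry_time_finite[OF o1 o2, of c])
      show "0 < c" using c1 c2 \<kappa> ab by (simp add: c_def)
      fix x assume x: "x \<in> {a..b}"
      show "0 \<le> c1 * (if x = a then 0 else \<kappa> * (b - x))" "0 \<le> c2 * (if x = b then 0 else \<kappa> * (x - a))"
        using c1 c2 \<kappa> x by auto
      assume "x \<notin> A"
      then have ne: "x \<noteq> a" "x \<noteq> b" using 1 by (auto simp: A)
      have "c = min c1 c2 * (\<kappa> * (b - x)) + min c1 c2 * (\<kappa> * (x - a))"
        by (simp add: c_def algebra_simps)
      also have "\<dots> \<le> c1 * (\<kappa> * (b - x)) + c2 * (\<kappa> * (x - a))"
        using \<kappa> x by (intro add_mono mult_right_mono) auto
      finally show "c \<le> c1 * (if x = a then 0 else \<kappa> * (b - x)) + c2 * (if x = b then 0 else \<kappa> * (x - a))"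
        using ne by simp
    qed
  next
    case 2
    have "\<exists>C>0. \<exists>k>0. \<forall>x\<in>{a..b}. f x \<le> C * g x \<and> k * (x - a) \<le> (C * g x - f x) * (x - a) + g x"
      by (rule drift_dominated_inward[OF ab \<kappa> L]) (use lipa lipb glow 2 in auto)
    then obtain C k where C: "0 < C" and k: "0 < k"
      and fg: "\<forall>x\<in>{a..b}. f x \<le> C * g x \<and> k * (x - a) \<le> (C * g x - f x) * (x - a) + g x" by blast
    have "\<exists>c>0. S.finite_occupation (\<lambda>x. c * (if x = a then 0 else k))"
      by (rule S.finite_occupation_at_left_end[OF ab C]) (use fg k in auto)
    then obtain c where c: "0 < c" and o: "S.finite_occupation (\<lambda>x. c * (if x = a then 0 else k))"
      by (elim exE conjE)
    show ?thesis
      by (rule S.mean_entry_time_finite[OF o o, of "c * k"]) (use c k 2 in \<open>auto simp: A\<close>)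
  next
    case 3
    \<comment> \<open>The reflected coefficients have zero drift at the left end and strictly inward
      drift at the right end, so the estimate of the previous case applies to them.\<close>
    have "\<exists>C>0. \<exists>k>0. \<forall>x\<in>{a..b}. - f (a + b - x) \<le> C * g (a + b - x) \<and>
      k * (x - a) \<le> (C * g (a + b - x) - - f (a + b - x)) * (x - a) + g (a + b - x)"
    proof (rule drift_dominated_inward[OF ab \<kappa> L])
      show "- f (a + b - b) < 0" using 3 by simp
      fix x assume "x \<in> {a..b}"
      then have y: "a + b - x \<in> {a..b}" by auto
      show "\<bar>- f (a + b - x)\<bar> \<le> L * (x - a)" using lipb[OF y] 3 by simp
      show "\<bar>- f (a + b - x) - - f (a + b - b)\<bar> \<le> L * (b - x)" using lipa[OF y] by simp
      show "\<kappa> * ((x - a) * (b - x)) \<le> g (a + b - x)" using bspec[OF glow y] by (simp add: ac_simps)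
    qed
    then obtain C k where C: "0 < C" and k: "0 < k"
      and fg: "\<forall>x\<in>{a..b}. - f (a + b - x) \<le> C * g (a + b - x) \<and>
        k * (x - a) \<le> (C * g (a + b - x) - - f (a + b - x)) * (x - a) + g (a + b - x)" by blast
    have fg': "- f x \<le> C * g x" "k * (b - x) \<le> (C * g x + f x) * (b - x) + g x" if "x \<in> {a..b}" for x
      using bspec[OF fg, of "a + b - x"] that by auto
    have "\<exists>c>0. S.finite_occupation (\<lambda>x. c * (if x = b then 0 else k))"
      by (rule S.finite_occupation_at_right_end[OF ab C fg'(1) _ _ fg'(2)]) (use k in auto)
    then obtain c where c: "0 < c" and o: "S.finite_occupation (\<lambda>x. c * (if x = b then 0 else k))"
      by (elim exE conjE)
    show ?thesis
      by (rule S.mean_entry_time_finite[OF o o, of "c * k"]) (use c k 3 in \<open>auto simp: A\<close>)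
  qed
  then show "(\<integral>\<^sup>+\<omega>. entry_time (X x0) {c \<in> {a, b}. absorbing M F W f g a b c} \<omega> \<partial>M) < \<infinity>"
    unfolding A_def .
qed

end
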